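(* Let $n\in\mathbb{N}$ and $\alpha>0$. Then there exists a Borel function $w\colon\mathbb{R}^{n}\to\mathbb{R}^{+}$ such that the measure $\mu:=w\mathcal{L}^{n}$ is doubling and the following hold. \begin{itemize} \item For every $p$ with $1\le p\leq 1+\alpha$ we have $\mathrm{Mod}_{p,\mu}(\Gamma_{c})=0$, where $\Gamma_{c}$ is the family of non constant absolutely continuous curves in $\mathbb{R}^{n}$. Consequently, for $1<p\le 1+\alpha$, the $p$-weak gradient on $(\mathbb{R}^{n},|\cdot|,\mu)$ is identically zero for every function: $|\nabla f|_{\mu,p}=0$ $\mu$-almost everywhere for every $f\colon\mathbb{R}^{n}\to\mathbb{R}$. \item For every $p>1+\alpha$ the function $w$ is a Muckenhoupt $A_{p}$-weight. Consequently, $\mu$ admits a weak $p$-Poincar\'{e} inequality, and the $p$-weak gradient on $(\mathbb{R}^{n},|\cdot|,\mu)$ agrees with the slope for Lipschitz functions: $|\nabla f|_{\mu,p}=|\nabla f|$ $\mu$-almost everywhere for every Lipschitz $f\colon\mathbb{R}^{n}\to\mathbb{R}$. \end{itemize}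
   Context: $\mathbb{R}^{+}=[0,\infty)$, $\mathcal{L}^n$ is Lebesgue measure on $\mathbb{R}^n$, $|A|=\mathcal{L}^n(A)$, and $\frac{1}{m(A)}\int_A f\,dm$ is denoted $f_A$. The same function $w$ works for all $p$. Curves. Let $(X,d)$ be a complete separable metric space with a $\sigma$-finite Borel measure $m$. A curve is a continuous map $\gamma\colon I\to X$ with $I\subset\mathbb{R}$ a closed bounded interval; $a_\gamma,b_\gamma\in X$ denote its end points. It is absolutely continuous if there is a Lebesgue integrable $g\colon I\to\mathbb{R}$ with $d(\gamma(s),\gamma(t))\le\int_s^t g(r)\,dr$ for all $s<t$ in $I$; the minimal such $g$ is the metric speed $|\dot\gamma|$. For Borel $f$ on $X$, $\int_\gamma f\,ds=\int_I f(\gamma(s))|\dot\gamma|(s)\,ds$. Only absolutely continuous curves are considered. Modulus. For $p\ge1$ and a family $\Gamma$ of absolutely continuous curves, $\mathrm{Mod}_{p,m}(\Gamma)=\inf\int_X g^p\,dm$, the infimum being over all Borel $g\colon X\to[0,\infty]$ with $\int_\gamma g\,ds\ge1$ for all $\gamma\in\Gamma$. A property holds for $p$-a.e. curve if the set of absolutely continuous curves for which it fails has $p$-modulus zero. Weak gradient. For $p\ge 1$, a Borel function $g\colon X\to[0,\infty]$ is a $p$-upper gradient of $f\colon X\to\mathbb{R}$ if $|f(b_\gamma)-f(a_\gamma)|\le\int_\gamma g\,ds$ for $p$-a.e. curve $\gamma$. For $p>1$ the $p$-weak gradient (minimal $p$-upper gradient) $|\nabla f|_{m,p}$ is the $p$-upper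 gradient of $f$ characterized, up to $m$-negligible sets, by $|\nabla f|_{m,p}\le g$ $m$-a.e. for every $p$-upper gradient $g$ of $f$. Slope. For locally Lipschitz $f\colon X\to\mathbb{R}$, $|\nabla f|(x)=\limsup_{y\to x}\frac{|f(y)-f(x)|}{d(x,y)}$. Doubling. A Borel measure $m$ is doubling if balls have finite positive measure and there is $C\ge1$ with $m(B(x,2r))\le C\,m(B(x,r))$ for all $x$ and all $r>0$. $A_p$-weights. For $p>1$, $w\colon\mathbb{R}^n\to\mathbb{R}^+$ is a Muckenhoupt $A_p$-weight if there is $C>0$ such that for all balls $B\subset\mathbb{R}^n$, $\left(\frac1{|B|}\int_B w\right)\left(\frac1{|B|}\int_B w^{1/(1-p)}\right)^{p-1}\le C$ (integrals with respect to $\mathcal{L}^n$). Weak $p$-Poincar\'{e} inequality. $m$ admits one if there are $C>0$ and $\lambda\ge1$ such that $\frac{1}{m(B)}\int_B|f-f_B|\,dm\le Cr\left(\frac{1}{m(\lambda B)}\int_{\lambda B}|\nabla f|^p\,dm\right)^{1/p}$ whenever $B$ is a ball of radius $r$ and $f$ is a locally Lipschitz function on $\lambda B$.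
   Formalization: The p-weak gradient is taken to be locally p-integrable and minimal only among locally p-integrable p-upper gradients; with minimality among all p-upper gradients, as literally defined, it does not exist e.g. for f(x)=x_1 when p>1+α. *)

theory Defs
  imports "HOL-Analysis.Analysis"
begin

text \<open>
  Real powers of extended nonnegative numbers. In contrast to \<^term>\<open>(0::real) powr q = 0\<close>,
  a negative power of \<open>0\<close> is \<open>\<infinity>\<close>.
\<close>

definition ennpowr :: "ennreal \<Rightarrow> real \<Rightarrow> ennreal" where
  "ennpowr x q =
     (if (x = 0 \<and> q < 0) \<or> (x = \<infinity> \<and> q > 0) then \<infinity> else ennreal (enn2real x powr q))"


subsection \<open>Curves\<close>

text \<open>
  A curve is a triple \<open>(a, b, \<gamma>)\<close>; only the values of \<open>\<gamma>\<close> on \<open>{a..b}\<close> matter.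
\<close>

type_synonym 'a curve = "real \<times> real \<times> (real \<Rightarrow> 'a)"

definition speed_bound :: "'a::metric_space curve \<Rightarrow> (real \<Rightarrow> real) \<Rightarrow> bool" where
  "speed_bound = (\<lambda>(a, b, \<gamma>) g.
     set_integrable lebesgue {a..b} g \<and>
     (\<forall>s t. a \<le> s \<and> s < t \<and> t \<le> b \<longrightarrow>
        dist (\<gamma> s) (\<gamma> t) \<le> set_lebesgue_integral lebesgue {s..t} g))"

definition ac_curves :: "'a::metric_space curve set" where
  "ac_curves = {(a, b, \<gamma>). a \<le> b \<and> continuous_on {a..b} \<gamma> \<and> (\<exists>g. speed_bound (a, b, \<gamma>) g)}"

definition nonconstant_ac_curves :: "'a::metric_space curve set" where
  "nonconstant_ac_curves = {(a, b, \<gamma>). (a, b, \<gamma>) \<in> ac_curves \<and> \<not> \<gamma> constant_on {a..b}}"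

text \<open>The metric speed is determined almost everywhere on \<open>{a..b}\<close>.\<close>

definition metric_speed :: "'a::metric_space curve \<Rightarrow> real \<Rightarrow> real" where
  "metric_speed = (\<lambda>(a, b, \<gamma>). SOME g.
     speed_bound (a, b, \<gamma>) g \<and>
     (\<forall>h. speed_bound (a, b, \<gamma>) h \<longrightarrow> (AE t in lebesgue. t \<in> {a..b} \<longrightarrow> g t \<le> h t)))"

definition curve_integral :: "'a::metric_space curve \<Rightarrow> ('a \<Rightarrow> ennreal) \<Rightarrow> ennreal" where
  "curve_integral = (\<lambda>(a, b, \<gamma>) f.
     \<integral>\<^sup>+ t \<in> {a..b}. f (\<gamma> t) * ennreal (metric_speed (a, b, \<gamma>) t) \<partial>lebesgue)"


subsection \<open>Modulus and weak gradients\<close>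

definition modulus :: "real \<Rightarrow> 'a::metric_space measure \<Rightarrow> 'a curve set \<Rightarrow> ennreal" where
  "modulus p M \<Gamma> =
     (INF g \<in> {g \<in> borel_measurable borel. \<forall>c\<in>\<Gamma>. 1 \<le> curve_integral c g}.
        \<integral>\<^sup>+ x. ennpowr (g x) p \<partial>M)"

definition ae_curve :: "real \<Rightarrow> 'a::metric_space measure \<Rightarrow> ('a curve \<Rightarrow> bool) \<Rightarrow> bool" where
  "ae_curve p M P \<longleftrightarrow> modulus p M {c \<in> ac_curves. \<not> P c} = 0"

definition upper_gradient ::
    "real \<Rightarrow> 'a::metric_space measure \<Rightarrow> ('a \<Rightarrow> real) \<Rightarrow> ('a \<Rightarrow> ennreal) \<Rightarrow> bool" where
  "upper_gradient p M f g \<longleftrightarrow>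
     g \<in> borel_measurable borel \<and>
     ae_curve p M (\<lambda>(a, b, \<gamma>). ennreal \<bar>f (\<gamma> b) - f (\<gamma> a)\<bar> \<le> curve_integral (a, b, \<gamma>) g)"

definition locally_Lp :: "real \<Rightarrow> 'a::metric_space measure \<Rightarrow> ('a \<Rightarrow> ennreal) \<Rightarrow> bool" where
  "locally_Lp p M g \<longleftrightarrow> (\<forall>x. \<exists>r>0. (\<integral>\<^sup>+ y \<in> ball x r. ennpowr (g y) p \<partial>M) < \<infinity>)"

text \<open>
  \<open>G\<close> is a (representative of the) \<open>p\<close>-weak gradient of \<open>f\<close>, which is unique up to null sets.
  As usual for minimal upper gradients, the competitors are the locally \<open>p\<close>-integrable ones.
  Without integrability the notion degenerates: on Euclidean space with coordinates \<open>x\<^sub>i\<close>, and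
  \<open>q\<^sub>k\<close> enumerating the rationals, the function \<open>g x = (\<Sum>i. \<Sum>k. 2 powr -k / \<bar>x\<^sub>i - q\<^sub>k\<bar>)\<close> is
  finite almost everywhere but has infinite integral along every nonconstant curve, so that
  \<open>\<epsilon> g\<close> is an upper gradient of every function for every \<open>\<epsilon> > 0\<close>; a minimal element below all
  of these would vanish almost everywhere.
\<close>

definition is_weak_gradient ::
    "real \<Rightarrow> 'a::metric_space measure \<Rightarrow> ('a \<Rightarrow> real) \<Rightarrow> ('a \<Rightarrow> ennreal) \<Rightarrow> bool" where
  "is_weak_gradient p M f G \<longleftrightarrow>
     upper_gradient p M f G \<and> locally_Lp p M G \<and>
     (\<forall>g. upper_gradient p M f g \<and> locally_Lp p M g \<longrightarrow> (AE x in M. G x \<le> g x))"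


subsection \<open>Slope and Poincare inequality\<close>

definition slope :: "('a::metric_space \<Rightarrow> real) \<Rightarrow> 'a \<Rightarrow> ennreal" where
  "slope f x = Limsup (at x) (\<lambda>y. ennreal (\<bar>f y - f x\<bar> / dist x y))"

definition locally_lipschitz_on :: "'a::metric_space set \<Rightarrow> ('a \<Rightarrow> real) \<Rightarrow> bool" where
  "locally_lipschitz_on U f \<longleftrightarrow> (\<forall>x\<in>U. \<exists>r>0. \<exists>L. L-lipschitz_on (U \<inter> ball x r) f)"

definition mean :: "'a measure \<Rightarrow> 'a set \<Rightarrow> ('a \<Rightarrow> real) \<Rightarrow> real" where
  "mean M A f = set_lebesgue_integral M A f / measure M A"

definition nn_mean :: "'a measure \<Rightarrow> 'a set \<Rightarrow> ('a \<Rightarrow> ennreal) \<Rightarrow> ennreal" where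
  "nn_mean M A f = (\<integral>\<^sup>+ x \<in> A. f x \<partial>M) / emeasure M A"

definition doubling :: "'a::metric_space measure \<Rightarrow> bool" where
  "doubling M \<longleftrightarrow>
     sets M = sets borel \<and>
     (\<forall>x. \<forall>r>0. 0 < emeasure M (ball x r) \<and> emeasure M (ball x r) < \<infinity>) \<and>
     (\<exists>C\<ge>1. \<forall>x. \<forall>r>0. emeasure M (ball x (2 * r)) \<le> ennreal C * emeasure M (ball x r))"

definition weak_poincare :: "real \<Rightarrow> 'a::metric_space measure \<Rightarrow> bool" where
  "weak_poincare p M \<longleftrightarrow>
     (\<exists>C>0. \<exists>\<sigma>\<ge>1. \<forall>x. \<forall>r>0. \<forall>f. locally_lipschitz_on (ball x (\<sigma> * r)) f \<longrightarrow>
        nn_mean M (ball x r) (\<lambda>y. ennreal \<bar>f y - mean M (ball x r) f\<bar>)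
          \<le> ennreal (C * r) *
             ennpowr (nn_mean M (ball x (\<sigma> * r)) (\<lambda>y. ennpowr (slope f y) p)) (1 / p))"


subsection \<open>Muckenhoupt weights\<close>

definition Ap_weight :: "real \<Rightarrow> ('a::euclidean_space \<Rightarrow> real) \<Rightarrow> bool" where
  "Ap_weight p w \<longleftrightarrow>
     w \<in> borel_measurable borel \<and> (\<forall>x. 0 \<le> w x) \<and>
     (\<exists>C>0. \<forall>x. \<forall>r>0.
        nn_mean lborel (ball x r) (\<lambda>y. ennreal (w y)) *
        ennpowr (nn_mean lborel (ball x r) (\<lambda>y. ennpowr (ennreal (w y)) (1 / (1 - p)))) (p - 1)
          \<le> ennreal C)"

end

theory Submission
  imports Defs
begin

text \<open>
  Let \<open>(b\<^sub>k, q\<^sub>k)\<close> enumerate all pairs of a coordinate direction and a rational number, put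
  \<open>S x = (\<Sum>k. 2 powr (- k) / sqrt \<bar>x \<bullet> b\<^sub>k - q\<^sub>k\<bar>)\<close> and take the weight \<open>w = S powr (- 2 \<alpha>)\<close>.

  For small \<open>p\<close>: near the hyperplane \<open>x \<bullet> b = q\<close> the weight is at most a multiple of
  \<open>\<bar>x \<bullet> b - q\<bar> powr \<alpha>\<close>, which makes the curves crossing this hyperplane negligible for all
  \<open>p \<le> 1 + \<alpha>\<close>. Every nonconstant curve crosses one of these countably many hyperplanes.

  For large \<open>p\<close>: on a ball \<open>B\<close>, \<open>S\<close> is bounded below by the number \<open>m\<close> obtained by replacing each
  summand by a lower bound on \<open>B\<close>, and convexity reduces \<open>(mean of S powr r on B) \<le> C * m powr r\<close>
  for \<open>r < 2\<close> to a single summand. This gives the Muckenhoupt condition for \<open>2 \<alpha> / (p - 1) < 2\<close>, and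
  also \<open>sup w \<le> C * (mean of w)\<close> on balls. The latter lets one replace \<open>\<mu>\<close> by Lebesgue measure in
  mean oscillations, so that the weighted Poincare inequality follows from the unweighted one for
  \<open>p = 1\<close>.

  The slope is minimal among upper gradients \<open>g\<close>: almost every segment in a given direction is good
  for \<open>g\<close>, and averaging \<open>\<bar>f (z + h) - f z\<bar> \<le> \<integral> g\<close> over \<open>z\<close> in a ball much smaller than \<open>\<bar>h\<bar>\<close> around
  a point \<open>x\<close> where the averages of \<open>g\<close> behave well bounds the difference quotients at \<open>x\<close> directly,
  without differentiating \<open>f\<close>.
\<close>

subsection \<open>Increments and averages\<close>

text \<open>The weight has to vanish to order \<alpha> on a dense family of hyperplanes and still be
  doubling. What makes this possible is the stability of A_1 bounds under sums. The singularity
  |t|^(-1/2), raised to any power r < 2, has a mean over each interval of at most a constant times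
  its infimum there. With a uniform constant such bounds pass to countable sums, so S^r is an A_1
  weight for 0 < r < 2. Hence w = (S^(2\<alpha>/(p-1)))^(1-p) is an A_1 weight raised to the power 1
  - p, which is A_p by the easy half of the factorization of Muckenhoupt weights. The exponents
  balance: (-2\<alpha>)(-1/2) = \<alpha> is the order of vanishing needed for small p, and
  2\<alpha>/(p-1) < 2 means p > 1 + \<alpha>. A second obstacle is that the metric speed is given
  only by minimality. Curves and functions are therefore measured by the same quantity
  \<open>pointwise_lip\<close>. For a curve it is almost everywhere the metric speed, for a real
  function it is the slope, and the upper gradient property of the slope becomes a chain
  inequality.\<close>

text \<open>
  The exceptional set \<open>Z\<close> is harmless: once \<open>h\<close> is set to \<open>0\<close> on \<open>Z\<close>, Henstock's lemma makes the
  integrals of \<open>h\<close> over the pieces of a fine division with tags in \<open>Z\<close> add up to less than any \<open>e\<close>.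
\<close>

lemma increment_le_integral:
  fixes \<phi> h D :: "real \<Rightarrow> real"
  assumes ab: "a \<le> b" and h: "h integrable_on {a..b}" and D: "D integrable_on {a..b}"
    and Z: "negligible Z"
    and ac: "\<And>s t. a \<le> s \<Longrightarrow> s \<le> t \<Longrightarrow> t \<le> b \<Longrightarrow> \<phi> t - \<phi> s \<le> integral {s..t} h"
    and pt: "\<And>t e. t \<in> {a..b} - Z \<Longrightarrow> 0 < e \<Longrightarrow>
      \<exists>\<delta>>0. \<forall>s\<in>{a..b}. \<bar>s - t\<bar> < \<delta> \<longrightarrow> \<bar>\<phi> s - \<phi> t\<bar> \<le> (D t + e) * \<bar>s - t\<bar>"
  shows "\<phi> b - \<phi> a \<le> integral {a..b} D"
proof (rule field_le_epsilon)
  fix e0 :: real assume "0 < e0"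
  \<comment> \<open>Three errors add up to \<open>e * (b - a + 2)\<close>: the pointwise bound costs
    e per unit length, the Riemann sum of \<open>k\<close> costs e, and the tags in \<open>Z\<close>
    cost e.\<close>
  define e where "e = e0 / (b - a + 2)"
  have e: "e > 0" using ab \<open>0 < e0\<close> by (simp add: e_def)
  define h' where "h' t = (if t \<in> Z then 0 else h t)" for t
  define k where "k t = (if t \<in> Z then 0 else D t)" for t
  have h': "h' integrable_on cbox a b"
    using integrable_spike[OF h Z, of h'] by (auto simp: h'_def)
  have k: "k integrable_on cbox a b"
    using integrable_spike[OF D Z, of k] by (auto simp: k_def)
  have kD: "integral {a..b} k = integral {a..b} D"
    by (rule integral_spike[OF Z]) (auto simp: k_def)
  have hh: "integral K h' = integral K h" for K
    by (rule integral_spike[OF Z]) (auto simp: h'_def)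
  obtain d1 where d1: "gauge d1" and
    d1': "\<And>p. \<lbrakk>p tagged_partial_division_of (cbox a b); d1 fine p\<rbrakk> \<Longrightarrow>
             sum (\<lambda>(x,k). norm (measure lborel k *\<^sub>R h' x - integral k h')) p < e"
    by (rule Henstock_lemma[OF h' e]) (rule that)
  obtain d2 where d2: "gauge d2" and
    d2': "\<And>p. \<lbrakk>p tagged_division_of (cbox a b); d2 fine p\<rbrakk> \<Longrightarrow>
             norm (sum (\<lambda>(x,K). measure lborel K *\<^sub>R k x) p - integral (cbox a b) k) < e"
    using integrable_integral[OF k, unfolded has_integral, rule_format, OF e] by metis
  have "\<forall>t. \<exists>\<delta>>0. t \<in> {a..b} - Z \<longrightarrow>
      (\<forall>s\<in>{a..b}. \<bar>s - t\<bar> < \<delta> \<longrightarrow> \<bar>\<phi> s - \<phi> t\<bar> \<le> (D t + e) * \<bar>s - t\<bar>)"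
  proof
    fix t show "\<exists>\<delta>>0. t \<in> {a..b} - Z \<longrightarrow>
      (\<forall>s\<in>{a..b}. \<bar>s - t\<bar> < \<delta> \<longrightarrow> \<bar>\<phi> s - \<phi> t\<bar> \<le> (D t + e) * \<bar>s - t\<bar>)"
      using pt[OF _ e, of t] by (cases "t \<in> {a..b} - Z") (auto intro: exI[of _ 1])
  qed
  then obtain \<delta> where \<delta>: "\<And>t. \<delta> t > 0" and
    \<delta>': "\<And>t s. t \<in> {a..b} - Z \<Longrightarrow> s \<in> {a..b} \<Longrightarrow> \<bar>s - t\<bar> < \<delta> t \<Longrightarrow>
      \<bar>\<phi> s - \<phi> t\<bar> \<le> (D t + e) * \<bar>s - t\<bar>"
    by metis
  have "gauge (\<lambda>x. ball x (\<delta> x))" using \<delta> by (rule gauge_ball_dependent[rule_format])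
  then have "gauge (\<lambda>x. d1 x \<inter> d2 x \<inter> ball x (\<delta> x))"
    using d1 d2 by (intro gauge_Int)
  then obtain p where p: "p tagged_division_of cbox a b"
    and "(\<lambda>x. d1 x \<inter> d2 x \<inter> ball x (\<delta> x)) fine p"
    by (rule fine_division_exists)
  then have f1: "d1 fine p" and f2: "d2 fine p" and f3: "(\<lambda>x. ball x (\<delta> x)) fine p"
    by (auto simp: fine_def)
  have pp: "p tagged_division_of {a..b}" using p by simp
  have "\<phi> b - \<phi> a = (\<Sum>(x,K)\<in>p. \<phi> (Sup K) - \<phi> (Inf K))"
    using additive_tagged_division_1[OF ab pp, of \<phi>] by simp
  also have "\<dots> \<le> (\<Sum>(x,K)\<in>p. measure lborel K *\<^sub>R k x + e * measure lborel K
                 + norm (measure lborel K *\<^sub>R h' x - integral K h'))"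
  proof (rule sum_mono, clarify)
    fix x K assume xK: "(x, K) \<in> p"
    then obtain c d where K: "K = cbox c d" and "x \<in> K" "K \<subseteq> cbox a b"
      using tagged_division_ofD(2-4)[OF p xK] by metis
    then have cd: "c \<le> x" "x \<le> d" "a \<le> c" "d \<le> b" by auto
    have S: "Sup K = d" "Inf K = c" and cont: "measure lborel K = d - c" using cd by (auto simp: K)
    have sub: "K \<subseteq> ball x (\<delta> x)" using f3 xK by (auto simp: fine_def)
    show "\<phi> (Sup K) - \<phi> (Inf K) \<le> measure lborel K *\<^sub>R k x + e * measure lborel K
                 + norm (measure lborel K *\<^sub>R h' x - integral K h')"
    proof (cases "x \<in> Z")
      case True
      have "\<phi> d - \<phi> c \<le> integral {c..d} h" using ac cd by simp
      also have "\<dots> \<le> norm (measure lborel K *\<^sub>R h' x - integral K h')"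
        using True hh[of "{c..d}"] by (simp add: h'_def[of x] K)
      finally have "\<phi> d - \<phi> c \<le> norm (measure lborel K *\<^sub>R h' x - integral K h')" .
      moreover have "0 \<le> e * (d - c)" using e cd by simp
      ultimately show ?thesis using True by (simp add: S k_def cont)
    next
      case False
      then have x: "x \<in> {a..b} - Z" using cd by auto
      have "c \<in> K" "d \<in> K" using cd by (auto simp: K)
      then have "\<bar>c - x\<bar> < \<delta> x" "\<bar>d - x\<bar> < \<delta> x"
        using sub by (auto simp: dist_real_def)
      then have "\<bar>\<phi> c - \<phi> x\<bar> \<le> (D x + e) * \<bar>c - x\<bar>" "\<bar>\<phi> d - \<phi> x\<bar> \<le> (D x + e) * \<bar>d - x\<bar>"
        using \<delta>'[OF x, of c] \<delta>'[OF x, of d] cd by auto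
      then have "\<phi> d - \<phi> c \<le> (D x + e) * (x - c) + (D x + e) * (d - x)"
        using cd by (simp add: abs_real_def split: if_splits)
      also have "\<dots> = measure lborel K *\<^sub>R k x + e * measure lborel K"
        using False by (simp add: k_def cont algebra_simps)
      finally show ?thesis by (simp add: S add_increasing2)
    qed
  qed
  also have "\<dots> = (\<Sum>(x,K)\<in>p. measure lborel K *\<^sub>R k x) + e * (\<Sum>(x,K)\<in>p. measure lborel K)
       + (\<Sum>(x,K)\<in>p. norm (measure lborel K *\<^sub>R h' x - integral K h'))"
    by (simp add: case_prod_unfold sum.distrib sum_distrib_left)
  also have "\<dots> \<le> (integral {a..b} k + e) + e * (b - a) + e"
  proof (intro add_mono)
    show "(\<Sum>(x,K)\<in>p. measure lborel K *\<^sub>R k x) \<le> integral {a..b} k + e"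
      using d2'[OF p f2] by (simp add: abs_less_iff)
    show "e * (\<Sum>(x,K)\<in>p. measure lborel K) \<le> e * (b - a)"
      using additive_content_tagged_division[OF p] ab by simp
    show "(\<Sum>(x,K)\<in>p. norm (measure lborel K *\<^sub>R h' x - integral K h')) \<le> e"
      using d1'[OF _ f1] p by (simp add: tagged_division_of_def less_imp_le)
  qed
  also have "\<dots> = integral {a..b} D + e * (b - a + 2)"
    by (simp add: kD algebra_simps)
  also have "\<dots> = integral {a..b} D + e0"
    using ab by (simp add: e_def)
  finally show "\<phi> b - \<phi> a \<le> integral {a..b} D + e0" .
qed

text \<open>The exceptional sets below are not known to be measurable, so they are recognized as
  null by outer approximation. \<open>T\<close> may be merely Lebesgue measurable because Vitali's
  theorem leaves a negligible remainder, which is added to \<open>T\<close>.\<close>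

lemma AE_notin_if_outer_null:
  fixes S :: "'a::euclidean_space set"
  assumes "\<And>e. 0 < e \<Longrightarrow> \<exists>T\<in>sets lebesgue. S \<subseteq> T \<and> emeasure lebesgue T \<le> ennreal e"
  shows "AE x in lborel. x \<notin> S"
proof -
  have "negligible S"
    unfolding negligible_outer_le
  proof (intro allI impI)
    fix e :: real assume e: "0 < e"
    then obtain T where T: "T \<in> sets lebesgue" "S \<subseteq> T" and le: "emeasure lebesgue T \<le> ennreal e"
      using assms by blast
    have "T \<in> lmeasurable" using T le by (auto simp: fmeasurable_def intro: le_less_trans)
    moreover have "measure lebesgue T \<le> e"
      unfolding measure_def by (rule enn2real_leI) (use le e in auto)
    ultimately show "\<exists>T. S \<subseteq> T \<and> T \<in> lmeasurable \<and> measure lebesgue T \<le> e" using T by blast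
  qed
  then have "AE x in lebesgue. x \<notin> S" by (intro AE_not_in) (simp add: negligible_iff_null_sets)
  then show ?thesis by (simp add: AE_completion_iff)
qed

text \<open>
  Since the measure with density \<open>u\<close> does not charge the zeros of \<open>u\<close>, these have an open neighbourhood
  of small \<open>u\<close>-mass. A Vitali family of balls inside it with averages above \<open>\<eta>\<close> has small volume.
\<close>

lemma null_averages_at_zeros:
  fixes u :: "'a::euclidean_space \<Rightarrow> ennreal"
  assumes [measurable]: "u \<in> borel_measurable borel" and U: "open U"
    and fin: "(\<integral>\<^sup>+x\<in>U. u x \<partial>lborel) < \<infinity>" and eta: "0 < \<eta>"
  shows "AE x in lborel. x \<in> U \<and> u x = 0 \<longrightarrow>
    (\<exists>r0>0. \<forall>r. 0 < r \<and> r < r0 \<longrightarrow> (\<integral>\<^sup>+y\<in>cball x r. u y \<partial>lborel) \<le> ennreal \<eta> * emeasure lborel (cball x r))"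
proof -
  have [measurable]: "U \<in> sets borel" using U by simp
  define M where "M = density lborel (\<lambda>x. u x * indicator U x)"
  define Bad where "Bad = {x\<in>U. u x = 0 \<and> (\<forall>r0>0. \<exists>r>0. r < r0 \<and>
    \<not> (\<integral>\<^sup>+y\<in>cball x r. u y \<partial>lborel) \<le> ennreal \<eta> * emeasure lborel (cball x r))}"
  have eM: "emeasure M A = (\<integral>\<^sup>+x\<in>A. u x * indicator U x \<partial>lborel)" if "A \<in> sets borel" for A
    unfolding M_def using that by (subst emeasure_density) auto
  have sM: "sets M = sets borel" "space M = UNIV" by (auto simp: M_def)
  have finM: "emeasure M (space M) \<noteq> \<infinity>" using fin by (simp add: eM sM)
  define Z where "Z = {x\<in>U. u x = 0}"
  have Z[measurable]: "Z \<in> sets borel" unfolding Z_def by measurable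
  have "emeasure M Z = (\<integral>\<^sup>+x. 0 \<partial>(lborel :: 'a measure))"
    unfolding eM[OF Z] by (rule nn_integral_cong) (auto simp: Z_def indicator_def)
  then have MZ: "emeasure M Z = 0" by simp
  have "AE x in lborel. x \<notin> Bad"
  proof (rule AE_notin_if_outer_null)
    fix e :: real assume "e > 0"
    have "(INF V \<in> {V. Z \<subseteq> V \<and> open V}. emeasure M V) = 0"
      using outer_regular[OF sM(1) finM, of Z] Z MZ by simp
    moreover have "0 < ennreal (e * \<eta>)" using \<open>e > 0\<close> eta by simp
    ultimately have "(INF V \<in> {V. Z \<subseteq> V \<and> open V}. emeasure M V) < ennreal (e * \<eta>)" by simp
    then obtain V where V: "Z \<subseteq> V" "open V" and MV: "emeasure M V < ennreal (e * \<eta>)"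
      unfolding INF_less_iff by auto
    define K where "K = {(x, r). 0 < r \<and> cball x r \<subseteq> V \<inter> U \<and>
      \<not> (\<integral>\<^sup>+y\<in>cball x r. u y \<partial>lborel) \<le> ennreal \<eta> * emeasure lborel (cball x r)}"
    have cov: "\<exists>i. i \<in> K \<and> x \<in> cball (fst i) (snd i) \<and> snd i < d" if x: "x \<in> Bad" and d: "0 < d" for x d
    proof -
      have "x \<in> V \<inter> U" using x V by (auto simp: Bad_def Z_def)
      moreover have "open (V \<inter> U)" using U V by blast
      ultimately obtain r1 where r1: "r1 > 0" "cball x r1 \<subseteq> V \<inter> U"
        using open_contains_cball by blast
      then have "min d r1 > 0" using d by simp
      with x obtain r where r: "r > 0" "r < min d r1" and
        "\<not> (\<integral>\<^sup>+y\<in>cball x r. u y \<partial>lborel) \<le> ennreal \<eta> * emeasure lborel (cball x r)"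
        unfolding Bad_def by blast
      moreover have "cball x r \<subseteq> V \<inter> U"
        using r1(2) r subset_cball[of r r1 x] by auto
      ultimately have "(x, r) \<in> K" by (auto simp: K_def)
      then show ?thesis using r by (intro exI[of _ "(x, r)"]) auto
    qed
    have K0: "0 < snd i" if "i \<in> K" for i
      using that by (auto simp: K_def)
    obtain C where C: "countable C" "C \<subseteq> K"
     "pairwise (\<lambda>i j. disjnt (cball (fst i) (snd i)) (cball (fst j) (snd j))) C"
     "negligible(Bad - (\<Union>i \<in> C. cball (fst i) (snd i)))"
      by (rule Vitali_covering_theorem_cballs[of K snd Bad fst]) (erule K0, erule (1) cov, rule that)
    let ?B = "\<lambda>i::'a \<times> real. cball (fst i) (snd i)"
    let ?T = "\<Union>i \<in> C. ?B i"
    have dis: "disjoint_family_on ?B C"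
      using C(3) by (auto simp: disjoint_family_on_def pairwise_def disjnt_def)
    have meas: "?B i \<in> sets lborel" "?B i \<in> sets M" for i by (auto simp: sM)
    have "ennreal \<eta> * emeasure lborel ?T = ennreal \<eta> * (\<integral>\<^sup>+i. emeasure lborel (?B i) \<partial>count_space C)"
      by (subst emeasure_UN_countable[OF meas(1) C(1) dis]) simp
    also have "\<dots> = (\<integral>\<^sup>+i. ennreal \<eta> * emeasure lborel (?B i) \<partial>count_space C)"
      by (subst nn_integral_cmult) auto
    also have "\<dots> \<le> (\<integral>\<^sup>+i. emeasure M (?B i) \<partial>count_space C)"
    proof (rule nn_integral_mono)
      fix i assume "i \<in> space (count_space C)"
      then have i: "i \<in> K" using C by auto
      then have "ennreal \<eta> * emeasure lborel (?B i) \<le> (\<integral>\<^sup>+y\<in>?B i. u y \<partial>lborel)"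
        by (auto simp: K_def)
      also have "\<dots> \<le> emeasure M (?B i)"
        using i by (simp only: eM borel_closed closed_cball, intro nn_integral_mono)
          (auto simp: K_def indicator_def)
      finally show "ennreal \<eta> * emeasure lborel (?B i) \<le> emeasure M (?B i)" .
    qed
    also have "\<dots> = emeasure M ?T"
      by (subst emeasure_UN_countable[OF meas(2) C(1) dis]) simp
    also have "\<dots> \<le> emeasure M V"
    proof (rule emeasure_mono)
      show "?T \<subseteq> V" using C(2) unfolding K_def by fastforce
    qed (use V in \<open>simp add: sM\<close>)
    also have "\<dots> \<le> ennreal (e * \<eta>)" using MV by simp
    finally have le: "ennreal \<eta> * emeasure lborel ?T \<le> ennreal \<eta> * ennreal e"
      using eta \<open>e > 0\<close> by (simp add: ennreal_mult mult.commute)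
    then have Te: "emeasure lborel ?T \<le> ennreal e"
      using eta by (subst (asm) ennreal_mult_le_mult_iff) auto
    have Tm: "?T \<in> sets borel"
      using C(1) by (intro sets.countable_UN'') auto
    let ?N = "Bad - ?T"
    have N: "?N \<in> null_sets lebesgue" using C(4) by (simp add: negligible_iff_null_sets)
    have "emeasure lebesgue (?T \<union> ?N) \<le> ennreal e"
      using Te Tm N by (subst emeasure_Un_null_set) auto
    moreover have "?T \<union> ?N \<in> sets lebesgue" using Tm N by (intro sets.Un) auto
    moreover have "Bad \<subseteq> ?T \<union> ?N" by blast
    ultimately show "\<exists>T\<in>sets lebesgue. Bad \<subseteq> T \<and> emeasure lebesgue T \<le> ennreal e" by blast
  qed
  then show ?thesis by (rule AE_mp) (auto simp: Bad_def)
qed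

text \<open>The substitute for a Lebesgue point. It is used only for nonnegative functions at their
  zeros, which is enough to bound averages from above; no limit of averages is ever
  identified.\<close>

definition vanishing_averages :: "('a::euclidean_space \<Rightarrow> ennreal) \<Rightarrow> 'a \<Rightarrow> bool" where
  "vanishing_averages u x \<longleftrightarrow> (\<forall>\<eta>>0. \<exists>r0>0. \<forall>r. 0 < r \<and> r < r0 \<longrightarrow>
    (\<integral>\<^sup>+y\<in>cball x r. u y \<partial>lborel) \<le> ennreal \<eta> * emeasure lborel (cball x r))"

lemma AE_vanishing_averages:
  fixes u :: "'a::euclidean_space \<Rightarrow> ennreal"
  assumes "u \<in> borel_measurable borel" "open U" "(\<integral>\<^sup>+x\<in>U. u x \<partial>lborel) < \<infinity>"
  shows "AE x in lborel. x \<in> U \<and> u x = 0 \<longrightarrow> vanishing_averages u x"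
proof -
  have "AE x in lborel. \<forall>k::nat. x \<in> U \<and> u x = 0 \<longrightarrow> (\<exists>r0>0. \<forall>r. 0 < r \<and> r < r0 \<longrightarrow>
      (\<integral>\<^sup>+y\<in>cball x r. u y \<partial>lborel) \<le> ennreal (inverse (Suc k)) * emeasure lborel (cball x r))"
    unfolding AE_all_countable by (intro allI null_averages_at_zeros assms) simp
  then show ?thesis
    unfolding vanishing_averages_def
  proof (eventually_elim, intro impI allI)
    fix x and \<eta> :: real
    assume A: "\<forall>k::nat. x \<in> U \<and> u x = 0 \<longrightarrow> (\<exists>r0>0. \<forall>r. 0 < r \<and> r < r0 \<longrightarrow>
        (\<integral>\<^sup>+y\<in>cball x r. u y \<partial>lborel) \<le> ennreal (inverse (Suc k)) * emeasure lborel (cball x r))"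
      and x: "x \<in> U \<and> u x = 0" and \<eta>: "0 < \<eta>"
    obtain k where k: "inverse (real (Suc k)) < \<eta>" using reals_Archimedean[OF \<eta>] by auto
    have "ennreal (inverse (Suc k)) * emeasure lborel (cball x r) \<le> ennreal \<eta> * emeasure lborel (cball x r)" for r
      using k by (intro mult_right_mono ennreal_leI) auto
    then show "\<exists>r0>0. \<forall>r. 0 < r \<and> r < r0 \<longrightarrow>
        (\<integral>\<^sup>+y\<in>cball x r. u y \<partial>lborel) \<le> ennreal \<eta> * emeasure lborel (cball x r)"
      using A x by (meson order_trans)
  qed
qed

subsection \<open>The pointwise Lipschitz constant\<close>

text \<open>The slope for maps into a metric space, so that one notion covers both the metric speed
  of a curve and the slope of a function.\<close>

definition pointwise_lip :: "('a::metric_space \<Rightarrow> 'b::metric_space) \<Rightarrow> 'a \<Rightarrow> ennreal" where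
  "pointwise_lip f x = Limsup (at x) (\<lambda>y. ennreal (dist (f y) (f x) / dist x y))"

lemma slope_eq_pointwise_lip: "slope f = pointwise_lip f"
  by (simp add: fun_eq_iff slope_def pointwise_lip_def dist_real_def)

text \<open>Writing nearby points as x + h makes the index set of the supremum independent of x. For
  each radius this is a supremum of continuous functions of x, whose superlevel sets are open. By
  monotonicity in the radius a sequence of radii suffices for the infimum.\<close>

lemma pointwise_lip_measurable:
  fixes f :: "'a::real_normed_vector \<Rightarrow> 'b::metric_space"
  assumes f: "continuous_on UNIV f"
  shows "pointwise_lip f \<in> borel_measurable borel"
proof -
  define q where "q h x = ennreal (dist (f (x + h)) (f x) / norm h)" for h x
  have eq: "pointwise_lip f x = (INF n::nat. SUP h\<in>ball 0 (inverse (Suc n)) - {0}. q h x)" for x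
  proof -
    have sup: "(SUP y\<in>UNIV \<inter> ball x e - {x}. ennreal (dist (f y) (f x) / dist x y))
        = (SUP h\<in>ball 0 e - {0}. q h x)" (is "_ = ?s e") for e
    proof -
      have "UNIV \<inter> ball x e - {x} = (\<lambda>h. x + h) ` (ball 0 e - {0})"
      proof (intro equalityI subsetI)
        fix y assume "y \<in> UNIV \<inter> ball x e - {x}"
        then show "y \<in> (\<lambda>h. x + h) ` (ball 0 e - {0})"
          by (intro image_eqI[of _ _ "y - x"]) (auto simp: dist_norm norm_minus_commute)
      qed (auto simp: dist_norm)
      then show ?thesis by (simp add: image_comp q_def dist_norm norm_minus_commute comp_def)
    qed
    have mono: "?s d \<le> ?s e" if "d \<le> e" for d e
      using that by (intro SUP_subset_mono) auto
    have "pointwise_lip f x = (INF e\<in>{0<..}. ?s e)"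
      unfolding pointwise_lip_def Limsup_within sup ..
    also have "\<dots> = (INF n::nat. ?s (inverse (Suc n)))"
    proof (rule antisym)
      show "(INF e\<in>{0<..}. ?s e) \<le> (INF n::nat. ?s (inverse (Suc n)))"
        by (rule INF_mono) (auto intro!: bexI[of _ "inverse (real (Suc _))"])
      show "(INF n::nat. ?s (inverse (Suc n))) \<le> (INF e\<in>{0<..}. ?s e)"
      proof (rule INF_mono)
        fix e :: real assume "e \<in> {0<..}"
        then obtain n where "inverse (real (Suc n)) < e" using reals_Archimedean by auto
        then show "\<exists>n\<in>UNIV. ?s (inverse (real (Suc n))) \<le> ?s e"
          using mono by (meson UNIV_I less_imp_le)
      qed
    qed
    finally show ?thesis .
  qed
  have "(\<lambda>x. SUP h\<in>ball 0 (inverse (Suc n)) - {0}. q h x) \<in> borel_measurable borel" for n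
  proof (rule borel_measurableI_greater)
    fix y
    have "open {x. y < q h x}" if "h \<noteq> 0" for h
    proof (rule open_Collect_less)
      show "continuous_on UNIV (q h)"
        unfolding q_def using that f
        by (intro continuous_on_ennreal continuous_intros continuous_on_compose2[OF f]) auto
    qed (rule continuous_on_const)
    then have "open (\<Union>h\<in>ball 0 (inverse (Suc n)) - {0}. {x. y < q h x})" by blast
    then show "{x \<in> space borel. y < (SUP h\<in>ball 0 (inverse (Suc n)) - {0}. q h x)} \<in> sets borel"
      by (simp add: less_SUP_iff Collect_bex_eq)
  qed
  then show ?thesis
    unfolding eq[abs_def] by (intro borel_measurable_INF) auto
qed

lemma pointwise_lip_leI:
  assumes "0 < \<delta>" and "\<And>y. dist y x < \<delta> \<Longrightarrow> y \<noteq> x \<Longrightarrow> ennreal (dist (f y) (f x)) \<le> ennreal (C * dist y x)"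
  shows "pointwise_lip f x \<le> ennreal C"
  unfolding pointwise_lip_def
proof (rule Limsup_bounded)
  show "\<forall>\<^sub>F y in at x. ennreal (dist (f y) (f x) / dist x y) \<le> ennreal C"
    unfolding eventually_at
  proof (intro exI conjI ballI impI)
    show "0 < \<delta>" by fact
    fix y assume y: "y \<noteq> x \<and> dist y x < \<delta>"
    then have d: "0 < dist y x" by simp
    have "dist (f y) (f x) \<le> C * dist y x \<or> dist (f y) (f x) = 0"
      using assms(2)[of y] y by (cases "0 \<le> C * dist y x") (auto simp: ennreal_neg)
    then show "ennreal (dist (f y) (f x) / dist x y) \<le> ennreal C"
    proof
      assume "dist (f y) (f x) \<le> C * dist y x"
      then show ?thesis using d by (intro ennreal_leI) (simp add: dist_commute[of x y] divide_le_eq)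
    qed simp
  qed
qed

lemma pointwise_lip_less:
  assumes "pointwise_lip f x < ennreal C"
  obtains \<delta> where "\<delta> > 0" "\<And>y. dist y x < \<delta> \<Longrightarrow> dist (f y) (f x) \<le> C * dist y x"
proof -
  have C: "0 < C" using assms by (metis ennreal_neg not_le not_less_zero less_le_not_le)
  obtain d where d: "d > 0" "\<And>y. y \<noteq> x \<Longrightarrow> dist y x < d \<Longrightarrow> ennreal (dist (f y) (f x) / dist x y) < ennreal C"
    using Limsup_lessD[OF assms[unfolded pointwise_lip_def]] unfolding eventually_at by auto
  show ?thesis
  proof (rule that[OF d(1)])
    fix y assume y: "dist y x < d"
    show "dist (f y) (f x) \<le> C * dist y x"
    proof (cases "y = x")
      case False
      then have "dist (f y) (f x) / dist x y < C"
        using d(2)[OF False y] C by (simp add: ennreal_less_iff)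
      then show ?thesis using False by (simp add: divide_less_eq dist_commute[of x y])
    qed simp
  qed
qed

lemma pointwise_lip_lipschitz:
  assumes "L-lipschitz_on UNIV f"
  shows "pointwise_lip f x \<le> ennreal L"
  using lipschitz_onD[OF assms] by (intro pointwise_lip_leI[of 1]) (auto intro!: ennreal_leI)

lemma pointwise_lip_cong:
  assumes "open U" "x \<in> U" "\<And>y. y \<in> U \<Longrightarrow> f y = g y"
  shows "pointwise_lip f x = pointwise_lip g x"
  unfolding pointwise_lip_def
proof (rule Limsup_eq)
  show "\<forall>\<^sub>F y in at x. ennreal (dist (f y) (f x) / dist x y) = ennreal (dist (g y) (g x) / dist x y)"
    using eventually_at_in_open'[OF assms(1,2)] by (rule eventually_mono) (use assms in simp)
qed

text \<open>Finiteness excludes the product of 0 and infinity, for which the inequality fails: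
  consider the square root of |x| after the square function, at 0.\<close>

lemma pointwise_lip_compose:
  assumes g: "pointwise_lip g t < \<infinity>" and f: "pointwise_lip f (g t) < \<infinity>"
  shows "pointwise_lip (f \<circ> g) t \<le> pointwise_lip f (g t) * pointwise_lip g t"
proof -
  obtain B where B: "0 \<le> B" "pointwise_lip g t = ennreal B"
    using g by (cases "pointwise_lip g t") auto
  obtain A where A: "0 \<le> A" "pointwise_lip f (g t) = ennreal A"
    using f by (cases "pointwise_lip f (g t)") auto
  have le: "pointwise_lip (f \<circ> g) t \<le> ennreal ((A + e) * (B + e))" if e: "0 < e" for e
  proof -
    have "pointwise_lip g t < ennreal (B + e)" using B e by (simp add: ennreal_less_iff)
    then obtain d1 where d1: "d1 > 0" "\<And>y. dist y t < d1 \<Longrightarrow> dist (g y) (g t) \<le> (B + e) * dist y t"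
      by (rule pointwise_lip_less) auto
    have "pointwise_lip f (g t) < ennreal (A + e)" using A e by (simp add: ennreal_less_iff)
    then obtain d2 where d2: "d2 > 0" "\<And>y. dist y (g t) < d2 \<Longrightarrow> dist (f y) (f (g t)) \<le> (A + e) * dist y (g t)"
      by (rule pointwise_lip_less) auto
    show ?thesis
    proof (rule pointwise_lip_leI)
      show "0 < min d1 (d2 / (B + e))" using d1 d2 B e by simp
      fix y assume "dist y t < min d1 (d2 / (B + e))" "y \<noteq> t"
      then have y: "dist y t < d1" "dist y t * (B + e) < d2"
        using B e by (auto simp: pos_less_divide_eq)
      have g1: "dist (g y) (g t) \<le> (B + e) * dist y t" using d1(2) y by blast
      then have "dist (g y) (g t) < d2" using y by (simp add: mult.commute)
      then have "dist (f (g y)) (f (g t)) \<le> (A + e) * dist (g y) (g t)" using d2(2) by blast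
      also have "\<dots> \<le> (A + e) * ((B + e) * dist y t)"
        using g1 A e by (intro mult_left_mono) auto
      finally show "ennreal (dist ((f \<circ> g) y) ((f \<circ> g) t)) \<le> ennreal ((A + e) * (B + e) * dist y t)"
        by (intro ennreal_leI) (simp add: mult.assoc)
    qed
  qed
  have "((\<lambda>e. ennreal ((A + e) * (B + e))) \<longlongrightarrow> ennreal ((A + 0) * (B + 0))) (at_right 0)"
    by (intro tendsto_intros tendsto_ennrealI)
  then have "pointwise_lip (f \<circ> g) t \<le> ennreal ((A + 0) * (B + 0))"
  proof (rule tendsto_lowerbound)
    show "\<forall>\<^sub>F e in at_right 0. pointwise_lip (f \<circ> g) t \<le> ennreal ((A + e) * (B + e))"
      using le by (auto simp: eventually_at_right_less eventually_at_filter)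
  qed simp
  then show ?thesis using A B by (simp add: ennreal_mult)
qed

text \<open>Upper bounds will be available only at rational levels q above g, and with an error e;
  this turns them into a bound by g itself.\<close>

lemma ennreal_le_rat_bounds:
  fixes P g :: ennreal
  assumes "\<And>q e. q \<in> \<rat> \<Longrightarrow> 0 \<le> q \<Longrightarrow> g < ennreal q \<Longrightarrow> 0 < e \<Longrightarrow> P \<le> ennreal (q + e)"
  shows "P \<le> g"
proof (rule ccontr)
  assume "\<not> P \<le> g"
  then obtain r :: rat where r: "g < ennreal (real_of_rat r)" "ennreal (real_of_rat r) < P"
    using ennreal_rat_dense[of g P] by (auto simp: not_le)
  then have pos: "0 \<le> real_of_rat r" by (metis ennreal_neg linear not_less_zero)
  have "P \<le> ennreal (real_of_rat r)"
  proof (rule ennreal_le_epsilon)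
    fix e :: real assume "e > 0"
    then show "P \<le> ennreal (real_of_rat r) + ennreal e"
      using assms[of "real_of_rat r" e] r pos by (simp add: ennreal_plus)
  qed
  with r show False by simp
qed

text \<open>One-sided Lebesgue differentiation. Subtraction in \<open>ennreal\<close> truncates at
  0, so the excess \<open>g y - ennreal q\<close> vanishes at x once g x < q, and small averages of
  the excess say that the averages of g near x hardly exceed q. Rational q keep the exceptional sets
  countable in number.\<close>

lemma AE_excess_averages:
  fixes g :: "'a::euclidean_space \<Rightarrow> ennreal"
  assumes [measurable]: "g \<in> borel_measurable borel" and U: "open U"
    and fin: "(\<integral>\<^sup>+x\<in>U. g x \<partial>lborel) < \<infinity>"
  shows "AE x in lborel. x \<in> U \<longrightarrow>
    (\<forall>q\<in>\<rat>. 0 \<le> q \<longrightarrow> g x < ennreal q \<longrightarrow> vanishing_averages (\<lambda>y. g y - ennreal q) x)"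
proof -
  have "AE x in lborel. \<forall>q\<in>\<rat>. x \<in> U \<and> g x - ennreal q = 0 \<longrightarrow> vanishing_averages (\<lambda>y. g y - ennreal q) x"
  proof (subst AE_ball_countable[OF countable_rat], rule ballI)
    fix q :: real
    have "(\<integral>\<^sup>+x\<in>U. g x - ennreal q \<partial>lborel) \<le> (\<integral>\<^sup>+x\<in>U. g x \<partial>lborel)"
      by (intro nn_integral_mono mult_right_mono) (auto simp: diff_le_self_ennreal)
    then have "(\<integral>\<^sup>+x\<in>U. g x - ennreal q \<partial>lborel) < \<infinity>" using fin by simp
    then show "AE x in lborel. x \<in> U \<and> g x - ennreal q = 0 \<longrightarrow> vanishing_averages (\<lambda>y. g y - ennreal q) x"
      by (intro AE_vanishing_averages U) auto
  qed
  then show ?thesis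
  proof (eventually_elim, intro impI ballI)
    fix x q assume A: "\<forall>q\<in>\<rat>. x \<in> U \<and> g x - ennreal q = 0 \<longrightarrow> vanishing_averages (\<lambda>y. g y - ennreal q) x"
      and x: "x \<in> U" and q: "q \<in> \<rat>" "0 \<le> q" "g x < ennreal q"
    have "g x < top" using q(3) by (rule less_trans) simp
    then have "g x - ennreal q = 0" using q by (simp add: diff_eq_0_iff_ennreal less_imp_le)
    then show "vanishing_averages (\<lambda>y. g y - ennreal q) x" using A x q by blast
  qed
qed

subsection \<open>Metric speed\<close>

lemma speed_bound_subinterval:
  assumes "speed_bound (a, b, \<gamma>) h" "a \<le> s" "t \<le> b"
  shows "speed_bound (s, t, \<gamma>) h"
proof -
  have "set_integrable lebesgue {s..t} h"
    by (rule set_integrable_subset[of lebesgue "{a..b}"]) (use assms in \<open>auto simp: speed_bound_def\<close>)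
  then show ?thesis using assms by (auto simp: speed_bound_def)
qed

lemma speed_bound_dist_le:
  assumes h: "speed_bound (a, b, \<gamma>) h" and st: "a \<le> s" "s \<le> t" "t \<le> b"
  shows "h integrable_on {s..t}" "dist (\<gamma> s) (\<gamma> t) \<le> integral {s..t} h"
    "ennreal (dist (\<gamma> s) (\<gamma> t)) \<le> (\<integral>\<^sup>+r\<in>{s..t}. ennreal (h r) \<partial>lebesgue)"
proof -
  have h': "speed_bound (s, t, \<gamma>) h" using speed_bound_subinterval[OF h] st by blast
  then have i: "set_integrable lebesgue {s..t} h" by (simp add: speed_bound_def)
  then show "h integrable_on {s..t}" by (rule set_lebesgue_integral_eq_integral)
  show 1: "dist (\<gamma> s) (\<gamma> t) \<le> integral {s..t} h"
  proof (cases "s = t")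
    case False
    then have "dist (\<gamma> s) (\<gamma> t) \<le> set_lebesgue_integral lebesgue {s..t} h"
      using h st by (auto simp: speed_bound_def)
    then show ?thesis using set_lebesgue_integral_eq_integral(2)[OF i] by simp
  qed simp
  have "ennreal (set_lebesgue_integral lebesgue {s..t} h)
      \<le> (\<integral>\<^sup>+r. ennreal (indicator {s..t} r *\<^sub>R h r) \<partial>lebesgue)"
  proof -
    have i': "integrable lebesgue (\<lambda>r. indicator {s..t} r *\<^sub>R h r)"
      using i by (simp add: set_integrable_def)
    then have "set_lebesgue_integral lebesgue {s..t} h
        \<le> integral\<^sup>L lebesgue (\<lambda>r. max 0 (indicator {s..t} r *\<^sub>R h r))"
      unfolding set_lebesgue_integral_def by (intro integral_mono) (auto intro: integrable_max)
    then have "ennreal (set_lebesgue_integral lebesgue {s..t} h)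
        \<le> ennreal (integral\<^sup>L lebesgue (\<lambda>r. max 0 (indicator {s..t} r *\<^sub>R h r)))"
      by (rule ennreal_leI)
    also have "\<dots> = (\<integral>\<^sup>+r. ennreal (max 0 (indicator {s..t} r *\<^sub>R h r)) \<partial>lebesgue)"
      using i' by (intro nn_integral_eq_integral[symmetric]) (auto intro: integrable_max)
    also have "\<dots> = (\<integral>\<^sup>+r. ennreal (indicator {s..t} r *\<^sub>R h r) \<partial>lebesgue)"
      by (rule nn_integral_cong) (simp add: max_def ennreal_neg)
    finally show ?thesis .
  qed
  also have "(\<integral>\<^sup>+r. ennreal (indicator {s..t} r *\<^sub>R h r) \<partial>lebesgue) = (\<integral>\<^sup>+r\<in>{s..t}. ennreal (h r) \<partial>lebesgue)"
    by (rule nn_integral_cong) (simp split: split_indicator)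
  finally show "ennreal (dist (\<gamma> s) (\<gamma> t)) \<le> (\<integral>\<^sup>+r\<in>{s..t}. ennreal (h r) \<partial>lebesgue)"
    using order_trans[OF ennreal_leI[OF 1]] set_lebesgue_integral_eq_integral(2)[OF i] by simp
qed

text \<open>With r = |s - t|, the integral of h between s and t is at most q r plus the integral of
  the excess over q on \<open>cball t r\<close>. At almost every t the average of that excess
  becomes as small as desired. The length 2 r of \<open>cball t r\<close> is the reason for
  \<open>e / 2\<close> in the proof.\<close>

lemma pointwise_lip_le_speed_bound:
  assumes h: "speed_bound (a, b, \<gamma>) h"
  shows "AE t in lborel. a < t \<and> t < b \<longrightarrow> pointwise_lip \<gamma> t \<le> ennreal (h t)"
proof -
  have "(\<lambda>t. indicator {a..b} t *\<^sub>R h t) \<in> borel_measurable lebesgue"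
    and hi: "integrable lebesgue (\<lambda>t. indicator {a..b} t *\<^sub>R h t)"
    using h by (auto simp: speed_bound_def set_integrable_def)
  then obtain h0 where [measurable]: "h0 \<in> borel_measurable lborel"
    and h0: "AE t in lborel. indicator {a..b} t *\<^sub>R h t = h0 t"
    using completion_ex_borel_measurable_real by blast
  define g where "g t = ennreal (h0 t)" for t
  have [measurable]: "g \<in> borel_measurable borel" unfolding g_def by simp
  have "(\<integral>\<^sup>+t\<in>{a<..<b}. g t \<partial>lborel) \<le> (\<integral>\<^sup>+t. ennreal (norm (indicator {a..b} t *\<^sub>R h t)) \<partial>lborel)"
    using h0 by (intro nn_integral_mono_AE) (auto simp: g_def abs_real_def ennreal_neg split: split_indicator)
  also have "\<dots> = (\<integral>\<^sup>+t. ennreal (norm (indicator {a..b} t *\<^sub>R h t)) \<partial>lebesgue)"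
    by (rule nn_integral_completion[symmetric])
  also have "\<dots> < \<infinity>" using hi by (simp add: integrable_iff_bounded)
  finally have fin: "(\<integral>\<^sup>+t\<in>{a<..<b}. g t \<partial>lborel) < \<infinity>" .
  have dist_le: "ennreal (dist (\<gamma> s) (\<gamma> t)) \<le> (\<integral>\<^sup>+r\<in>{s..t}. g r \<partial>lborel)"
    if "a \<le> s" "s \<le> t" "t \<le> b" for s t
  proof -
    have "ennreal (dist (\<gamma> s) (\<gamma> t)) \<le> (\<integral>\<^sup>+r\<in>{s..t}. ennreal (h r) \<partial>lebesgue)"
      using speed_bound_dist_le(3)[OF h] that by blast
    also have "\<dots> = (\<integral>\<^sup>+r\<in>{s..t}. ennreal (h r) \<partial>lborel)" by (rule nn_integral_completion)
    also have "\<dots> \<le> (\<integral>\<^sup>+r\<in>{s..t}. g r \<partial>lborel)"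
      using h0 that by (intro nn_integral_mono_AE) (auto simp: g_def split: split_indicator)
    finally show ?thesis .
  qed
  have "g \<in> borel_measurable borel" by measurable
  from AE_excess_averages[OF this open_greaterThanLessThan fin] h0 show ?thesis
  proof (eventually_elim, intro impI)
    fix t assume ht: "indicator {a..b} t *\<^sub>R h t = h0 t" and t: "a < t \<and> t < b"
    assume A: "t \<in> {a<..<b} \<longrightarrow>
      (\<forall>q\<in>\<rat>. 0 \<le> q \<longrightarrow> g t < ennreal q \<longrightarrow> vanishing_averages (\<lambda>y. g y - ennreal q) t)"
    have "pointwise_lip \<gamma> t \<le> g t"
    proof (rule ennreal_le_rat_bounds)
      fix q e :: real assume q: "q \<in> \<rat>" "0 \<le> q" "g t < ennreal q" and e: "0 < e"
      have "t \<in> {a<..<b}" "0 < e / 2" using t e by auto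
      from A[rule_format, OF this(1) q, unfolded vanishing_averages_def, rule_format, OF this(2)] obtain r0 where r0: "r0 > 0" "\<And>r. 0 < r \<and> r < r0 \<Longrightarrow>
          (\<integral>\<^sup>+y\<in>cball t r. g y - ennreal q \<partial>lborel) \<le> ennreal (e / 2) * emeasure lborel (cball t r)"
        by blast
      show "pointwise_lip \<gamma> t \<le> ennreal (q + e)"
      proof (rule pointwise_lip_leI)
        show "0 < min r0 (min (t - a) (b - t))" using r0 t by simp
        fix s assume s: "dist s t < min r0 (min (t - a) (b - t))" "s \<noteq> t"
        define r where "r = dist s t"
        have r: "0 < r" "r < r0" using s by (auto simp: r_def)
        have st: "a \<le> min s t" "min s t \<le> max s t" "max s t \<le> b" using s t by (auto simp: dist_real_def)
        have "dist (\<gamma> s) (\<gamma> t) = dist (\<gamma> (min s t)) (\<gamma> (max s t))"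
          by (auto simp: min_def max_def dist_commute)
        also have "ennreal \<dots> \<le> (\<integral>\<^sup>+y\<in>{min s t..max s t}. g y \<partial>lborel)" by (rule dist_le[OF st])
        also have "\<dots> \<le> (\<integral>\<^sup>+y. ennreal q * indicator {min s t..max s t} y
            + (g y - ennreal q) * indicator (cball t r) y \<partial>lborel)"
        proof (rule nn_integral_mono)
          fix y
          have "g y \<le> ennreal q + (g y - ennreal q)"
            by (cases "ennreal q \<le> g y") (auto simp: add_diff_inverse_ennreal intro: add_increasing2)
          then show "g y * indicator {min s t..max s t} y \<le> ennreal q * indicator {min s t..max s t} y
            + (g y - ennreal q) * indicator (cball t r) y"
            by (auto simp: r_def dist_real_def split: split_indicator)
        qed
        also have "\<dots> = ennreal q * emeasure lborel {min s t..max s t}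
            + (\<integral>\<^sup>+y\<in>cball t r. g y - ennreal q \<partial>lborel)"
        proof -
          have [measurable]: "cball t r \<in> sets borel" by simp
          show ?thesis by (subst nn_integral_add) (measurable, simp add: nn_integral_cmult_indicator)
        qed
        also have "\<dots> \<le> ennreal q * ennreal r + ennreal (e / 2) * emeasure lborel (cball t r)"
          using r0(2)[of r] r by (intro add_mono mult_left_mono) (auto simp: r_def dist_real_def)
        also have "\<dots> = ennreal ((q + e) * r)"
          using r q e by (simp add: cball_eq_atLeastAtMost ennreal_mult[symmetric] ennreal_plus[symmetric] algebra_simps del: ennreal_plus)
        finally show "ennreal (dist (\<gamma> s) (\<gamma> t)) \<le> ennreal ((q + e) * dist s t)" by (simp add: r_def)
      qed
    qed
    then show "pointwise_lip \<gamma> t \<le> ennreal (h t)" using ht t by (simp add: g_def)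
  qed
qed

text \<open>So the pointwise Lipschitz constant is itself a speed bound.
  \<open>increment_le_integral\<close> is applied to the distance from \<open>\<gamma> a\<close>;
  the given bound h controls the increments on the exceptional set.\<close>

lemma dist_le_integral_pointwise_lip:
  assumes h: "speed_bound (a, b, \<gamma>) h" and \<gamma>: "continuous_on UNIV \<gamma>" and ab: "a \<le> b"
  shows "set_integrable lebesgue {a..b} (\<lambda>t. enn2real (pointwise_lip \<gamma> t))"
    and "dist (\<gamma> a) (\<gamma> b) \<le> set_lebesgue_integral lebesgue {a..b} (\<lambda>t. enn2real (pointwise_lip \<gamma> t))"
proof -
  let ?D = "\<lambda>t. enn2real (pointwise_lip \<gamma> t)"
  have [measurable]: "pointwise_lip \<gamma> \<in> borel_measurable borel"
    using \<gamma> by (rule pointwise_lip_measurable)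
  have bound: "AE t in lborel. a < t \<and> t < b \<longrightarrow> pointwise_lip \<gamma> t \<le> ennreal (h t)"
    using h by (rule pointwise_lip_le_speed_bound)
  then have bound': "AE t in lborel. t \<in> {a..b} \<longrightarrow> pointwise_lip \<gamma> t \<le> ennreal (h t)"
    using AE_lborel_singleton[of a] AE_lborel_singleton[of b] by eventually_elim auto
  have hi: "integrable lebesgue (\<lambda>t. indicator {a..b} t *\<^sub>R h t)"
    using h by (auto simp: speed_bound_def set_integrable_def)
  show Di: "set_integrable lebesgue {a..b} ?D"
    unfolding set_integrable_def
  proof (rule Bochner_Integration.integrable_bound[OF hi])
    have "AE t in lebesgue. t \<in> {a..b} \<longrightarrow> pointwise_lip \<gamma> t \<le> ennreal (h t)"
      using bound' by (rule AE_completion)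
    then show "AE t in lebesgue. norm (indicator {a..b} t *\<^sub>R ?D t) \<le> norm (indicator {a..b} t *\<^sub>R h t)"
    proof eventually_elim
      fix t assume *: "t \<in> {a..b} \<longrightarrow> pointwise_lip \<gamma> t \<le> ennreal (h t)"
      show "norm (indicator {a..b} t *\<^sub>R ?D t) \<le> norm (indicator {a..b} t *\<^sub>R h t)"
      proof (cases "t \<in> {a..b}")
        case True
        then have "?D t \<le> enn2real (ennreal (h t))" using * by (intro enn2real_mono) auto
        also have "\<dots> \<le> \<bar>h t\<bar>" by (cases "0 \<le> h t") (auto simp: ennreal_neg)
        finally show ?thesis using True by simp
      qed simp
    qed
    have "(\<lambda>t. indicator {a..b} t *\<^sub>R ?D t) \<in> borel_measurable lborel" by measurable
    then show "(\<lambda>t. indicator {a..b} t *\<^sub>R ?D t) \<in> borel_measurable lebesgue" by (rule measurable_completion)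
  qed
  define Z where "Z = {t. \<not> (a < t \<and> t < b \<longrightarrow> pointwise_lip \<gamma> t \<le> ennreal (h t))}"
  have "AE t in lborel. t \<notin> Z" using bound by (rule AE_mp) (auto simp: Z_def)
  then have "AE t in lebesgue. t \<notin> Z" by (rule AE_completion)
  then obtain N where "Z \<subseteq> N" "N \<in> null_sets lebesgue" by (auto simp: eventually_ae_filter)
  then have "negligible Z" using negligible_iff_null_sets negligible_subset by blast
  then have Z: "negligible (Z \<union> {a, b})" by (intro negligible_Un) auto
  have "dist (\<gamma> a) (\<gamma> b) - dist (\<gamma> a) (\<gamma> a) \<le> integral {a..b} ?D"
  proof (rule increment_le_integral[OF ab _ _ Z, where h = h])
    show "h integrable_on {a..b}" using speed_bound_dist_le(1)[OF h] ab by blast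
    show "?D integrable_on {a..b}" using Di by (rule set_lebesgue_integral_eq_integral)
    fix s t assume st: "a \<le> s" "s \<le> t" "t \<le> b"
    have "dist (\<gamma> a) (\<gamma> t) - dist (\<gamma> a) (\<gamma> s) \<le> dist (\<gamma> s) (\<gamma> t)"
      using dist_triangle[of "\<gamma> a" "\<gamma> t" "\<gamma> s"] by simp
    also have "\<dots> \<le> integral {s..t} h" using speed_bound_dist_le(2)[OF h st] .
    finally show "dist (\<gamma> a) (\<gamma> t) - dist (\<gamma> a) (\<gamma> s) \<le> integral {s..t} h" .
  next
    fix t e assume t: "t \<in> {a..b} - (Z \<union> {a, b})" and e: "(0::real) < e"
    have fin: "pointwise_lip \<gamma> t < \<infinity>" using t by (auto simp: Z_def intro: le_less_trans)
    then have "pointwise_lip \<gamma> t = ennreal (?D t)" by simp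
    also have "\<dots> < ennreal (?D t + e)" using e by (simp add: ennreal_less_iff)
    finally obtain \<delta> where \<delta>: "\<delta> > 0" "\<And>s. dist s t < \<delta> \<Longrightarrow> dist (\<gamma> s) (\<gamma> t) \<le> (?D t + e) * dist s t"
      by (rule pointwise_lip_less) blast
    show "\<exists>\<delta>>0. \<forall>s\<in>{a..b}. \<bar>s - t\<bar> < \<delta> \<longrightarrow>
        \<bar>dist (\<gamma> a) (\<gamma> s) - dist (\<gamma> a) (\<gamma> t)\<bar> \<le> (?D t + e) * \<bar>s - t\<bar>"
    proof (intro exI[of _ \<delta>] conjI ballI impI)
      fix s assume "\<bar>s - t\<bar> < \<delta>"
      then have "dist (\<gamma> s) (\<gamma> t) \<le> (?D t + e) * \<bar>s - t\<bar>" using \<delta>(2)[of s] by (simp add: dist_real_def)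
      then show "\<bar>dist (\<gamma> a) (\<gamma> s) - dist (\<gamma> a) (\<gamma> t)\<bar> \<le> (?D t + e) * \<bar>s - t\<bar>"
        using dist_triangle[of "\<gamma> a" "\<gamma> t" "\<gamma> s"] dist_triangle[of "\<gamma> a" "\<gamma> s" "\<gamma> t"]
        by (simp add: dist_commute)
    qed (rule \<delta>)
  qed
  then show "dist (\<gamma> a) (\<gamma> b) \<le> set_lebesgue_integral lebesgue {a..b} ?D"
    using set_lebesgue_integral_eq_integral(2)[OF Di] by simp
qed

text \<open>A curve is arbitrary outside its parameter interval. Extending it by constants gives the
  global continuity that \<open>pointwise_lip_measurable\<close> requires.\<close>

lemma continuous_on_clamp_real:
  fixes \<gamma> :: "real \<Rightarrow> 'a::topological_space"
  assumes "continuous_on {a..b} \<gamma>" "a \<le> b"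
  shows "continuous_on UNIV (\<lambda>t. \<gamma> (max a (min b t)))"
  using assms by (intro continuous_on_compose2[OF assms(1)] continuous_intros) auto

lemma speed_bound_cong:
  assumes "\<And>t. t \<in> {a..b} \<Longrightarrow> \<gamma> t = \<gamma>' t"
  shows "speed_bound (a, b, \<gamma>) h \<longleftrightarrow> speed_bound (a, b, \<gamma>') h"
  using assms by (auto simp: speed_bound_def)

lemma AE_pointwise_lip_clamp:
  assumes h: "speed_bound (a, b, \<gamma>) h"
  shows "AE t in lborel. t \<in> {a..b} \<longrightarrow> pointwise_lip (\<lambda>t. \<gamma> (max a (min b t))) t \<le> ennreal (h t)"
proof -
  have "speed_bound (a, b, \<lambda>t. \<gamma> (max a (min b t))) h"
    using h by (subst speed_bound_cong[of _ _ _ \<gamma>]) auto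
  then have "AE t in lborel. a < t \<and> t < b \<longrightarrow> pointwise_lip (\<lambda>t. \<gamma> (max a (min b t))) t \<le> ennreal (h t)"
    by (rule pointwise_lip_le_speed_bound)
  then show ?thesis
    using AE_lborel_singleton[of a] AE_lborel_singleton[of b] by eventually_elim auto
qed

text \<open>The choice in \<open>metric_speed\<close> is realized by the pointwise Lipschitz
  constant of the extended curve: it is a speed bound by
  \<open>dist_le_integral_pointwise_lip\<close> and lies below all others by
  \<open>pointwise_lip_le_speed_bound\<close>. The latter compares with
  \<open>ennreal (h t)\<close>, so h must first be shown nonnegative almost everywhere.\<close>

lemma metric_speed:
  assumes c: "(a, b, \<gamma>) \<in> ac_curves"
  shows "speed_bound (a, b, \<gamma>) (metric_speed (a, b, \<gamma>))"
    and "speed_bound (a, b, \<gamma>) h \<Longrightarrow> AE t in lebesgue. t \<in> {a..b} \<longrightarrow> metric_speed (a, b, \<gamma>) t \<le> h t"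
proof -
  obtain g where ab: "a \<le> b" and cont: "continuous_on {a..b} \<gamma>" and g: "speed_bound (a, b, \<gamma>) g"
    using c by (auto simp: ac_curves_def)
  let ?\<gamma> = "\<lambda>t. \<gamma> (max a (min b t))"
  let ?m = "\<lambda>t. enn2real (pointwise_lip ?\<gamma> t)"
  have cont': "continuous_on UNIV ?\<gamma>" using cont ab by (rule continuous_on_clamp_real)
  have g': "speed_bound (a, b, ?\<gamma>) g"
    using g by (subst speed_bound_cong[of _ _ _ \<gamma>]) auto
  have "speed_bound (a, b, ?\<gamma>) ?m"
    unfolding speed_bound_def prod.case
  proof (intro conjI allI impI)
    show "set_integrable lebesgue {a..b} ?m" by (rule dist_le_integral_pointwise_lip[OF g' cont' ab])
    fix s t assume "a \<le> s \<and> s < t \<and> t \<le> b"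
    then show "dist (?\<gamma> s) (?\<gamma> t) \<le> set_lebesgue_integral lebesgue {s..t} ?m"
      by (intro dist_le_integral_pointwise_lip[OF speed_bound_subinterval[OF g'] cont']) auto
  qed
  then have m: "speed_bound (a, b, \<gamma>) ?m"
    by (subst speed_bound_cong[of _ _ _ ?\<gamma>]) auto
  have min: "AE t in lebesgue. t \<in> {a..b} \<longrightarrow> ?m t \<le> h t" if h: "speed_bound (a, b, \<gamma>) h" for h
  proof -
    \<comment> \<open>\<open>h + 1\<close> bounds the speed of the identity curve, whose pointwise Lipschitz constant is \<open>1\<close>.\<close>
    have nonneg: "AE t in lborel. t \<in> {a..b} \<longrightarrow> 0 \<le> h t"
    proof -
      have "speed_bound (a, b, \<lambda>t. t) (\<lambda>t. h t + 1)"
        unfolding speed_bound_def prod.case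
      proof (intro conjI allI impI)
        have i1: "set_integrable lebesgue {s..t} (\<lambda>t. 1 :: real)" for s t :: real
          by (auto simp: set_integrable_def emeasure_lborel_Icc_eq intro!: integrable_real_indicator)
        then show "set_integrable lebesgue {a..b} (\<lambda>t. h t + 1)"
          using h by (auto simp: speed_bound_def)
        fix s t assume st: "a \<le> s \<and> s < t \<and> t \<le> b"
        have "set_integrable lebesgue {s..t} h"
          using speed_bound_subinterval[OF h] st by (auto simp: speed_bound_def)
        then have "set_lebesgue_integral lebesgue {s..t} (\<lambda>t. h t + 1)
            = set_lebesgue_integral lebesgue {s..t} h + set_lebesgue_integral lebesgue {s..t} (\<lambda>t. 1)"
          using i1 by simp
        moreover have "dist (\<gamma> s) (\<gamma> t) \<le> set_lebesgue_integral lebesgue {s..t} h"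
          using h st by (auto simp: speed_bound_def)
        moreover have "set_lebesgue_integral lebesgue {s..t} (\<lambda>t. 1 :: real) = t - s"
          using st by (simp add: set_lebesgue_integral_def)
        ultimately show "dist s t \<le> set_lebesgue_integral lebesgue {s..t} (\<lambda>t. h t + 1)"
          using st order_trans[OF zero_le_dist] by (simp add: dist_real_def)
      qed
      then have "AE t in lborel. a < t \<and> t < b \<longrightarrow> pointwise_lip (\<lambda>t::real. t) t \<le> ennreal (h t + 1)"
        by (rule pointwise_lip_le_speed_bound)
      then show ?thesis
        using AE_lborel_singleton[of a] AE_lborel_singleton[of b]
      proof eventually_elim
        fix t assume *: "a < t \<and> t < b \<longrightarrow> pointwise_lip (\<lambda>t::real. t) t \<le> ennreal (h t + 1)" "t \<noteq> a" "t \<noteq> b"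
        have "1 \<le> pointwise_lip (\<lambda>t::real. t) t"
          unfolding pointwise_lip_def
          by (rule le_Limsup) (auto simp: eventually_at dist_commute intro!: exI[of _ 1])
        then have "1 \<le> ennreal (h t + 1)" if "t \<in> {a..b}"
          by (rule order_trans) (use * that in auto)
        then show "t \<in> {a..b} \<longrightarrow> 0 \<le> h t" by simp
      qed
    qed
    have "AE t in lborel. t \<in> {a..b} \<longrightarrow> ?m t \<le> h t"
      using AE_pointwise_lip_clamp[OF h] nonneg
    proof eventually_elim
      fix t assume "t \<in> {a..b} \<longrightarrow> pointwise_lip ?\<gamma> t \<le> ennreal (h t)" "t \<in> {a..b} \<longrightarrow> 0 \<le> h t"
      then show "t \<in> {a..b} \<longrightarrow> ?m t \<le> h t" by (auto intro: enn2real_leI)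
    qed
    then show ?thesis by (rule AE_completion)
  qed
  have "\<exists>g. speed_bound (a, b, \<gamma>) g \<and>
     (\<forall>h. speed_bound (a, b, \<gamma>) h \<longrightarrow> (AE t in lebesgue. t \<in> {a..b} \<longrightarrow> g t \<le> h t))"
    using m min by blast
  from someI_ex[OF this]
  show "speed_bound (a, b, \<gamma>) (metric_speed (a, b, \<gamma>))"
    and "speed_bound (a, b, \<gamma>) h \<Longrightarrow> AE t in lebesgue. t \<in> {a..b} \<longrightarrow> metric_speed (a, b, \<gamma>) t \<le> h t"
    by (auto simp: metric_speed_def)
qed

text \<open>The real curve obtained by composing with f has speed bound \<open>L * h\<close>, and
  the chain inequality bounds its pointwise Lipschitz constant. Allowing any speed bound h lets a
  piece of a curve be treated with the metric speed of the whole curve, as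
  \<open>curve_integral_shell\<close> does.\<close>

lemma upper_gradient_inequality:
  fixes f :: "'a::metric_space \<Rightarrow> real"
  assumes ab: "a \<le> b" and cont: "continuous_on {a..b} \<gamma>" and h: "speed_bound (a, b, \<gamma>) h"
    and f: "L-lipschitz_on UNIV f"
  shows "ennreal \<bar>f (\<gamma> b) - f (\<gamma> a)\<bar> \<le> (\<integral>\<^sup>+t\<in>{a..b}. slope f (\<gamma> t) * ennreal (h t) \<partial>lebesgue)"
proof -
  let ?\<gamma> = "\<lambda>t. \<gamma> (max a (min b t))"
  have fc: "continuous_on UNIV f" using f by (rule lipschitz_on_continuous_on)
  have L: "0 \<le> L" using f by (rule lipschitz_on_nonneg)
  have cont': "continuous_on UNIV (f \<circ> ?\<gamma>)"
    using continuous_on_compose2[OF fc continuous_on_clamp_real[OF cont ab]] by (simp add: comp_def)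
  have h': "speed_bound (a, b, f \<circ> ?\<gamma>) (\<lambda>t. L * h t)"
    unfolding speed_bound_def prod.case
  proof (intro conjI allI impI)
    show "set_integrable lebesgue {a..b} (\<lambda>t. L * h t)" using h by (auto simp: speed_bound_def)
    fix s t assume st: "a \<le> s \<and> s < t \<and> t \<le> b"
    then have "dist ((f \<circ> ?\<gamma>) s) ((f \<circ> ?\<gamma>) t) \<le> L * dist (\<gamma> s) (\<gamma> t)"
      using lipschitz_onD[OF f, of "\<gamma> s" "\<gamma> t"] by simp
    also have "\<dots> \<le> L * set_lebesgue_integral lebesgue {s..t} h"
      using h st L by (intro mult_left_mono) (auto simp: speed_bound_def)
    finally show "dist ((f \<circ> ?\<gamma>) s) ((f \<circ> ?\<gamma>) t) \<le> set_lebesgue_integral lebesgue {s..t} (\<lambda>t. L * h t)"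
      by simp
  qed
  let ?D = "\<lambda>t. enn2real (pointwise_lip (f \<circ> ?\<gamma>) t)"
  note D = dist_le_integral_pointwise_lip[OF h' cont' ab]
  have "ennreal \<bar>f (\<gamma> b) - f (\<gamma> a)\<bar> = ennreal (dist ((f \<circ> ?\<gamma>) a) ((f \<circ> ?\<gamma>) b))"
    using ab by (simp add: dist_real_def abs_minus_commute)
  also have "\<dots> \<le> ennreal (set_lebesgue_integral lebesgue {a..b} ?D)"
    using D(2) by (rule ennreal_leI)
  also have "\<dots> = (\<integral>\<^sup>+t. ennreal (indicator {a..b} t *\<^sub>R ?D t) \<partial>lebesgue)"
    unfolding set_lebesgue_integral_def
    using D(1) by (intro nn_integral_eq_integral[symmetric]) (auto simp: set_integrable_def)
  also have "\<dots> \<le> (\<integral>\<^sup>+t\<in>{a..b}. slope f (\<gamma> t) * ennreal (h t) \<partial>lebesgue)"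
  proof (rule nn_integral_mono_AE)
    show "AE t in lebesgue. ennreal (indicator {a..b} t *\<^sub>R ?D t)
        \<le> slope f (\<gamma> t) * ennreal (h t) * indicator {a..b} t"
      using AE_completion[OF AE_pointwise_lip_clamp[OF h]]
    proof eventually_elim
      fix t assume *: "t \<in> {a..b} \<longrightarrow> pointwise_lip ?\<gamma> t \<le> ennreal (h t)"
      show "ennreal (indicator {a..b} t *\<^sub>R ?D t) \<le> slope f (\<gamma> t) * ennreal (h t) * indicator {a..b} t"
      proof (cases "t \<in> {a..b}")
        case True
        then have le: "pointwise_lip ?\<gamma> t \<le> ennreal (h t)" using * by simp
        have "ennreal (?D t) \<le> pointwise_lip (f \<circ> ?\<gamma>) t"
          by (cases "pointwise_lip (f \<circ> ?\<gamma>) t") auto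
        also have "\<dots> \<le> pointwise_lip f (?\<gamma> t) * pointwise_lip ?\<gamma> t"
          using le pointwise_lip_lipschitz[OF f, of "?\<gamma> t"]
          by (intro pointwise_lip_compose) (auto intro: le_less_trans)
        also have "\<dots> \<le> pointwise_lip f (?\<gamma> t) * ennreal (h t)"
          using le by (rule mult_left_mono) simp
        finally show ?thesis using True by (simp add: slope_eq_pointwise_lip)
      qed simp
    qed
  qed
  finally show ?thesis .
qed

lemma curve_integral_slope:
  fixes f :: "'a::metric_space \<Rightarrow> real"
  assumes "(a, b, \<gamma>) \<in> ac_curves" "L-lipschitz_on UNIV f"
  shows "ennreal \<bar>f (\<gamma> b) - f (\<gamma> a)\<bar> \<le> curve_integral (a, b, \<gamma>) (slope f)"
  using upper_gradient_inequality[OF _ _ metric_speed(1)[OF assms(1)] assms(2)] assms(1)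
  by (auto simp: curve_integral_def ac_curves_def)

subsection \<open>Real powers of extended numbers\<close>

lemma ennpowr_ennreal:
  assumes "0 < x \<or> 0 \<le> x \<and> 0 \<le> q"
  shows "ennpowr (ennreal x) q = ennreal (x powr q)"
  using assms by (auto simp: ennpowr_def)

lemma ennpowr_0 [simp]: "0 < q \<Longrightarrow> ennpowr 0 q = 0"
  by (simp add: ennpowr_def)

lemma ennpowr_top [simp]: "0 < q \<Longrightarrow> ennpowr top q = top"
  by (simp add: ennpowr_def)

lemma ennpowr_measurable [measurable]:
  assumes [measurable]: "f \<in> borel_measurable M"
  shows "(\<lambda>x. ennpowr (f x) q) \<in> borel_measurable M"
  unfolding ennpowr_def by measurable

lemma ennpowr_mono:
  assumes "0 < q" "x \<le> y"
  shows "ennpowr x q \<le> ennpowr y q"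
  using assms by (cases x; cases y)
    (auto simp: ennpowr_ennreal top_unique intro!: ennreal_leI powr_mono2)

lemma ennpowr_ennpowr:
  assumes "0 < p" "0 < q"
  shows "ennpowr (ennpowr x p) q = ennpowr x (p * q)"
  using assms by (cases x) (auto simp: ennpowr_ennreal powr_powr)

lemma ennpowr_one [simp]: "ennpowr x 1 = x"
  by (cases x) (auto simp: ennpowr_ennreal)

lemma ennpowr_mult:
  assumes "0 < q"
  shows "ennpowr (x * y) q = ennpowr x q * ennpowr y q"
proof (cases x; cases y)
  fix a b :: real assume "0 \<le> a" "x = ennreal a" "0 \<le> b" "y = ennreal b"
  then show ?thesis using assms
    by (simp add: ennreal_mult[symmetric] ennpowr_ennreal powr_mult)
next
  fix a :: real assume *: "0 \<le> a" "x = ennreal a" "y = top"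
  show ?thesis using assms * by (cases "a = 0") (auto simp: ennreal_mult_top ennpowr_ennreal)
next
  fix b :: real assume *: "0 \<le> b" "y = ennreal b" "x = top"
  show ?thesis using assms * by (cases "b = 0") (auto simp: ennreal_top_mult ennpowr_ennreal)
qed (use assms in auto)

lemma ennpowr_le_iff:
  assumes "0 < p"
  shows "ennpowr x p \<le> y \<longleftrightarrow> x \<le> ennpowr y (1 / p)"
proof
  assume "ennpowr x p \<le> y"
  then have "ennpowr (ennpowr x p) (1 / p) \<le> ennpowr y (1 / p)" using assms by (intro ennpowr_mono) auto
  then show "x \<le> ennpowr y (1 / p)" using assms by (simp add: ennpowr_ennpowr)
next
  assume "x \<le> ennpowr y (1 / p)"
  then have "ennpowr x p \<le> ennpowr (ennpowr y (1 / p)) p" using assms by (intro ennpowr_mono) auto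
  then show "ennpowr x p \<le> y" using assms by (simp add: ennpowr_ennpowr)
qed

lemma ennpowr_SUP_le:
  assumes "0 < p"
  shows "ennpowr (SUP k. g k) p \<le> (\<Sum>k. ennpowr (g k) p)"
proof -
  have "g k \<le> ennpowr (\<Sum>k. ennpowr (g k) p) (1 / p)" for k
    unfolding ennpowr_le_iff[OF assms, symmetric]
    using sum_le_suminf[of "\<lambda>k. ennpowr (g k) p" "{k}"] by simp
  then have "(SUP k. g k) \<le> ennpowr (\<Sum>k. ennpowr (g k) p) (1 / p)" by (rule SUP_least)
  then show ?thesis unfolding ennpowr_le_iff[OF assms] .
qed

subsection \<open>Modulus\<close>

lemma modulus_zeroI:
  assumes "\<And>e. 0 < e \<Longrightarrow> \<exists>g\<in>borel_measurable borel. (\<forall>c\<in>\<Gamma>. 1 \<le> curve_integral c g) \<and>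
    (\<integral>\<^sup>+x. ennpowr (g x) p \<partial>M) \<le> ennreal e"
  shows "modulus p M \<Gamma> = 0"
proof -
  have "modulus p M \<Gamma> \<le> 0"
  proof (rule ennreal_le_epsilon)
    fix e :: real assume "0 < e"
    then obtain g where "g \<in> borel_measurable borel" "\<forall>c\<in>\<Gamma>. 1 \<le> curve_integral c g"
      "(\<integral>\<^sup>+x. ennpowr (g x) p \<partial>M) \<le> ennreal e"
      using assms by blast
    then show "modulus p M \<Gamma> \<le> 0 + ennreal e"
      unfolding modulus_def by (intro INF_lower2[of g]) auto
  qed
  then show ?thesis by simp
qed

lemma modulus_zeroD:
  assumes "modulus p M \<Gamma> = 0" "0 < e"
  obtains g where "g \<in> borel_measurable borel" "\<And>c. c \<in> \<Gamma> \<Longrightarrow> 1 \<le> curve_integral c g"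
    "(\<integral>\<^sup>+x. ennpowr (g x) p \<partial>M) < e"
proof -
  have "modulus p M \<Gamma> < e" using assms by simp
  then show ?thesis unfolding modulus_def INF_less_iff using that by blast
qed

lemma modulus_zero_subset:
  assumes "modulus p M \<Gamma>' = 0" "\<Gamma> \<subseteq> \<Gamma>'"
  shows "modulus p M \<Gamma> = 0"
proof (rule modulus_zeroI)
  fix e :: real assume "0 < e"
  then have "0 < ennreal e" by simp
  from modulus_zeroD[OF assms(1) this] show "\<exists>g\<in>borel_measurable borel. (\<forall>c\<in>\<Gamma>. 1 \<le> curve_integral c g) \<and>
    (\<integral>\<^sup>+x. ennpowr (g x) p \<partial>M) \<le> ennreal e"
    using assms(2) by (metis less_imp_le subsetD)
qed

lemma curve_integral_mono:
  assumes "\<And>x. f x \<le> g x"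
  shows "curve_integral c f \<le> curve_integral c g"
  using assms by (auto simp: curve_integral_def split: prod.split intro!: nn_integral_mono mult_right_mono)

text \<open>Test functions of energy below \<open>e * (1/2)^Suc k\<close> are combined by a supremum
  rather than a sum, because the p-th power of a supremum is at most the sum of the p-th
  powers.\<close>

lemma modulus_zero_UN:
  assumes p: "0 < p" and M: "sets M = sets borel"
    and "\<And>k::nat. modulus p M (\<Gamma> k) = 0"
  shows "modulus p M (\<Union>k. \<Gamma> k) = 0"
proof (rule modulus_zeroI)
  fix e :: real assume e: "0 < e"
  have "\<exists>g. g \<in> borel_measurable borel \<and> (\<forall>c \<in> \<Gamma> k. 1 \<le> curve_integral c g) \<and>
    (\<integral>\<^sup>+x. ennpowr (g x) p \<partial>M) < ennreal (e * (1/2)^Suc k)" for k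
  proof -
    have "0 < ennreal (e * (1/2)^Suc k)" using e by simp
    from modulus_zeroD[OF assms(3) this] show ?thesis by metis
  qed
  then obtain g where g[measurable]: "\<And>k. g k \<in> borel_measurable borel"
    and ge: "\<And>k c. c \<in> \<Gamma> k \<Longrightarrow> 1 \<le> curve_integral c (g k)"
    and le: "\<And>k. (\<integral>\<^sup>+x. ennpowr (g k x) p \<partial>M) < ennreal (e * (1/2)^Suc k)"
    by metis
  define G where "G x = (SUP k. g k x)" for x
  have [measurable]: "G \<in> borel_measurable borel" unfolding G_def by measurable
  have gM: "g k \<in> borel_measurable M" for k using g M by (simp cong: measurable_cong_sets)
  have "(\<integral>\<^sup>+x. ennpowr (G x) p \<partial>M) \<le> (\<integral>\<^sup>+x. (\<Sum>k. ennpowr (g k x) p) \<partial>M)"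
    unfolding G_def by (intro nn_integral_mono ennpowr_SUP_le p)
  also have "\<dots> = (\<Sum>k. \<integral>\<^sup>+x. ennpowr (g k x) p \<partial>M)"
    using gM by (intro nn_integral_suminf) auto
  also have "\<dots> \<le> (\<Sum>k. ennreal (e * (1/2)^Suc k))"
    using le by (intro suminf_le) (auto simp: less_imp_le)
  also have "\<dots> = ennreal e"
    using e sums_mult[OF power_half_series, of e] by (intro suminf_ennreal_eq) auto
  finally have "(\<integral>\<^sup>+x. ennpowr (G x) p \<partial>M) \<le> ennreal e" .
  moreover have "1 \<le> curve_integral c G" if "c \<in> (\<Union>k. \<Gamma> k)" for c
  proof -
    obtain k where "c \<in> \<Gamma> k" using \<open>c \<in> (\<Union>k. \<Gamma> k)\<close> by blast
    then have "1 \<le> curve_integral c (g k)" by (rule ge)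
    also have "\<dots> \<le> curve_integral c G"
      unfolding G_def by (intro curve_integral_mono SUP_upper) auto
    finally show ?thesis .
  qed
  ultimately show "\<exists>g\<in>borel_measurable borel. (\<forall>c\<in>\<Union>k. \<Gamma> k. 1 \<le> curve_integral c g) \<and>
    (\<integral>\<^sup>+x. ennpowr (g x) p \<partial>M) \<le> ennreal e"
    by (intro bexI[of _ G]) auto
qed

lemma modulus_zero_countable_UN:
  assumes "0 < p" "sets M = sets borel" "countable I"
    and "\<And>i. i \<in> I \<Longrightarrow> modulus p M (\<Gamma> i) = 0"
  shows "modulus p M (\<Union>i\<in>I. \<Gamma> i) = 0"
proof (cases "I = {}")
  case True
  then show ?thesis
    using assms(1) by (intro modulus_zeroI bexI[of _ "\<lambda>_. 0"]) auto
next
  case False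
  have "modulus p M (\<Union>k. \<Gamma> (from_nat_into I k)) = 0"
    by (intro modulus_zero_UN assms from_nat_into False)
  moreover have "(\<Union>k. \<Gamma> (from_nat_into I k)) = (\<Union>i\<in>I. \<Gamma> i)"
    using range_from_nat_into[OF False assms(3)] by (metis image_image)
  ultimately show ?thesis by simp
qed

text \<open>The difficulty is measurability: the metric speed is known to be Lebesgue measurable
  only on \<open>{a..b}\<close>, and the curve is arbitrary outside. Clamping the curve and
  multiplying the speed by the indicator gives the same integrands in measurable form.\<close>

lemma curve_integral_sum:
  assumes c: "c \<in> ac_curves" and f: "\<And>i. i \<in> I \<Longrightarrow> f i \<in> borel_measurable borel"
  shows "curve_integral c (\<lambda>x. \<Sum>i\<in>I. ennreal (r i) * f i x) = (\<Sum>i\<in>I. ennreal (r i) * curve_integral c (f i))"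
proof -
  obtain a b \<gamma> where abg: "c = (a, b, \<gamma>)" by (cases c)
  let ?m = "metric_speed (a, b, \<gamma>)" let ?\<gamma> = "\<lambda>t. \<gamma> (max a (min b t))"
  have "continuous_on UNIV ?\<gamma>" using c by (intro continuous_on_clamp_real) (auto simp: abg ac_curves_def)
  then have [measurable]: "?\<gamma> \<in> borel_measurable borel" by (rule borel_measurable_continuous_onI)
  have "speed_bound (a, b, \<gamma>) ?m" using c by (intro metric_speed) (simp add: abg)
  then have m: "(\<lambda>t. indicator {a..b} t *\<^sub>R ?m t) \<in> borel_measurable lebesgue"
    by (auto simp: speed_bound_def set_integrable_def)
  have eq: "h (\<gamma> t) * ennreal (?m t) * indicator {a..b} t
      = h (?\<gamma> t) * ennreal (indicator {a..b} t *\<^sub>R ?m t)" for h t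
    by (auto split: split_indicator)
  have meas: "(\<lambda>t. h (?\<gamma> t) * ennreal (indicator {a..b} t *\<^sub>R ?m t)) \<in> borel_measurable lebesgue"
    if "h \<in> borel_measurable borel" for h
  proof -
    note that[measurable]
    have "(\<lambda>t. h (?\<gamma> t)) \<in> borel_measurable lborel" by measurable
    then have "(\<lambda>t. h (?\<gamma> t)) \<in> borel_measurable lebesgue" by (rule measurable_completion)
    then show ?thesis using m by (intro borel_measurable_times_ennreal measurable_compose[OF m measurable_ennreal])
  qed
  have "curve_integral c (\<lambda>x. \<Sum>i\<in>I. ennreal (r i) * f i x)
     = (\<integral>\<^sup>+t. (\<Sum>i\<in>I. ennreal (r i) * (f i (?\<gamma> t) * ennreal (indicator {a..b} t *\<^sub>R ?m t))) \<partial>lebesgue)"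
    unfolding curve_integral_def abg prod.case eq by (simp add: sum_distrib_right mult.assoc)
  also have "\<dots> = (\<Sum>i\<in>I. \<integral>\<^sup>+t. ennreal (r i) * (f i (?\<gamma> t) * ennreal (indicator {a..b} t *\<^sub>R ?m t)) \<partial>lebesgue)"
    by (intro nn_integral_sum borel_measurable_times_ennreal[OF borel_measurable_const meas] f)
  also have "\<dots> = (\<Sum>i\<in>I. ennreal (r i) * curve_integral c (f i))"
    unfolding curve_integral_def abg prod.case eq
    using f meas by (intro sum.cong nn_integral_cmult) auto
  finally show ?thesis .
qed

text \<open>Truncating \<phi> to the interval from c to d gives a 1-Lipschitz function that is
  locally constant off the closed shell, so its slope is at most the indicator of the shell. The
  upper gradient inequality between t0 and t1, in whichever order they occur, then bounds the length
  inside \<open>A\<close> from below.\<close>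

lemma curve_integral_shell:
  assumes curve: "(a, b, \<gamma>) \<in> ac_curves" and \<phi>: "1-lipschitz_on UNIV \<phi>"
    and t: "t0 \<in> {a..b}" "t1 \<in> {a..b}" and c: "\<phi> (\<gamma> t0) \<le> c" and cd: "c \<le> d" and d: "d \<le> \<phi> (\<gamma> t1)"
    and A: "\<And>t. t \<in> {a..b} \<Longrightarrow> c \<le> \<phi> (\<gamma> t) \<Longrightarrow> \<phi> (\<gamma> t) \<le> d \<Longrightarrow> \<gamma> t \<in> A"
  shows "ennreal (d - c) \<le> curve_integral (a, b, \<gamma>) (indicator A)"
proof -
  let ?m = "metric_speed (a, b, \<gamma>)"
  define f where "f x = max c (min d (\<phi> x))" for x
  have \<phi>c: "continuous_on UNIV \<phi>" using \<phi> by (rule lipschitz_on_continuous_on)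
  have f: "1-lipschitz_on UNIV f"
  proof (rule lipschitz_onI)
    fix x y
    have "dist (f x) (f y) \<le> dist (\<phi> x) (\<phi> y)" by (auto simp: f_def dist_real_def)
    then show "dist (f x) (f y) \<le> 1 * dist x y" using lipschitz_onD[OF \<phi>, of x y] by simp
  qed simp
  have slope: "slope f x \<le> indicator {x. c \<le> \<phi> x \<and> \<phi> x \<le> d} x" for x
  proof (cases "c \<le> \<phi> x \<and> \<phi> x \<le> d")
    case True
    then show ?thesis using pointwise_lip_lipschitz[OF f, of x] by (simp add: slope_eq_pointwise_lip)
  next
    case False
    have "pointwise_lip f x \<le> 0"
    proof (cases "\<phi> x < c")
      case True
      have "open {x. \<phi> x < c}" using \<phi>c by (intro open_Collect_less continuous_intros) auto
      then have "pointwise_lip f x = pointwise_lip (\<lambda>_. c) x"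
        by (rule pointwise_lip_cong) (use True cd in \<open>auto simp: f_def\<close>)
      also have "\<dots> \<le> ennreal 0" by (rule pointwise_lip_leI[of 1]) auto
      finally show ?thesis by simp
    next
      case 2: False
      have "open {x. d < \<phi> x}" using \<phi>c by (intro open_Collect_less continuous_intros) auto
      then have "pointwise_lip f x = pointwise_lip (\<lambda>_. d) x"
        by (rule pointwise_lip_cong) (use 2 False cd in \<open>auto simp: f_def\<close>)
      also have "\<dots> \<le> ennreal 0" by (rule pointwise_lip_leI[of 1]) auto
      finally show ?thesis by simp
    qed
    then show ?thesis by (simp add: slope_eq_pointwise_lip)
  qed
  define s where "s = min t0 t1" define t where "t = max t0 t1"
  have st: "a \<le> s" "s \<le> t" "t \<le> b" using t by (auto simp: s_def t_def)
  have "{f (\<gamma> s), f (\<gamma> t)} = {c, d}" using c d cd by (auto simp: s_def t_def f_def min_def max_def)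
  then have "\<bar>f (\<gamma> t) - f (\<gamma> s)\<bar> = d - c" using cd by (auto simp: doubleton_eq_iff)
  then have "ennreal (d - c) = ennreal \<bar>f (\<gamma> t) - f (\<gamma> s)\<bar>" by simp
  also have "\<dots> \<le> (\<integral>\<^sup>+r\<in>{s..t}. slope f (\<gamma> r) * ennreal (?m r) \<partial>lebesgue)"
  proof (rule upper_gradient_inequality[OF st(2) _ _ f])
    show "continuous_on {s..t} \<gamma>"
      using curve st by (auto simp: ac_curves_def intro: continuous_on_subset)
    show "speed_bound (s, t, \<gamma>) ?m"
      using speed_bound_subinterval[OF metric_speed(1)[OF curve]] st by blast
  qed
  also have "\<dots> \<le> (\<integral>\<^sup>+r\<in>{a..b}. indicator A (\<gamma> r) * ennreal (?m r) \<partial>lebesgue)"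
  proof (rule nn_integral_mono)
    fix r
    show "slope f (\<gamma> r) * ennreal (?m r) * indicator {s..t} r
       \<le> indicator A (\<gamma> r) * ennreal (?m r) * indicator {a..b} r"
    proof (cases "r \<in> {s..t}")
      case True
      then have r: "r \<in> {a..b}" using st by auto
      have "slope f (\<gamma> r) \<le> indicator {x. c \<le> \<phi> x \<and> \<phi> x \<le> d} (\<gamma> r)" by (rule slope)
      also have "\<dots> \<le> indicator A (\<gamma> r)" using A[OF r] by (auto split: split_indicator)
      finally show ?thesis using True r by (auto intro: mult_right_mono)
    qed simp
  qed
  finally show ?thesis by (simp add: curve_integral_def)
qed

text \<open>The ball lies in a cube of side 2 R, over which the integral factorizes by
  coordinates.\<close>

lemma nn_integral_coordinate_le:
  fixes z :: "'a::euclidean_space"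
  assumes [measurable]: "h \<in> borel_measurable borel" and b: "b \<in> Basis" and R: "0 \<le> R"
  shows "(\<integral>\<^sup>+x\<in>cball z R. h (x \<bullet> b) \<partial>lborel)
    \<le> ennreal ((2 * R) ^ (DIM('a) - 1)) * (\<integral>\<^sup>+t\<in>cball (z \<bullet> b) R. h t \<partial>lborel)"
proof -
  define F where "F c t = (if c = b then h t else 1) * indicator {z \<bullet> c - R..z \<bullet> c + R} t" for c :: 'a and t :: real
  have [measurable]: "F c \<in> borel_measurable borel" for c
    unfolding F_def by (cases "c = b") simp_all
  have "(\<integral>\<^sup>+x\<in>cball z R. h (x \<bullet> b) \<partial>lborel) \<le> (\<integral>\<^sup>+x. (\<Prod>c\<in>Basis. F c (x \<bullet> c)) \<partial>lborel)"
  proof (rule nn_integral_mono)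
    fix x
    show "h (x \<bullet> b) * indicator (cball z R) x \<le> (\<Prod>c\<in>Basis. F c (x \<bullet> c))"
    proof (cases "x \<in> cball z R")
      case True
      have "\<bar>(x - z) \<bullet> c\<bar> \<le> R" if "c \<in> Basis" for c
        using True Basis_le_norm[OF that, of "x - z"] by (simp add: dist_norm norm_minus_commute)
      then have "F c (x \<bullet> c) = (if c = b then h (x \<bullet> b) else 1)" if "c \<in> Basis" for c
        using that by (fastforce simp: F_def inner_diff_left abs_le_iff split: split_indicator)
      then have "(\<Prod>c\<in>Basis. F c (x \<bullet> c)) = h (x \<bullet> b)"
        using b by (simp add: prod.delta)
      then show ?thesis using True by simp
    qed simp
  qed
  also have "\<dots> = (\<Prod>c\<in>Basis. \<integral>\<^sup>+t. F c t \<partial>lborel)"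
    by (rule nn_integral_lborel_prod) auto
  also have "\<dots> = (\<integral>\<^sup>+t. F b t \<partial>lborel) * (\<Prod>c\<in>Basis - {b}. \<integral>\<^sup>+t. F c t \<partial>lborel)"
    using b by (intro prod.remove) auto
  also have "(\<Prod>c\<in>Basis - {b}. \<integral>\<^sup>+t. F c t \<partial>lborel) = (\<Prod>c\<in>Basis - {b}. ennreal (2 * R))"
    using R by (intro prod.cong) (auto simp: F_def)
  also have "\<dots> = ennreal ((2 * R) ^ (DIM('a) - 1))"
    using b R by (simp add: card_Diff_singleton ennreal_power)
  also have "(\<integral>\<^sup>+t. F b t \<partial>lborel) = (\<integral>\<^sup>+t\<in>cball (z \<bullet> b) R. h t \<partial>lborel)"
    by (simp add: F_def cball_eq_atLeastAtMost)
  finally show ?thesis by (simp add: mult.commute)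
qed

text \<open>
  The test function averages the \<open>m\<close> shells \<open>4 powr (- j) / 2 \<le> \<bar>x \<bullet> b - q\<bar> \<le> 4 powr (- j)\<close> with
  \<open>m \<le> j < 2 m\<close>. Averaging makes its energy small for \<open>p > 1\<close>, and the shrinking of the shells does
  so for \<open>p < 1 + \<alpha>\<close>.
\<close>

lemma modulus_crossing_zero:
  fixes w :: "'a::euclidean_space \<Rightarrow> ennreal"
  assumes w[measurable]: "w \<in> borel_measurable borel" and b: "b \<in> Basis"
    and wle: "\<And>x. w x \<le> ennreal (C * \<bar>x \<bullet> b - q\<bar> powr \<alpha>)" and C: "0 \<le> C" and \<alpha>: "0 < \<alpha>"
    and p: "1 \<le> p" "p \<le> 1 + \<alpha>" and \<delta>: "0 < \<delta>" and N: "0 < N"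
  shows "modulus p (density lborel w)
    {(s, t, \<gamma>) \<in> ac_curves. \<gamma> ` {s..t} \<subseteq> cball 0 N \<and>
      (\<exists>t0\<in>{s..t}. \<gamma> t0 \<bullet> b = q) \<and> (\<exists>t1\<in>{s..t}. \<delta> \<le> \<bar>\<gamma> t1 \<bullet> b - q\<bar>)} = 0"
    (is "modulus p ?M ?\<Gamma> = 0")
proof (rule modulus_zeroI)
  fix e :: real assume e: "0 < e"
  define \<phi> where "\<phi> x = \<bar>x \<bullet> b - q\<bar>" for x
  have \<phi>: "1-lipschitz_on UNIV \<phi>"
  proof (rule lipschitz_onI)
    fix x y
    have "dist (\<phi> x) (\<phi> y) \<le> \<bar>(x - y) \<bullet> b\<bar>" by (auto simp: \<phi>_def dist_real_def inner_diff_left)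
    also have "\<dots> \<le> 1 * dist x y" using Basis_le_norm[OF b, of "x - y"] by (simp add: dist_norm)
    finally show "dist (\<phi> x) (\<phi> y) \<le> 1 * dist x y" .
  qed simp
  have [measurable]: "\<phi> \<in> borel_measurable borel" unfolding \<phi>_def by measurable
  define A where "A j = {x \<in> cball 0 N. (1/4)^j / 2 \<le> \<phi> x \<and> \<phi> x \<le> (1/4)^j}" for j :: nat
  have [measurable]: "cball (0::'a) N \<in> sets borel" by simp
  have A[measurable]: "A j \<in> sets borel" for j
  proof -
    have "A j = cball 0 N \<inter> {x\<in>space borel. (1/4)^j / 2 \<le> \<phi> x \<and> \<phi> x \<le> (1/4)^j}"
      by (auto simp: A_def)
    also have "\<dots> \<in> sets borel" by measurable
    finally show ?thesis .
  qed
  \<comment> \<open>Ratio 4 against inner radius 1/2 leaves gaps between the shells. At most one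
    term of \<open>g\<close> is then nonzero at each point, so the p-th power of the sum is the sum
    of the p-th powers.\<close>
  have disj: "i = j" if "x \<in> A i" "x \<in> A j" for x i j
  proof -
    have *: False if "x \<in> A i" "x \<in> A j" "i < j" for i j
    proof -
      have "(1/4::real)^j \<le> (1/4)^Suc i" using that by (intro power_decreasing) auto
      then have "(1/4::real)^j \<le> (1/4)^i / 4" by simp
      moreover have "(0::real) < (1/4)^i" by simp
      ultimately have "(1/4::real)^j < (1/4)^i / 2" by linarith
      then show False using that by (auto simp: A_def)
    qed
    show ?thesis using *[of i j] *[of j i] that by (cases i j rule: linorder_cases) auto
  qed
  define B where "B = C * (2 * N) ^ (DIM('a) - 1) * 2"
  have B: "0 \<le> B" using C N by (simp add: B_def)
  have eA: "emeasure ?M (A j) \<le> ennreal (B * (((1/4::real)^j) powr \<alpha> * (1/4)^j))" for j :: nat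
  proof -
    let ?d = "(1/4::real)^j"
    let ?h = "\<lambda>t. ennreal (C * ?d powr \<alpha>) * indicator {q - ?d..q + ?d} t"
    have "emeasure ?M (A j) = (\<integral>\<^sup>+x\<in>A j. w x \<partial>lborel)"
      by (subst emeasure_density) auto
    also have "\<dots> \<le> (\<integral>\<^sup>+x\<in>cball 0 N. ?h (x \<bullet> b) \<partial>lborel)"
    proof (rule nn_integral_mono)
      fix x
      show "w x * indicator (A j) x \<le> ?h (x \<bullet> b) * indicator (cball 0 N) x"
      proof (cases "x \<in> A j")
        case True
        then have x: "x \<in> cball 0 N" "\<bar>x \<bullet> b - q\<bar> \<le> ?d" by (auto simp: A_def \<phi>_def)
        have "w x \<le> ennreal (C * \<bar>x \<bullet> b - q\<bar> powr \<alpha>)" by (rule wle)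
        also have "\<dots> \<le> ennreal (C * ?d powr \<alpha>)"
          using x C \<alpha> by (intro ennreal_leI mult_left_mono powr_mono2) auto
        finally show ?thesis using x True by (auto simp: abs_le_iff split: split_indicator)
      qed simp
    qed
    also have "\<dots> \<le> ennreal ((2 * N) ^ (DIM('a) - 1)) * (\<integral>\<^sup>+t\<in>cball ((0::'a) \<bullet> b) N. ?h t \<partial>lborel)"
      using b N by (intro nn_integral_coordinate_le) auto
    also have "(\<integral>\<^sup>+t\<in>cball ((0::'a) \<bullet> b) N. ?h t \<partial>lborel) \<le> (\<integral>\<^sup>+t. ?h t \<partial>lborel)"
      by (intro nn_integral_mono) (auto split: split_indicator)
    also have "(\<integral>\<^sup>+t. ?h t \<partial>lborel) = ennreal (C * ?d powr \<alpha>) * ennreal (2 * ?d)"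
      by (subst nn_integral_cmult_indicator) auto
    also have "ennreal ((2 * N) ^ (DIM('a) - 1)) * (ennreal (C * ?d powr \<alpha>) * ennreal (2 * ?d))
        = ennreal (B * (?d powr \<alpha> * ?d))"
      using C N by (simp add: ennreal_mult[symmetric] B_def mult_ac)
    finally show ?thesis by (simp add: mult_left_mono)
  qed
  \<comment> \<open>Shell j contributes at most
    \<open>B * 2 powr p * (real m powr (- p) * \<theta> ^ j)\<close> to the energy, and the m shells
    together at most a multiple of \<open>real m powr (1 - p) * \<theta> ^ m\<close>. For p = 1 the
    factor \<theta> < 1 makes this small, for p > 1 the power of m does, including the end point p =
    1 + \<alpha> where \<theta> = 1.\<close>
  define \<theta> where "\<theta> = 4 powr (p - 1 - \<alpha>)"
  have \<theta>: "0 < \<theta>" "\<theta> \<le> 1" using p powr_le_cancel_iff[of 4 "p - 1 - \<alpha>" 0] by (auto simp: \<theta>_def)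
  have "(\<lambda>m. B * 2 powr p * (real m powr (1 - p) * \<theta> ^ m)) \<longlonglongrightarrow> B * 2 powr p * 0"
  proof (intro tendsto_mult tendsto_const)
    show "(\<lambda>m. real m powr (1 - p) * \<theta> ^ m) \<longlonglongrightarrow> 0"
    proof (cases "p = 1")
      case True
      then have "\<theta> < 1" using \<alpha> powr_less_cancel_iff[of 4 "p - 1 - \<alpha>" 0] by (simp add: \<theta>_def)
      then have "(\<lambda>m. \<theta> ^ m) \<longlonglongrightarrow> 0" using \<theta> by (intro LIMSEQ_power_zero) auto
      then show ?thesis
      proof (rule Lim_transform_eventually)
        show "\<forall>\<^sub>F m in sequentially. \<theta> ^ m = real m powr (1 - p) * \<theta> ^ m"
          using eventually_gt_at_top[of 0] by eventually_elim (simp add: True)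
      qed
    next
      case False
      then have "1 - p < 0" using p by simp
      then have lim: "(\<lambda>m. real m powr (1 - p)) \<longlonglongrightarrow> 0"
        by (rule tendsto_neg_powr) (rule filterlim_real_sequentially)
      show ?thesis
      proof (rule tendsto_sandwich[OF _ _ tendsto_const lim])
        show "\<forall>\<^sub>F m in sequentially. 0 \<le> real m powr (1 - p) * \<theta> ^ m"
          using \<theta> by (intro always_eventually allI mult_nonneg_nonneg) auto
        show "\<forall>\<^sub>F m in sequentially. real m powr (1 - p) * \<theta> ^ m \<le> real m powr (1 - p)"
          using \<theta> by (intro always_eventually allI mult_right_le_one_le) (auto simp: power_le_one)
      qed
    qed
  qed
  then have ev1: "\<forall>\<^sub>F m in sequentially. B * 2 powr p * (real m powr (1 - p) * \<theta> ^ m) < e"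
    using e by (intro order_tendstoD) auto
  have "(\<lambda>m. (1/4::real)^m) \<longlonglongrightarrow> 0" by (intro LIMSEQ_power_zero) auto
  then have ev2: "\<forall>\<^sub>F m in sequentially. (1/4::real)^m < \<delta>" using \<delta> by (intro order_tendstoD) auto
  \<comment> \<open>The condition \<open>(1/4)^m < \<delta>\<close> places every shell with j \<ge>
    m between the hyperplane and the point reached at distance \<delta>, so the curve crosses all of
    them.\<close>
  obtain m where m: "B * 2 powr p * (real m powr (1 - p) * \<theta> ^ m) < e" "(1/4::real)^m < \<delta>" "0 < m"
    using eventually_happens[OF eventually_conj[OF eventually_conj[OF ev1 ev2] eventually_gt_at_top[of 0]]]
    by auto
  \<comment> \<open>Shell j has thickness \<open>(1/4)^j / 2\<close>, so with this coefficient each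
    of the m crossings contributes at least 1/m to the curve integral.\<close>
  define g where "g x = (\<Sum>j\<in>{m..<2*m}. ennreal (2 * 4^j / m) * indicator (A j) x)" for x
  have [measurable]: "g \<in> borel_measurable borel" unfolding g_def by measurable
  have gp: "ennpowr (g x) p = (\<Sum>j\<in>{m..<2*m}. ennreal ((2 * 4^j / real m) powr p) * indicator (A j) x)" for x
  proof (cases "\<exists>i\<in>{m..<2*m}. x \<in> A i")
    case True
    then obtain i where i: "i \<in> {m..<2*m}" "x \<in> A i" by blast
    have ind: "indicator (A j) x = (if j = i then 1 else 0 :: ennreal)" for j
    proof (cases "j = i")
      case False
      then have "x \<notin> A j" using disj[OF i(2), of j] by blast
      then show ?thesis using False by simp
    qed (use i in simp)
    show ?thesis unfolding g_def ind using i m by (simp add: sum.delta ennpowr_ennreal if_distrib cong: if_cong)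
  next
    case False
    then show ?thesis using p by (simp add: g_def)
  qed
  have "(\<integral>\<^sup>+x. ennpowr (g x) p \<partial>?M) = (\<Sum>j\<in>{m..<2*m}. ennreal ((2 * 4^j / real m) powr p) * emeasure ?M (A j))"
    unfolding gp by (subst nn_integral_sum) (auto simp: nn_integral_cmult_indicator)
  also have "\<dots> \<le> (\<Sum>j\<in>{m..<2*m}. ennreal (B * 2 powr p * (real m powr (- p) * \<theta> ^ m)))"
  proof (rule sum_mono)
    fix j assume j: "j \<in> {m..<2*m}"
    have "ennreal ((2 * 4^j / real m) powr p) * emeasure ?M (A j)
        \<le> ennreal ((2 * 4^j / real m) powr p) * ennreal (B * (((1/4::real)^j) powr \<alpha> * (1/4)^j))"
      by (intro mult_left_mono eA) auto
    also have "\<dots> = ennreal (B * 2 powr p * (real m powr (- p) * (((4::real)^j) powr p * (((1/4::real)^j) powr \<alpha> * (1/4)^j))))"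
    proof -
      have "(2 * 4^j / real m) powr p = 2 powr p * (real m powr (- p) * ((4::real)^j) powr p)"
        by (simp add: powr_mult powr_divide powr_minus_divide)
      then show ?thesis using B by (simp add: ennreal_mult[symmetric] mult_ac)
    qed
    also have "((4::real)^j) powr p * (((1/4::real)^j) powr \<alpha> * (1/4)^j) = \<theta> ^ j"
    proof -
      have "(4::real)^j = 4 powr j" "(1/4::real)^j = 4 powr (- real j)"
        by (auto simp: powr_realpow powr_minus power_divide inverse_eq_divide)
      then have "((4::real)^j) powr p * (((1/4::real)^j) powr \<alpha> * (1/4)^j)
          = 4 powr (real j * p) * (4 powr (- (real j * \<alpha>)) * 4 powr (- real j))"
        by (simp add: powr_powr)
      also have "\<dots> = 4 powr (real j * p + (- (real j * \<alpha>) + - real j))"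
        by (simp only: powr_add)
      also have "real j * p + (- (real j * \<alpha>) + - real j) = (p - 1 - \<alpha>) * j"
        by (simp add: algebra_simps)
      also have "4 powr ((p - 1 - \<alpha>) * j) = \<theta> ^ j" by (simp add: \<theta>_def powr_power mult.commute)
      finally show ?thesis .
    qed
    also have "ennreal (B * 2 powr p * (real m powr (- p) * \<theta> ^ j)) \<le> ennreal (B * 2 powr p * (real m powr (- p) * \<theta> ^ m))"
      using B \<theta> j by (intro ennreal_leI mult_left_mono power_decreasing) auto
    finally show "ennreal ((2 * 4^j / real m) powr p) * emeasure ?M (A j)
      \<le> ennreal (B * 2 powr p * (real m powr (- p) * \<theta> ^ m))" .
  qed
  also have "\<dots> = ennreal (m * (B * 2 powr p * (real m powr (- p) * \<theta> ^ m)))"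
    using B \<theta> by (simp add: ennreal_mult[symmetric] ennreal_of_nat_eq_real_of_nat)
  also have "m * (B * 2 powr p * (real m powr (- p) * \<theta> ^ m)) = B * 2 powr p * (real m powr (1 - p) * \<theta> ^ m)"
  proof -
    have "real m * real m powr (- p) = real m powr (1 - p)"
      using m powr_add[of "real m" 1 "- p"] by simp
    then show ?thesis by (simp add: mult_ac)
  qed
  also have "ennreal \<dots> \<le> ennreal e" using m by (intro ennreal_leI) auto
  finally have energy: "(\<integral>\<^sup>+x. ennpowr (g x) p \<partial>?M) \<le> ennreal e" .
  have "1 \<le> curve_integral c g" if c: "c \<in> ?\<Gamma>" for c
  proof -
    obtain s t \<gamma> t0 t1 where cc: "c = (s, t, \<gamma>)" and curve: "(s, t, \<gamma>) \<in> ac_curves"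
      and sub: "\<gamma> ` {s..t} \<subseteq> cball 0 N" and t0: "t0 \<in> {s..t}" "\<phi> (\<gamma> t0) = 0"
      and t1: "t1 \<in> {s..t}" "\<delta> \<le> \<phi> (\<gamma> t1)"
      using c by (auto simp: \<phi>_def)
    have shell: "ennreal (1 / m) \<le> ennreal (2 * 4^j / m) * curve_integral c (indicator (A j))"
      if j: "j \<in> {m..<2*m}" for j
    proof -
      have "(1/4::real)^j \<le> (1/4)^m" using j by (intro power_decreasing) auto
      then have "(1/4)^j \<le> \<phi> (\<gamma> t1)" using m(2) t1(2) by linarith
      moreover have "\<gamma> r \<in> cball 0 N" if "r \<in> {s..t}" for r using sub that by blast
      ultimately have "ennreal ((1/4)^j - (1/4)^j / 2) \<le> curve_integral (s, t, \<gamma>) (indicator (A j))"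
        using t0(2) by (intro curve_integral_shell[OF curve \<phi> t0(1) t1(1)]) (simp_all add: A_def)
      then have "ennreal (2 * 4^j / m) * ennreal ((1/4)^j - (1/4)^j / 2)
          \<le> ennreal (2 * 4^j / m) * curve_integral c (indicator (A j))"
        unfolding cc by (rule mult_left_mono) simp
      moreover have "ennreal (2 * 4^j / m) * ennreal ((1/4)^j - (1/4)^j / 2) = ennreal (1 / m)"
        by (simp add: ennreal_mult[symmetric] power_divide field_simps)
      ultimately show ?thesis by simp
    qed
    have "1 = (\<Sum>j\<in>{m..<2*m}. ennreal (1 / m))"
      using m by (simp add: ennreal_of_nat_eq_real_of_nat ennreal_mult[symmetric])
    also have "\<dots> \<le> (\<Sum>j\<in>{m..<2*m}. ennreal (2 * 4^j / m) * curve_integral c (indicator (A j)))"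
      by (intro sum_mono shell)
    also have "\<dots> = curve_integral c g"
      unfolding g_def using curve by (subst curve_integral_sum) (auto simp: cc)
    finally show ?thesis .
  qed
  then show "\<exists>g\<in>borel_measurable borel. (\<forall>c\<in>?\<Gamma>. 1 \<le> curve_integral c g) \<and>
    (\<integral>\<^sup>+x. ennpowr (g x) p \<partial>?M) \<le> ennreal e"
    using energy by (intro bexI[of _ g]) auto
qed

text \<open>Some coordinate takes two different values along the curve, and by connectedness a
  rational between them is attained. The indices k and N make the remaining data of
  \<open>modulus_crossing_zero\<close> countable: a distance that the curve reaches from the
  hyperplane, and a ball that contains the curve.\<close>

lemma modulus_nonconstant_zero:
  fixes w :: "'a::euclidean_space \<Rightarrow> ennreal"
  assumes w: "w \<in> borel_measurable borel"
    and wle: "\<And>b q. b \<in> Basis \<Longrightarrow> q \<in> \<rat> \<Longrightarrow> \<exists>C\<ge>0. \<forall>x. w x \<le> ennreal (C * \<bar>x \<bullet> b - q\<bar> powr \<alpha>)"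
    and \<alpha>: "0 < \<alpha>" and p: "1 \<le> p" "p \<le> 1 + \<alpha>"
  shows "modulus p (density lborel w) nonconstant_ac_curves = 0"
proof -
  define \<Gamma> where "\<Gamma> = (\<lambda>(b, q :: real, k :: nat, N :: nat). {(s, t, \<gamma>) \<in> (ac_curves :: 'a curve set).
      \<gamma> ` {s..t} \<subseteq> cball 0 (real (Suc N)) \<and> (\<exists>t0\<in>{s..t}. \<gamma> t0 \<bullet> b = q) \<and>
      (\<exists>t1\<in>{s..t}. inverse (Suc k) \<le> \<bar>\<gamma> t1 \<bullet> b - q\<bar>)})"
  have "modulus p (density lborel w) (\<Union>i\<in>(Basis :: 'a set) \<times> \<rat> \<times> UNIV \<times> UNIV. \<Gamma> i) = 0"
  proof (rule modulus_zero_countable_UN)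
    show "countable ((Basis :: 'a set) \<times> (\<rat> :: real set) \<times> (UNIV :: nat set) \<times> (UNIV :: nat set))"
      by (intro countable_SIGMA countable_rat) (auto simp: countable_finite)
    fix i assume "i \<in> (Basis :: 'a set) \<times> (\<rat> :: real set) \<times> (UNIV :: nat set) \<times> (UNIV :: nat set)"
    then obtain b q k N where i: "i = (b, q, k, N)" "b \<in> Basis" "q \<in> \<rat>" by auto
    then obtain C where "C \<ge> 0" "\<And>x. w x \<le> ennreal (C * \<bar>x \<bullet> b - q\<bar> powr \<alpha>)" using wle by blast
    then show "modulus p (density lborel w) (\<Gamma> i) = 0"
      unfolding i \<Gamma>_def prod.case using w i \<alpha> p by (intro modulus_crossing_zero) auto
  qed (use p in auto)
  then show ?thesis
  proof (rule modulus_zero_subset, intro subsetI)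
    fix c :: "'a curve" assume c: "c \<in> nonconstant_ac_curves"
    obtain s t \<gamma> where cc: "c = (s, t, \<gamma>)" by (cases c)
    have ac: "(s, t, \<gamma>) \<in> ac_curves" and nc: "\<not> \<gamma> constant_on {s..t}"
      using c by (auto simp: nonconstant_ac_curves_def cc)
    have cont: "continuous_on {s..t} \<gamma>" using ac by (simp add: ac_curves_def)
    obtain u v where uv: "u \<in> {s..t}" "v \<in> {s..t}" "\<gamma> u \<noteq> \<gamma> v"
    proof -
      have "s \<in> {s..t}" using ac by (auto simp: ac_curves_def)
      moreover obtain v where "v \<in> {s..t}" "\<gamma> v \<noteq> \<gamma> s" using nc unfolding constant_on_def by blast
      ultimately show ?thesis using that[of s v] by simp
    qed
    then obtain b where b: "b \<in> Basis" "\<gamma> u \<bullet> b \<noteq> \<gamma> v \<bullet> b" by (metis euclidean_eqI)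
    obtain u' v' where uv': "u' \<in> {s..t}" "v' \<in> {s..t}" "\<gamma> u' \<bullet> b < \<gamma> v' \<bullet> b"
      using uv b by (metis linorder_neqE)
    obtain q where q: "q \<in> \<rat>" "\<gamma> u' \<bullet> b < q" "q < \<gamma> v' \<bullet> b"
      using Rats_dense_in_real[OF uv'(3)] by blast
    have "connected ((\<lambda>r. \<gamma> r \<bullet> b) ` {s..t})"
      by (intro connected_continuous_image continuous_intros cont) auto
    then have "q \<in> (\<lambda>r. \<gamma> r \<bullet> b) ` {s..t}"
      using uv' q by (meson connected_contains_Icc imageI subsetD atLeastAtMost_iff less_imp_le)
    then obtain t0 where t0: "t0 \<in> {s..t}" "\<gamma> t0 \<bullet> b = q" by auto
    obtain k where "inverse (real (Suc k)) < \<gamma> v' \<bullet> b - q"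
      using reals_Archimedean[of "\<gamma> v' \<bullet> b - q"] q by auto
    then have k: "inverse (Suc k) \<le> \<bar>\<gamma> v' \<bullet> b - q\<bar>" by simp
    have "bounded (\<gamma> ` {s..t})"
      by (intro compact_imp_bounded compact_continuous_image cont compact_Icc)
    then obtain D where D: "\<And>x. x \<in> \<gamma> ` {s..t} \<Longrightarrow> norm x \<le> D" by (auto simp: bounded_iff)
    obtain N :: nat where "D \<le> N" using real_arch_simple by blast
    then have "\<gamma> ` {s..t} \<subseteq> cball 0 (real (Suc N))" using D by fastforce
    then have "c \<in> \<Gamma> (b, q, k, N)" using ac t0 k uv' by (auto simp: \<Gamma>_def cc)
    then show "c \<in> (\<Union>i\<in>(Basis :: 'a set) \<times> \<rat> \<times> UNIV \<times> UNIV. \<Gamma> i)" using b q by blast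
  qed
qed

subsection \<open>Integrals of powers\<close>

lemma powr_above_tangent:
  fixes z r :: real
  assumes z: "0 \<le> z" and r: "1 \<le> r"
  shows "1 + r * (z - 1) \<le> z powr r"
proof (cases "z = 0")
  case False
  have "r * 1 powr (r - 1) * (z - 1) \<le> z powr r - 1 powr r"
  proof (rule f''_imp_f'[where C = "{0<..}" and f' = "\<lambda>x. r * x powr (r - 1)" and f'' = "\<lambda>x. r * ((r - 1) * x powr (r - 2))"])
    show "((\<lambda>x. x powr r) has_real_derivative r * x powr (r - 1)) (at x)" if "x \<in> {0<..}" for x
      using that by (auto intro!: derivative_eq_intros)
    show "((\<lambda>x. r * x powr (r - 1)) has_real_derivative r * ((r - 1) * x powr (r - 2))) (at x)"
      if "x \<in> {0<..}" for x
      using that by (auto intro!: derivative_eq_intros)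
  qed (use r z False in auto)
  then show ?thesis by simp
qed (use r in simp)

text \<open>Jensen's inequality for the weights l, obtained by summing the tangent inequality at the
  mean. As \<open>ennreal\<close> has no negative numbers, the constant part of the tangent is moved
  to the other side before summing and cancelled at the end.\<close>

lemma ennpowr_suminf_convex:
  fixes s :: "nat \<Rightarrow> ennreal"
  assumes l: "\<And>k. 0 \<le> l k" and l1: "(\<Sum>k. ennreal (l k)) = 1" and r: "1 \<le> r"
  shows "ennpowr (\<Sum>k. ennreal (l k) * s k) r \<le> (\<Sum>k. ennreal (l k) * ennpowr (s k) r)"
    (is "ennpowr ?T r \<le> ?X")
proof -
  have tangent: "ennreal (r * T powr (r - 1)) * v \<le> ennpowr v r + ennreal ((r - 1) * T powr r)"
    if T: "0 < T" for T v
  proof (cases v)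
    case (real x)
    have "1 + r * (x / T - 1) \<le> (x / T) powr r" using real T r by (intro powr_above_tangent) auto
    then have "(1 + r * (x / T - 1)) * T powr r \<le> (x / T) powr r * T powr r"
      by (intro mult_right_mono) auto
    also have "\<dots> = x powr r" using real T by (simp add: powr_divide)
    also have "(1 + r * (x / T - 1)) * T powr r = r * T powr (r - 1) * x - (r - 1) * T powr r"
      using T by (simp add: powr_diff field_simps)
    finally have "r * T powr (r - 1) * x \<le> x powr r + (r - 1) * T powr r" by simp
    then have "ennreal (r * T powr (r - 1) * x) \<le> ennreal (x powr r + (r - 1) * T powr r)"
      by (rule ennreal_leI)
    then show ?thesis
      using real r T by (simp add: ennpowr_ennreal ennreal_mult[symmetric] ennreal_plus[symmetric] del: ennreal_plus)
  qed (use r in simp)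
  have sum: "ennreal (r * T powr (r - 1)) * ?T \<le> ?X + ennreal ((r - 1) * T powr r)" if T: "0 < T" for T
  proof -
    have "ennreal (r * T powr (r - 1)) * ?T = (\<Sum>k. ennreal (l k) * (ennreal (r * T powr (r - 1)) * s k))"
      by (simp add: ennreal_suminf_cmult[symmetric] mult_ac)
    also have "\<dots> \<le> (\<Sum>k. ennreal (l k) * ennpowr (s k) r + ennreal (l k) * ennreal ((r - 1) * T powr r))"
      using tangent[OF T] by (intro suminf_le) (auto simp: distrib_left[symmetric] intro!: mult_left_mono)
    also have "\<dots> = ?X + (\<Sum>k. ennreal (l k)) * ennreal ((r - 1) * T powr r)"
      by (simp add: suminf_add[symmetric] ennreal_suminf_multc)
    finally show ?thesis by (simp add: l1)
  qed
  show ?thesis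
  proof (cases ?T)
    case (real T)
    show ?thesis
    proof (cases "T = 0")
      case False
      then have T: "0 < T" using real by simp
      have "ennreal (r * T powr r) = ennreal (r * T powr (r - 1)) * ?T"
        using real T r by (simp add: ennreal_mult[symmetric] powr_diff)
      also have "\<dots> \<le> ?X + ennreal ((r - 1) * T powr r)" by (rule sum[OF T])
      also have "r * T powr r = (r - 1) * T powr r + T powr r" by (simp add: algebra_simps)
      also have "ennreal \<dots> = ennreal ((r - 1) * T powr r) + ennreal (T powr r)"
        using r by (intro ennreal_plus) auto
      finally have "ennreal ((r - 1) * T powr r) + ennreal (T powr r) \<le> ennreal ((r - 1) * T powr r) + ?X"
        by (simp only: add.commute)
      then have "ennreal (T powr r) \<le> ?X" by (simp only: ennreal_add_left_cancel_le) simp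
      then show ?thesis using real r by (simp add: ennpowr_ennreal)
    qed (use real r in simp)
  next
    \<comment> \<open>For an infinite mean, the tangent at 1 already forces the right-hand side to
      be infinite.\<close>
    case top
    then show ?thesis using sum[of 1] r by (simp add: ennreal_mult_top top_unique)
  qed
qed

lemma nn_integral_abs_powr_le:
  fixes s :: real
  assumes s: "0 < s" "s < 1" and T: "0 < T"
  shows "(\<integral>\<^sup>+t\<in>cball q T. ennpowr (ennreal \<bar>t - q\<bar>) (- s) \<partial>lborel) \<le> ennreal (2 * T powr (1 - s) / (1 - s))"
proof -
  let ?h = "\<lambda>t::real. ennreal (if t \<in> {0..T} then t powr (- s) else 0)"
  have "((\<lambda>x. x powr (- s)) has_integral (T powr (- s + 1) / (- s + 1))) {0..T}"
    using s T by (intro has_integral_powr_from_0) auto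
  then have "((\<lambda>x. if x \<in> {0..T} then x powr (- s) else 0) has_integral (T powr (- s + 1) / (- s + 1))) UNIV"
    by (simp only: has_integral_restrict_UNIV)
  then have h: "(\<integral>\<^sup>+t. ?h t \<partial>lborel) = ennreal (T powr (1 - s) / (1 - s))"
    by (subst nn_integral_has_integral_lborel) (auto simp: add.commute)
  have [measurable]: "cball q T \<in> sets borel" by simp
  have "(\<integral>\<^sup>+t\<in>cball q T. ennpowr (ennreal \<bar>t - q\<bar>) (- s) \<partial>lborel)
      = (\<integral>\<^sup>+t. ennpowr (ennreal \<bar>t\<bar>) (- s) * indicator (cball q T) (q + t) \<partial>lborel)"
    by (subst nn_integral_real_affine[where c = 1 and t = q]) auto
  also have "\<dots> \<le> (\<integral>\<^sup>+t. ?h t + ?h (- t) \<partial>lborel)"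
  proof (rule nn_integral_mono_AE)
    show "AE t in lborel. ennpowr (ennreal \<bar>t\<bar>) (- s) * indicator (cball q T) (q + t) \<le> ?h t + ?h (- t)"
      using AE_lborel_singleton[of "0::real"]
    proof eventually_elim
      fix t :: real assume "t \<noteq> 0"
      then show "ennpowr (ennreal \<bar>t\<bar>) (- s) * indicator (cball q T) (q + t) \<le> ?h t + ?h (- t)"
        by (cases "0 < t") (auto simp: ennpowr_ennreal dist_real_def split: split_indicator)
    qed
  qed
  also have "\<dots> = (\<integral>\<^sup>+t. ?h t \<partial>lborel) + (\<integral>\<^sup>+t. ?h (- t) \<partial>lborel)"
    by (rule nn_integral_add) auto
  also have "(\<integral>\<^sup>+t. ?h (- t) \<partial>lborel) = (\<integral>\<^sup>+t. ?h t \<partial>lborel)"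
    using nn_integral_real_affine[of ?h "-1" 0] by (simp cong: if_cong)
  also have "(\<integral>\<^sup>+t. ?h t \<partial>lborel) + (\<integral>\<^sup>+t. ?h t \<partial>lborel) = ennreal (2 * T powr (1 - s) / (1 - s))"
    using s by (simp only: h) (simp add: ennreal_plus[symmetric] del: ennreal_plus)
  finally show ?thesis .
qed

text \<open>The A_1 property of |t - q|^(-s): the last factor is its infimum over the interval. If q
  is far away, the function varies by a factor of at most 3^s \<le> 3 over an interval of length 2
  R, which gives the constant 6. Otherwise the interval lies in the one of radius 3 R about q, where
  explicit integration gives 6 / (1 - s).\<close>

lemma nn_integral_abs_powr_interval_le:
  fixes s :: real
  assumes s: "0 < s" "s < 1" and R: "0 < R"
  shows "(\<integral>\<^sup>+t\<in>cball a R. ennpowr (ennreal \<bar>t - q\<bar>) (- s) \<partial>lborel)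
    \<le> ennreal ((6 + 6 / (1 - s)) * R * (\<bar>a - q\<bar> + R) powr (- s))"
proof (cases "\<bar>a - q\<bar> \<ge> 2 * R")
  case True
  let ?c = "((\<bar>a - q\<bar> + R) / 3) powr (- s)"
  have [measurable]: "cball a R \<in> sets borel" by simp
  have "(\<integral>\<^sup>+t\<in>cball a R. ennpowr (ennreal \<bar>t - q\<bar>) (- s) \<partial>lborel)
      \<le> (\<integral>\<^sup>+t. ennreal ?c * indicator (cball a R) t \<partial>lborel)"
  proof (rule nn_integral_mono)
    fix t
    show "ennpowr (ennreal \<bar>t - q\<bar>) (- s) * indicator (cball a R) t \<le> ennreal ?c * indicator (cball a R) t"
    proof (cases "t \<in> cball a R")
      case t: True
      then have "\<bar>a - t\<bar> \<le> R" by (simp add: dist_real_def)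
      then have le: "(\<bar>a - q\<bar> + R) / 3 \<le> \<bar>t - q\<bar>"
        using True abs_triangle_ineq[of "a - t" "t - q"] by simp
      moreover have pos: "0 < (\<bar>a - q\<bar> + R) / 3" using R by simp
      ultimately have "\<bar>t - q\<bar> powr (- s) \<le> ?c" using s by (intro powr_mono2') auto
      moreover have "0 < \<bar>t - q\<bar>" using le pos by linarith
      ultimately show ?thesis using t by (simp add: ennpowr_ennreal ennreal_leI)
    qed simp
  qed
  also have "\<dots> = ennreal ?c * ennreal (2 * R)"
    using R by (subst nn_integral_cmult_indicator) (auto simp: cball_eq_atLeastAtMost)
  also have "\<dots> = ennreal (?c * (2 * R))" by (simp add: ennreal_mult' [symmetric])
  also have "\<dots> \<le> ennreal ((6 + 6 / (1 - s)) * R * (\<bar>a - q\<bar> + R) powr (- s))"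
  proof (rule ennreal_leI)
    have "?c = 3 powr s * (\<bar>a - q\<bar> + R) powr (- s)"
      using R by (simp add: powr_divide powr_minus field_simps)
    moreover have "3 powr s \<le> 3 powr (1::real)" using s by (intro powr_mono) auto
    ultimately have "?c \<le> 3 * (\<bar>a - q\<bar> + R) powr (- s)" by (simp add: mult_right_mono)
    then have "?c * (2 * R) \<le> 3 * (\<bar>a - q\<bar> + R) powr (- s) * (2 * R)"
      using R by (intro mult_right_mono) auto
    also have "\<dots> \<le> (6 + 6 / (1 - s)) * R * (\<bar>a - q\<bar> + R) powr (- s)"
      using s R by (simp add: field_simps)
    finally show "?c * (2 * R) \<le> (6 + 6 / (1 - s)) * R * (\<bar>a - q\<bar> + R) powr (- s)" .
  qed
  finally show ?thesis .
next
  case False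
  have "(\<integral>\<^sup>+t\<in>cball a R. ennpowr (ennreal \<bar>t - q\<bar>) (- s) \<partial>lborel)
      \<le> (\<integral>\<^sup>+t\<in>cball q (3 * R). ennpowr (ennreal \<bar>t - q\<bar>) (- s) \<partial>lborel)"
    using False by (intro nn_integral_mono) (auto simp: dist_real_def split: split_indicator)
  also have "\<dots> \<le> ennreal (2 * (3 * R) powr (1 - s) / (1 - s))"
    using s R by (intro nn_integral_abs_powr_le) auto
  also have "\<dots> \<le> ennreal ((6 + 6 / (1 - s)) * R * (\<bar>a - q\<bar> + R) powr (- s))"
  proof (rule ennreal_leI)
    have "2 * (3 * R) powr (1 - s) / (1 - s) = 6 / (1 - s) * R * (3 * R) powr (- s)"
      using R by (simp add: powr_diff powr_minus field_simps)
    also have "\<dots> \<le> 6 / (1 - s) * R * (\<bar>a - q\<bar> + R) powr (- s)"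
      using s R False by (intro mult_left_mono powr_mono2') auto
    also have "\<dots> \<le> (6 + 6 / (1 - s)) * R * (\<bar>a - q\<bar> + R) powr (- s)"
      using s R by (intro mult_right_mono) auto
    finally show "2 * (3 * R) powr (1 - s) / (1 - s) \<le> (6 + 6 / (1 - s)) * R * (\<bar>a - q\<bar> + R) powr (- s)" .
  qed
  finally show ?thesis .
qed

text \<open>The constant is independent of b and q; this uniformity is what permits summing over all
  hyperplanes.\<close>

lemma ball_integral_hyperplane_powr_le:
  fixes s :: real
  assumes s: "0 < s" "s < 1"
  obtains C where "0 < C" "\<And>b q x R. b \<in> (Basis :: 'a::euclidean_space set) \<Longrightarrow> 0 < R \<Longrightarrow>
    (\<integral>\<^sup>+y\<in>ball x R. ennpowr (ennreal \<bar>y \<bullet> b - q\<bar>) (- s) \<partial>lborel)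
      \<le> ennreal (C * (\<bar>x \<bullet> b - q\<bar> + R) powr (- s)) * emeasure lborel (ball x R)"
proof
  let ?n = "DIM('a)"
  let ?v = "unit_ball_vol (real ?n)"
  let ?K = "6 + 6 / (1 - s)"
  have K: "0 < ?K" using s by (intro add_pos_pos) auto
  define C where "C = 2 ^ (?n - 1) * ?K / ?v"
  show "0 < C" using K by (simp add: C_def)
  fix b x :: 'a and q R :: real assume b: "b \<in> Basis" and R: "0 < R"
  let ?g = "(\<bar>x \<bullet> b - q\<bar> + R) powr (- s)"
  have "(\<integral>\<^sup>+y\<in>ball x R. ennpowr (ennreal \<bar>y \<bullet> b - q\<bar>) (- s) \<partial>lborel)
      \<le> (\<integral>\<^sup>+y\<in>cball x R. ennpowr (ennreal \<bar>y \<bullet> b - q\<bar>) (- s) \<partial>lborel)"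
    by (intro nn_integral_mono) (auto split: split_indicator)
  also have "\<dots> \<le> ennreal ((2 * R) ^ (?n - 1)) *
      (\<integral>\<^sup>+t\<in>cball (x \<bullet> b) R. ennpowr (ennreal \<bar>t - q\<bar>) (- s) \<partial>lborel)"
    using b R by (intro nn_integral_coordinate_le) auto
  also have "\<dots> \<le> ennreal ((2 * R) ^ (?n - 1)) * ennreal (?K * R * ?g)"
    using s R by (intro mult_left_mono nn_integral_abs_powr_interval_le) auto
  also have "\<dots> = ennreal (C * ?g) * ennreal (?v * R ^ ?n)"
  proof -
    have "R ^ ?n = R * R ^ (?n - 1)" by (simp add: power_Suc[symmetric] del: power_Suc)
    moreover have "?v \<noteq> 0" by (rule less_imp_neq[symmetric]) simp
    ultimately have "(2 * R) ^ (?n - 1) * (?K * R * ?g) = C * ?g * (?v * R ^ ?n)"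
      by (simp add: C_def power_mult_distrib mult_ac)
    then show ?thesis
      using K R \<open>0 < C\<close> unit_ball_vol_pos[of "real ?n"] by (simp add: ennreal_mult[symmetric] less_imp_le)
  qed
  also have "\<dots> = ennreal (C * ?g) * emeasure lborel (ball x R)"
    using R by (simp add: emeasure_ball)
  finally show "(\<integral>\<^sup>+y\<in>ball x R. ennpowr (ennreal \<bar>y \<bullet> b - q\<bar>) (- s) \<partial>lborel)
      \<le> ennreal (C * ?g) * emeasure lborel (ball x R)" .
qed

subsection \<open>The weight\<close>

definition hyperplane :: "nat \<Rightarrow> 'a::euclidean_space \<times> real" where
  "hyperplane = from_nat_into (Basis \<times> \<rat>)"

definition hyperplane_dist :: "nat \<Rightarrow> 'a::euclidean_space \<Rightarrow> real" where
  "hyperplane_dist k x = \<bar>x \<bullet> fst (hyperplane k) - snd (hyperplane k :: 'a \<times> real)\<bar>"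

text \<open>
  With the exponent \<open>1 / 2\<close>, the summands to the power \<open>r\<close> are locally integrable for all \<open>r < 2\<close>.
\<close>

definition potential :: "'a::euclidean_space \<Rightarrow> ennreal" where
  "potential x = (\<Sum>k. ennreal ((1/2)^k) * ennpowr (ennreal (hyperplane_dist k x)) (- (1/2)))"

text \<open>Each summand is the infimum over \<open>ball x R\<close> of the corresponding summand of
  \<open>potential\<close>, approached at points farthest from the hyperplane. For R > 0 the sum is
  finite, even where \<open>potential x\<close> is infinite.\<close>

definition potential_bound :: "'a::euclidean_space \<Rightarrow> real \<Rightarrow> real" where
  "potential_bound x R = (\<Sum>k. (1/2)^k * (hyperplane_dist k x + R) powr (- (1/2)))"

text \<open>
  Where the potential is infinite, the weight is \<open>0 powr (- 2 * \<alpha>) = 0\<close>, the correct limit.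
\<close>

definition weight :: "real \<Rightarrow> 'a::euclidean_space \<Rightarrow> real" where
  "weight \<alpha> x = enn2real (potential x) powr (- 2 * \<alpha>)"

lemma hyperplane_in: "hyperplane k \<in> (Basis :: 'a::euclidean_space set) \<times> \<rat>"
  unfolding hyperplane_def by (rule from_nat_into) (use nonempty_Basis Rats_0 in blast)

lemma fst_hyperplane: "fst (hyperplane k) \<in> (Basis :: 'a::euclidean_space set)"
  using hyperplane_in[of k, where 'a = 'a] by auto

lemma ex_hyperplane:
  assumes "b \<in> (Basis :: 'a::euclidean_space set)" "q \<in> \<rat>"
  obtains k where "hyperplane k = (b, q)"
proof -
  have "countable ((Basis :: 'a set) \<times> (\<rat> :: real set))"
    by (intro countable_SIGMA countable_rat) (auto simp: countable_finite)
  then show ?thesis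
    using from_nat_into_surj[of "Basis \<times> \<rat>" "(b, q)"] assms that unfolding hyperplane_def by blast
qed

lemma hyperplane_dist_nonneg: "0 \<le> hyperplane_dist k x"
  by (simp add: hyperplane_dist_def)

lemma hyperplane_dist_measurable [measurable]: "hyperplane_dist k \<in> borel_measurable borel"
  unfolding hyperplane_dist_def by measurable

lemma potential_measurable [measurable]: "potential \<in> borel_measurable borel"
  unfolding potential_def by measurable

lemma weight_measurable [measurable]: "weight \<alpha> \<in> borel_measurable borel"
  unfolding weight_def by measurable

lemma hyperplane_dist_le:
  "hyperplane_dist k (y::'a::euclidean_space) \<le> hyperplane_dist k x + dist x y"
proof -
  have "hyperplane_dist k y \<le> hyperplane_dist k x + \<bar>(y - x) \<bullet> fst (hyperplane k)\<bar>"
    by (auto simp: hyperplane_dist_def inner_diff_left)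
  also have "\<bar>(y - x) \<bullet> fst (hyperplane k)\<bar> \<le> norm (y - x)" by (intro Basis_le_norm fst_hyperplane)
  finally show ?thesis by (simp add: dist_norm norm_minus_commute)
qed

lemma potential_bound_summable:
  assumes R: "0 < R"
  shows "summable (\<lambda>k. (1/2)^k * (hyperplane_dist k x + R) powr (- (1/2)))"
proof (rule summable_comparison_test')
  show "summable (\<lambda>k. (1/2)^k * R powr (- (1/2)))"
    by (intro summable_mult2 summable_geometric) auto
  fix k :: nat
  have "(hyperplane_dist k x + R) powr (- (1/2)) \<le> R powr (- (1/2))"
    using R hyperplane_dist_nonneg[of k x] by (intro powr_mono2') auto
  then show "norm ((1/2)^k * (hyperplane_dist k x + R) powr (- (1/2))) \<le> (1/2)^k * R powr (- (1/2))"
    by simp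
qed

lemma hyperplane_dist_add_pos: "0 < R \<Longrightarrow> 0 < hyperplane_dist k x + R"
  using hyperplane_dist_nonneg[of k x] by simp

lemma potential_bound_pos:
  assumes "0 < R"
  shows "0 < potential_bound x R"
  unfolding potential_bound_def
proof (rule suminf_pos[OF potential_bound_summable[OF assms]])
  fix k
  have "hyperplane_dist k x + R \<noteq> 0" using hyperplane_dist_add_pos[OF assms, of k x] by simp
  then show "0 < (1/2)^k * (hyperplane_dist k x + R) powr (- (1/2))" by simp
qed

lemma potential_bound_ennreal:
  assumes "0 < R"
  shows "(\<Sum>k. ennreal ((1/2)^k * (hyperplane_dist k x + R) powr (- (1/2)))) = ennreal (potential_bound x R)"
  unfolding potential_bound_def
  by (intro suminf_ennreal2 potential_bound_summable assms) auto

lemma potential_bound_le_potential: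
  assumes R: "0 < R" and y: "y \<in> ball x R"
  shows "ennreal (potential_bound x R) \<le> potential y"
  unfolding potential_bound_ennreal[OF R, symmetric] potential_def
proof (rule suminf_le)
  fix k
  have le: "hyperplane_dist k y \<le> hyperplane_dist k x + R"
    using hyperplane_dist_le[of k y x] y by simp
  have "ennreal ((hyperplane_dist k x + R) powr (- (1/2))) \<le> ennpowr (ennreal (hyperplane_dist k y)) (- (1/2))"
  proof (cases "hyperplane_dist k y = 0")
    case True
    then show ?thesis by (simp add: ennpowr_def)
  next
    case False
    then have "0 < hyperplane_dist k y" using hyperplane_dist_nonneg[of k y] by simp
    then show ?thesis using le by (auto simp: ennpowr_ennreal intro!: ennreal_leI powr_mono2')
  qed
  then show "ennreal ((1/2)^k * (hyperplane_dist k x + R) powr (- (1/2)))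
      \<le> ennreal ((1/2)^k) * ennpowr (ennreal (hyperplane_dist k y)) (- (1/2))"
    by (simp add: ennreal_mult mult_left_mono)
qed auto

lemma potential_bound_double:
  assumes R: "0 < R"
  shows "potential_bound x R \<le> 2 powr (1/2) * potential_bound x (2 * R)"
proof -
  have R2: "0 < 2 * R" using R by simp
  have "potential_bound x R \<le> (\<Sum>k. 2 powr (1/2) * ((1/2)^k * (hyperplane_dist k x + 2 * R) powr (- (1/2))))"
    unfolding potential_bound_def
  proof (intro suminf_le potential_bound_summable R summable_mult R2)
    fix k
    have "2 powr (- (1/2)) * (hyperplane_dist k x + R) powr (- (1/2)) = (2 * (hyperplane_dist k x + R)) powr (- (1/2))"
      by (rule powr_mult[symmetric])
    also have "\<dots> \<le> (hyperplane_dist k x + 2 * R) powr (- (1/2))"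
      using hyperplane_dist_nonneg[of k x] R by (intro powr_mono2') auto
    finally have "2 powr (1/2) * (2 powr (- (1/2)) * (hyperplane_dist k x + R) powr (- (1/2)))
        \<le> 2 powr (1/2) * (hyperplane_dist k x + 2 * R) powr (- (1/2))"
      by (intro mult_left_mono) auto
    then have "(hyperplane_dist k x + R) powr (- (1/2)) \<le> 2 powr (1/2) * (hyperplane_dist k x + 2 * R) powr (- (1/2))"
      by (simp add: mult.assoc[symmetric] powr_add[symmetric])
    then have "(1/2)^k * (hyperplane_dist k x + R) powr (- (1/2))
        \<le> (1/2)^k * (2 powr (1/2) * (hyperplane_dist k x + 2 * R) powr (- (1/2)))"
      by (intro mult_left_mono) auto
    then show "(1/2)^k * (hyperplane_dist k x + R) powr (- (1/2))
        \<le> 2 powr (1/2) * ((1/2)^k * (hyperplane_dist k x + 2 * R) powr (- (1/2)))"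
      by (simp add: mult_ac)
  qed
  also have "\<dots> = 2 powr (1/2) * potential_bound x (2 * R)"
    unfolding potential_bound_def by (intro suminf_mult potential_bound_summable R2)
  finally show ?thesis .
qed

text \<open>\<open>potential y\<close> is written as \<open>potential_bound x R\<close> times a
  convex combination: \<open>l k\<close> is the share of the k-th summand in the bound, and it
  multiplies the ratio of the k-th summand at y to its bound. Jensen's inequality then moves the
  power r onto the single ratios.\<close>

lemma potential_powr_le:
  assumes R: "0 < R" and r: "1 \<le> r"
  shows "ennpowr (potential y) r \<le> (\<Sum>k. ennreal ((1/2)^k * potential_bound x R powr (r - 1)
    * (hyperplane_dist k x + R) powr ((r - 1) / 2)) * ennpowr (ennreal (hyperplane_dist k y)) (- (r / 2)))"
proof -
  let ?m = "potential_bound x R" let ?d = "\<lambda>k. hyperplane_dist k x + R"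
  let ?u = "\<lambda>k. ennpowr (ennreal (hyperplane_dist k y)) (- (1/2))"
  have m: "0 < ?m" using R by (rule potential_bound_pos)
  have d: "0 < ?d k" for k using R by (rule hyperplane_dist_add_pos)
  define l where "l k = (1/2)^k * ?d k powr (- (1/2)) / ?m" for k
  have l: "0 \<le> l k" for k using m by (simp add: l_def)
  have "ennreal (l k) = ennreal ((1/2)^k * ?d k powr (- (1/2))) * ennreal (1 / ?m)" for k
    using m by (simp add: l_def ennreal_mult[symmetric])
  then have "(\<Sum>k. ennreal (l k)) = (\<Sum>k. ennreal ((1/2)^k * ?d k powr (- (1/2)))) * ennreal (1 / ?m)"
    by (simp only: ennreal_suminf_multc)
  also have "\<dots> = 1"
    using m by (simp only: potential_bound_ennreal[OF R]) (simp add: ennreal_mult[symmetric])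
  finally have l1: "(\<Sum>k. ennreal (l k)) = 1" .
  have pot: "potential y = ennreal ?m * (\<Sum>k. ennreal (l k) * (ennreal (?d k powr (1/2)) * ?u k))"
  proof -
    have "ennreal ?m * (ennreal (l k) * (ennreal (?d k powr (1/2)) * ?u k)) = ennreal ((1/2)^k) * ?u k" for k
    proof -
      have "?m * (l k * ?d k powr (1/2)) = (1/2)^k"
        using m d[of k] by (simp add: l_def powr_add[symmetric])
      then have "ennreal ?m * (ennreal (l k) * ennreal (?d k powr (1/2))) = ennreal ((1/2)^k)"
        using m l by (simp add: ennreal_mult[symmetric])
      then show ?thesis by (simp add: mult.assoc[symmetric])
    qed
    then show ?thesis by (simp add: potential_def ennreal_suminf_cmult[symmetric] del: ennreal_suminf_cmult)
  qed
  have "ennpowr (potential y) r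
      = ennreal (?m powr r) * ennpowr (\<Sum>k. ennreal (l k) * (ennreal (?d k powr (1/2)) * ?u k)) r"
    unfolding pot using r m by (simp add: ennpowr_mult ennpowr_ennreal)
  also have "\<dots> \<le> ennreal (?m powr r) * (\<Sum>k. ennreal (l k) * ennpowr (ennreal (?d k powr (1/2)) * ?u k) r)"
    by (intro mult_left_mono ennpowr_suminf_convex l l1 r) auto
  also have "\<dots> = (\<Sum>k. ennreal (?m powr r) * (ennreal (l k) * ennpowr (ennreal (?d k powr (1/2)) * ?u k) r))"
    by (rule ennreal_suminf_cmult[symmetric])
  also have "\<dots> = (\<Sum>k. ennreal ((1/2)^k * ?m powr (r - 1) * ?d k powr ((r - 1) / 2))
      * ennpowr (ennreal (hyperplane_dist k y)) (- (r / 2)))"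
  proof (rule suminf_cong)
    fix k
    have u: "ennpowr (?u k) r = ennpowr (ennreal (hyperplane_dist k y)) (- (r / 2))"
      using r hyperplane_dist_nonneg[of k y]
      by (cases "hyperplane_dist k y = 0") (auto simp: ennpowr_def powr_powr)
    have "?m powr r * (l k * ?d k powr (r / 2)) = (1/2)^k * ?m powr (r - 1) * ?d k powr ((r - 1) / 2)"
    proof -
      have "?m powr r = ?m powr (r - 1) * ?m" using m by (simp add: powr_diff)
      moreover have "?d k powr ((r - 1) / 2) = ?d k powr (- (1/2)) * ?d k powr (r / 2)"
        by (simp add: powr_add[symmetric] diff_divide_distrib)
      ultimately show ?thesis using m by (simp add: l_def)
    qed
    then have "ennreal (?m powr r) * (ennreal (l k) * ennreal (?d k powr (r / 2)))
        = ennreal ((1/2)^k * ?m powr (r - 1) * ?d k powr ((r - 1) / 2))"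
      using l by (simp add: ennreal_mult[symmetric])
    moreover have "ennpowr (ennreal (?d k powr (1/2)) * ?u k) r
        = ennreal (?d k powr (r / 2)) * ennpowr (ennreal (hyperplane_dist k y)) (- (r / 2))"
      using r by (simp add: ennpowr_mult ennpowr_ennreal powr_powr u)
    ultimately show "ennreal (?m powr r) * (ennreal (l k) * ennpowr (ennreal (?d k powr (1/2)) * ?u k) r)
      = ennreal ((1/2)^k * ?m powr (r - 1) * ?d k powr ((r - 1) / 2))
        * ennpowr (ennreal (hyperplane_dist k y)) (- (r / 2))"
      by (simp add: mult.assoc[symmetric])
  qed
  finally show ?thesis .
qed

text \<open>\<open>potential_powr_le\<close> is integrated term by term with the hyperplane estimate
  for s = r / 2 < 1. The exponents (r - 1) / 2 and - r / 2 of \<open>hyperplane_dist k x + R\<close>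
  add up to -1/2, so the sum over k reproduces \<open>potential_bound x R\<close>, the factor
  missing from its r-th power.\<close>

lemma potential_average_ge1:
  assumes r: "1 \<le> r" "r < 2"
  obtains C where "0 < C" "\<And>(x :: 'a::euclidean_space) R. 0 < R \<Longrightarrow>
    (\<integral>\<^sup>+y\<in>ball x R. ennpowr (potential y) r \<partial>lborel)
      \<le> ennreal (C * potential_bound x R powr r) * emeasure lborel (ball x R)"
proof -
  have "0 < r / 2" "r / 2 < 1" using r by auto
  then obtain C where C: "0 < C" and le: "\<And>b q (x::'a) R. b \<in> Basis \<Longrightarrow> 0 < R \<Longrightarrow>
    (\<integral>\<^sup>+y\<in>ball x R. ennpowr (ennreal \<bar>y \<bullet> b - q\<bar>) (- (r / 2)) \<partial>lborel)
      \<le> ennreal (C * (\<bar>x \<bullet> b - q\<bar> + R) powr (- (r / 2))) * emeasure lborel (ball x R)"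
    by (rule ball_integral_hyperplane_powr_le) blast
  show ?thesis
  proof (rule that[OF C])
    fix x :: 'a and R :: real assume R: "0 < R"
    let ?m = "potential_bound x R" let ?d = "\<lambda>k. hyperplane_dist k x + R"
    let ?a = "\<lambda>k. (1/2)^k * ?m powr (r - 1) * ?d k powr ((r - 1) / 2)"
    let ?B = "emeasure lborel (ball x R)"
    have m: "0 < ?m" using R by (rule potential_bound_pos)
    have d: "0 < ?d k" for k using R by (rule hyperplane_dist_add_pos)
    have [measurable]: "ball x R \<in> sets borel" by simp
    have "(\<integral>\<^sup>+y\<in>ball x R. ennpowr (potential y) r \<partial>lborel)
      \<le> (\<integral>\<^sup>+y. (\<Sum>k. ennreal (?a k) * (ennpowr (ennreal (hyperplane_dist k y)) (- (r / 2)) * indicator (ball x R) y)) \<partial>lborel)"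
    proof (rule nn_integral_mono)
      fix y
      show "ennpowr (potential y) r * indicator (ball x R) y
        \<le> (\<Sum>k. ennreal (?a k) * (ennpowr (ennreal (hyperplane_dist k y)) (- (r / 2)) * indicator (ball x R) y))"
        using potential_powr_le[OF R r(1), of y x] by (simp add: mult.assoc[symmetric] ennreal_suminf_multc mult_right_mono)
    qed
    also have "\<dots> = (\<Sum>k. ennreal (?a k) * (\<integral>\<^sup>+y\<in>ball x R. ennpowr (ennreal (hyperplane_dist k y)) (- (r / 2)) \<partial>lborel))"
      by (subst nn_integral_suminf) (auto simp: nn_integral_cmult)
    also have "\<dots> \<le> (\<Sum>k. ennreal ((1/2)^k * ?d k powr (- (1/2))) * (ennreal (C * ?m powr (r - 1)) * ?B))"
    proof (rule suminf_le)
      fix k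
      have "ennreal (?a k) * (\<integral>\<^sup>+y\<in>ball x R. ennpowr (ennreal (hyperplane_dist k y)) (- (r / 2)) \<partial>lborel)
        \<le> ennreal (?a k) * (ennreal (C * ?d k powr (- (r / 2))) * ?B)"
        unfolding hyperplane_dist_def by (intro mult_left_mono le fst_hyperplane R) auto
      also have "ennreal (?a k) * (ennreal (C * ?d k powr (- (r / 2))) * ?B)
          = ennreal ((1/2)^k * ?d k powr (- (1/2))) * (ennreal (C * ?m powr (r - 1)) * ?B)"
      proof -
        have "?d k powr ((r - 1) / 2) * ?d k powr (- (r / 2)) = ?d k powr (- (1/2))"
          by (simp add: powr_add[symmetric] diff_divide_distrib)
        then have "?a k * (C * ?d k powr (- (r / 2))) = (1/2)^k * ?d k powr (- (1/2)) * (C * ?m powr (r - 1))"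
          by (simp add: mult_ac)
        then have "ennreal (?a k) * ennreal (C * ?d k powr (- (r / 2)))
            = ennreal ((1/2)^k * ?d k powr (- (1/2))) * ennreal (C * ?m powr (r - 1))"
          using C by (simp add: ennreal_mult[symmetric])
        then show ?thesis by (simp add: mult.assoc[symmetric])
      qed
      finally show "ennreal (?a k) * (\<integral>\<^sup>+y\<in>ball x R. ennpowr (ennreal (hyperplane_dist k y)) (- (r / 2)) \<partial>lborel)
        \<le> ennreal ((1/2)^k * ?d k powr (- (1/2))) * (ennreal (C * ?m powr (r - 1)) * ?B)" .
    qed auto
    also have "\<dots> = ennreal ?m * (ennreal (C * ?m powr (r - 1)) * ?B)"
      by (simp only: ennreal_suminf_multc potential_bound_ennreal[OF R])
    also have "\<dots> = ennreal (C * ?m powr r) * ?B"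
    proof -
      have "?m * (C * ?m powr (r - 1)) = C * ?m powr r" using m by (simp add: powr_diff)
      then have "ennreal ?m * ennreal (C * ?m powr (r - 1)) = ennreal (C * ?m powr r)"
        using m C by (simp add: ennreal_mult[symmetric])
      then show ?thesis by (simp add: mult.assoc[symmetric])
    qed
    finally show "(\<integral>\<^sup>+y\<in>ball x R. ennpowr (potential y) r \<partial>lborel) \<le> ennreal (C * ?m powr r) * ?B" .
  qed
qed

lemma potential_average:
  assumes r: "0 < r" "r < 2"
  obtains C where "0 < C" "\<And>(x :: 'a::euclidean_space) R. 0 < R \<Longrightarrow>
    (\<integral>\<^sup>+y\<in>ball x R. ennpowr (potential y) r \<partial>lborel)
      \<le> ennreal (C * potential_bound x R powr r) * emeasure lborel (ball x R)"
proof (cases "1 \<le> r")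
  case True
  then show ?thesis using potential_average_ge1[OF _ r(2)] that by blast
next
  case False
  obtain C where C: "0 < C" and le: "\<And>(x :: 'a) R. 0 < R \<Longrightarrow>
    (\<integral>\<^sup>+y\<in>ball x R. ennpowr (potential y) 1 \<partial>lborel)
      \<le> ennreal (C * potential_bound x R powr 1) * emeasure lborel (ball x R)"
    by (rule potential_average_ge1[of 1]) auto
  show ?thesis
  proof (rule that[OF C])
    fix x :: 'a and R :: real assume R: "0 < R"
    let ?m = "potential_bound x R" let ?B = "emeasure lborel (ball x R)"
    have m: "0 < ?m" using R by (rule potential_bound_pos)
    have pw: "ennpowr (potential y) r \<le> ennreal (?m powr (r - 1)) * potential y" if y: "y \<in> ball x R" for y
    proof (cases "potential y")
      case (real t)
      then have t: "?m \<le> t" using potential_bound_le_potential[OF R y] m by simp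
      have "t powr r = t powr (r - 1) * t" using t m by (simp add: powr_diff)
      also have "\<dots> \<le> ?m powr (r - 1) * t"
        using t m False by (intro mult_right_mono powr_mono2') auto
      finally show ?thesis using real r
        by (simp add: ennpowr_ennreal ennreal_mult[symmetric] ennreal_leI)
    next
      case top
      then show ?thesis using m by (simp add: ennreal_mult_top)
    qed
    have [measurable]: "ball x R \<in> sets borel" by simp
    have "(\<integral>\<^sup>+y\<in>ball x R. ennpowr (potential y) r \<partial>lborel)
        \<le> (\<integral>\<^sup>+y. ennreal (?m powr (r - 1)) * (ennpowr (potential y) 1 * indicator (ball x R) y) \<partial>lborel)"
      using pw by (intro nn_integral_mono) (auto split: split_indicator)
    also have "\<dots> = ennreal (?m powr (r - 1)) * (\<integral>\<^sup>+y\<in>ball x R. ennpowr (potential y) 1 \<partial>lborel)"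
      by (rule nn_integral_cmult) measurable
    also have "\<dots> \<le> ennreal (?m powr (r - 1)) * (ennreal (C * ?m powr 1) * ?B)"
      by (intro mult_left_mono le R) auto
    also have "\<dots> = ennreal (C * ?m powr r) * ?B"
    proof -
      have "?m powr (r - 1) * (C * ?m powr 1) = C * ?m powr r" using m by (simp add: powr_diff)
      then have "ennreal (?m powr (r - 1)) * ennreal (C * ?m powr 1) = ennreal (C * ?m powr r)"
        using m C by (simp add: ennreal_mult[symmetric])
      then show ?thesis by (simp add: mult.assoc[symmetric])
    qed
    finally show "(\<integral>\<^sup>+y\<in>ball x R. ennpowr (potential y) r \<partial>lborel) \<le> ennreal (C * ?m powr r) * ?B" .
  qed
qed

section \<open>Bounds for the weight, doubling and the Muckenhoupt condition\<close>

lemma potential_pos: "0 < potential x"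
proof -
  have "0 < ennreal (potential_bound x 1)" using potential_bound_pos[of 1 x] by simp
  also have "\<dots> \<le> potential x" by (rule potential_bound_le_potential) auto
  finally show ?thesis .
qed

lemma weight_nonneg: "0 \<le> weight \<alpha> x"
  by (simp add: weight_def)

lemma weight_le:
  assumes "0 < R" "y \<in> ball x R" "0 < \<alpha>"
  shows "weight \<alpha> y \<le> potential_bound x R powr (- 2 * \<alpha>)"
proof (cases "potential y")
  case (real t)
  then have "potential_bound x R \<le> t" using potential_bound_le_potential[OF assms(1,2)] potential_bound_pos[OF assms(1), of x] by simp
  then show ?thesis
    using real assms potential_bound_pos[OF assms(1), of x] by (auto simp: weight_def intro!: powr_mono2')
qed (simp add: weight_def)

text \<open>The single summand of this hyperplane bounds the potential from below, and
  (-1/2)(-2\<alpha>) = \<alpha>. The constant deteriorates with the index k, which is harmless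
  because each hyperplane is treated separately.\<close>

lemma weight_le_hyperplane:
  assumes b: "b \<in> (Basis :: 'a::euclidean_space set)" "q \<in> \<rat>" and \<alpha>: "0 < \<alpha>"
  shows "\<exists>C\<ge>0. \<forall>x. ennreal (weight \<alpha> x) \<le> ennreal (C * \<bar>x \<bullet> b - q\<bar> powr \<alpha>)"
proof -
  obtain k where k: "hyperplane k = (b, q)" using ex_hyperplane[OF b] .
  let ?C = "((1/2::real)^k) powr (- 2 * \<alpha>)"
  have "ennreal (weight \<alpha> x) \<le> ennreal (?C * \<bar>x \<bullet> b - q\<bar> powr \<alpha>)" for x
  proof (rule ennreal_leI)
    let ?t = "\<bar>x \<bullet> b - q\<bar>"
    have "ennreal ((1/2)^k) * ennpowr (ennreal (hyperplane_dist k x)) (- (1/2)) \<le> potential x"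
      unfolding potential_def
      using sum_le_suminf[of "\<lambda>k. ennreal ((1/2)^k) * ennpowr (ennreal (hyperplane_dist k x)) (- (1/2))" "{k}"]
      by simp
    then have le: "ennreal ((1/2)^k) * ennpowr (ennreal ?t) (- (1/2)) \<le> potential x"
      by (simp add: hyperplane_dist_def k)
    show "weight \<alpha> x \<le> ?C * ?t powr \<alpha>"
    proof (cases "potential x")
      case (real s)
      show ?thesis
      proof (cases "?t = 0")
        case True
        then show ?thesis using le real by (simp add: ennpowr_def ennreal_mult_top top_unique)
      next
        case False
        have "(1/2)^k * ?t powr (- (1/2)) \<le> s"
          using le real False by (simp add: ennpowr_ennreal ennreal_mult[symmetric])
        then have "s powr (- 2 * \<alpha>) \<le> ((1/2)^k * ?t powr (- (1/2))) powr (- 2 * \<alpha>)"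
          using False \<alpha> by (intro powr_mono2') auto
        also have "\<dots> = ?C * (?t powr (- (1/2))) powr (- 2 * \<alpha>)" by (rule powr_mult)
        also have "(?t powr (- (1/2))) powr (- 2 * \<alpha>) = ?t powr \<alpha>" by (simp add: powr_powr)
        finally show ?thesis using real by (simp add: weight_def)
      qed
    qed (simp add: weight_def)
  qed
  then show ?thesis by (intro exI[of _ ?C]) auto
qed

text \<open>At points of infinite potential the weight is 0 and the exponent on the left is
  negative, so the convention that negative powers of 0 are infinite keeps the identity valid
  everywhere.\<close>

lemma ennpowr_weight:
  assumes "0 < \<alpha>" "1 < p"
  shows "ennpowr (ennreal (weight \<alpha> x)) (1 / (1 - p)) = ennpowr (potential x) (2 * \<alpha> / (p - 1))"
proof (cases "potential x")
  case (real t)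
  then have t: "0 < t" using potential_pos[of x] by simp
  have "- (2 * \<alpha>) * (1 / (1 - p)) = 2 * \<alpha> / (p - 1)" using assms by (simp add: field_simps)
  then have "(t powr (- 2 * \<alpha>)) powr (1 / (1 - p)) = t powr (2 * \<alpha> / (p - 1))"
    by (simp only: powr_powr) simp
  then show ?thesis using real t by (simp add: weight_def ennpowr_ennreal)
next
  case top
  then show ?thesis using assms by (simp add: weight_def ennpowr_def)
qed

lemma emeasure_lborel_ball_pos:
  assumes "0 < R"
  shows "0 < emeasure lborel (ball (x::'a::euclidean_space) R)" "emeasure lborel (ball x R) < top"
  using assms by (auto simp: emeasure_ball intro!: mult_pos_pos)

abbreviation (input) weighted :: "('a::euclidean_space \<Rightarrow> real) \<Rightarrow> 'a measure" where
  "weighted w \<equiv> density lborel (\<lambda>x. ennreal (w x))"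

lemma emeasure_weight_le:
  fixes x :: "'a::euclidean_space"
  assumes R: "0 < R" and \<alpha>: "0 < \<alpha>"
  shows "emeasure (weighted (weight \<alpha>)) (ball x R)
    \<le> ennreal (potential_bound x R powr (- 2 * \<alpha>)) * emeasure lborel (ball x R)"
proof -
  have "emeasure (weighted (weight \<alpha>)) (ball x R)
      = (\<integral>\<^sup>+y\<in>ball x R. ennreal (weight \<alpha> y) \<partial>lborel)"
    by (subst emeasure_density) auto
  also have "\<dots> \<le> (\<integral>\<^sup>+y. ennreal (potential_bound x R powr (- 2 * \<alpha>)) * indicator (ball x R) y \<partial>lborel)"
    using weight_le[OF R _ \<alpha>, of _ x] by (intro nn_integral_mono) (auto intro!: ennreal_leI split: split_indicator)
  also have "\<dots> = ennreal (potential_bound x R powr (- 2 * \<alpha>)) * emeasure lborel (ball x R)"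
    by (rule nn_integral_cmult_indicator) auto
  finally show ?thesis .
qed

text \<open>Let m be \<open>potential_bound x R\<close>. The mean of the potential over the ball is
  at most C m, so it stays below A = 2 C m on at least half of the ball, where the weight is at
  least A^(-2\<alpha>). This gives c = (2 C)^(-2\<alpha>) / 2 and, with
  \<open>emeasure_weight_le\<close>, the size of the weighted ball up to constants.\<close>

lemma emeasure_weight_ge:
  assumes \<alpha>: "0 < \<alpha>"
  obtains c where "0 < c" "\<And>(x :: 'a::euclidean_space) R. 0 < R \<Longrightarrow>
    ennreal (c * potential_bound x R powr (- 2 * \<alpha>)) * emeasure lborel (ball x R)
      \<le> emeasure (weighted (weight \<alpha>)) (ball x R)"
proof -
  obtain C where C: "0 < C" and le: "\<And>(x :: 'a) R. 0 < R \<Longrightarrow>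
    (\<integral>\<^sup>+y\<in>ball x R. ennpowr (potential y) 1 \<partial>lborel)
      \<le> ennreal (C * potential_bound x R powr 1) * emeasure lborel (ball x R)"
    by (rule potential_average[of 1]) auto
  define c where "c = (2 * C) powr (- 2 * \<alpha>) / 2"
  show ?thesis
  proof (rule that[of c])
    show "0 < c" using C by (simp add: c_def)
    fix x :: 'a and R :: real assume R: "0 < R"
    let ?m = "potential_bound x R" let ?B = "emeasure lborel (ball x R)"
    let ?M = "weighted (weight \<alpha>)"
    have m: "0 < ?m" using R by (rule potential_bound_pos)
    define A where "A = 2 * C * ?m"
    have A: "0 < A" using C m by (simp add: A_def)
    define K where "K = A powr (- 2 * \<alpha>)"
    have K: "0 < K" using A by (simp add: K_def)
    \<comment> \<open>Chebyshev's inequality in pointwise form: the second summand takes over where the potential exceeds \<open>A\<close>.\<close>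
    have pw: "ennreal K \<le> ennreal (weight \<alpha> y) + ennreal (K / A) * potential y" for y
    proof (cases "potential y")
      case (real t)
      show ?thesis
      proof (cases "t \<le> A")
        case True
        have "0 < t" using potential_pos[of y] real by simp
        then have "K \<le> t powr (- 2 * \<alpha>)" unfolding K_def using True \<alpha> by (intro powr_mono2') auto
        then have "ennreal K \<le> ennreal (weight \<alpha> y)" using real by (simp add: weight_def ennreal_leI)
        then show ?thesis by (rule add_increasing2[rotated]) simp
      next
        case False
        then have "K \<le> K / A * t" using A K by (simp add: field_simps)
        then have "ennreal K \<le> ennreal (K / A) * potential y"
          using real A K by (simp add: ennreal_mult[symmetric] ennreal_leI)
        then show ?thesis by (rule add_increasing[rotated]) simp
      qed
    next
      case top
      then show ?thesis using A K by (simp add: ennreal_mult_top)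
    qed
    have [measurable]: "ball x R \<in> sets borel" by simp
    have "ennreal K * ?B = (\<integral>\<^sup>+y. ennreal K * indicator (ball x R) y \<partial>lborel)"
      by (rule nn_integral_cmult_indicator[symmetric]) auto
    also have "\<dots> \<le> (\<integral>\<^sup>+y. ennreal (weight \<alpha> y) * indicator (ball x R) y
        + ennreal (K / A) * (ennpowr (potential y) 1 * indicator (ball x R) y) \<partial>lborel)"
      using pw by (intro nn_integral_mono) (auto split: split_indicator)
    also have "\<dots> = emeasure ?M (ball x R)
        + ennreal (K / A) * (\<integral>\<^sup>+y\<in>ball x R. ennpowr (potential y) 1 \<partial>lborel)"
      by (subst nn_integral_add) (auto simp: emeasure_density nn_integral_cmult)
    also have "\<dots> \<le> emeasure ?M (ball x R) + ennreal (K / A) * (ennreal (C * ?m powr 1) * ?B)"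
      by (intro add_mono mult_left_mono le R) auto
    also have "ennreal (K / A) * (ennreal (C * ?m powr 1) * ?B) = ennreal (K / 2) * ?B"
    proof -
      have "K / A * (C * ?m powr 1) = K / 2" using m C by (simp add: A_def)
      then have "ennreal (K / A) * ennreal (C * ?m powr 1) = ennreal (K / 2)"
        using K A C m by (simp add: ennreal_mult[symmetric])
      then show ?thesis by (simp add: mult.assoc[symmetric])
    qed
    finally have "ennreal K * ?B \<le> emeasure ?M (ball x R) + ennreal (K / 2) * ?B" .
    moreover have "ennreal K * ?B = ennreal (K / 2) * ?B + ennreal (K / 2) * ?B"
      using K by (simp add: distrib_right[symmetric] ennreal_plus[symmetric] del: ennreal_plus)
    moreover have "ennreal (K / 2) * ?B \<noteq> top"
      using emeasure_lborel_ball_pos(2)[OF R, of x] by (simp add: ennreal_mult_eq_top_iff)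
    ultimately have "ennreal (K / 2) * ?B \<le> emeasure ?M (ball x R)"
      by (simp add: add.commute[of "emeasure ?M (ball x R)"] ennreal_add_left_cancel_le)
    moreover have "K / 2 = c * ?m powr (- 2 * \<alpha>)"
      by (simp add: K_def A_def c_def powr_mult)
    ultimately show "ennreal (c * ?m powr (- 2 * \<alpha>)) * ?B \<le> emeasure ?M (ball x R)" by simp
  qed
qed

text \<open>A reverse Hoelder inequality with exponent infinity: the supremum and the mean of the
  weight over a ball are both comparable to
  \<open>potential_bound x R powr (- 2 * \<alpha>)\<close>.\<close>

lemma reverse_Hoelder_weight:
  assumes \<alpha>: "0 < \<alpha>"
  obtains C where "0 < C" "\<And>(x :: 'a::euclidean_space) R y. 0 < R \<Longrightarrow> y \<in> ball x R \<Longrightarrow>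
    ennreal (weight \<alpha> y) * emeasure lborel (ball x R)
      \<le> ennreal C * emeasure (weighted (weight \<alpha>)) (ball x R)"
proof -
  obtain c where c: "0 < c" and le: "\<And>(x :: 'a) R. 0 < R \<Longrightarrow>
    ennreal (c * potential_bound x R powr (- 2 * \<alpha>)) * emeasure lborel (ball x R)
      \<le> emeasure (weighted (weight \<alpha>)) (ball x R)"
    using emeasure_weight_ge[OF \<alpha>] by blast
  show ?thesis
  proof (rule that[of "1 / c"])
    show "0 < 1 / c" using c by simp
    fix x y :: 'a and R :: real assume R: "0 < R" and y: "y \<in> ball x R"
    let ?K = "potential_bound x R powr (- 2 * \<alpha>)" let ?B = "emeasure lborel (ball x R)"
    have "ennreal (weight \<alpha> y) * ?B \<le> ennreal ?K * ?B"
      using weight_le[OF R y \<alpha>] by (intro mult_right_mono ennreal_leI) auto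
    also have "\<dots> = ennreal (1 / c) * (ennreal (c * ?K) * ?B)"
    proof -
      have "ennreal (1 / c) * ennreal (c * ?K) = ennreal ?K"
        using c by (simp add: ennreal_mult[symmetric])
      then show ?thesis by (simp add: mult.assoc[symmetric])
    qed
    also have "\<dots> \<le> ennreal (1 / c) * emeasure (weighted (weight \<alpha>)) (ball x R)"
      by (intro mult_left_mono le R) auto
    finally show "ennreal (weight \<alpha> y) * ?B
      \<le> ennreal (1 / c) * emeasure (weighted (weight \<alpha>)) (ball x R)" .
  qed
qed

text \<open>The weighted measure of a ball is comparable to
  \<open>potential_bound x R powr (- 2 * \<alpha>)\<close> times its volume. Doubling the radius
  lowers the potential bound by a factor of at most the square root of 2, which costs
  \<open>2 powr \<alpha>\<close>.\<close>

lemma doubling_weight: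
  assumes \<alpha>: "0 < \<alpha>"
  shows "doubling (density lborel (\<lambda>x. ennreal (weight \<alpha> (x :: 'a::euclidean_space))))"
proof -
  let ?M = "density lborel (\<lambda>x. ennreal (weight \<alpha> (x :: 'a)))"
  obtain c where c: "0 < c" and le: "\<And>(x :: 'a) R. 0 < R \<Longrightarrow>
    ennreal (c * potential_bound x R powr (- 2 * \<alpha>)) * emeasure lborel (ball x R) \<le> emeasure ?M (ball x R)"
    using emeasure_weight_ge[OF \<alpha>] by blast
  define D where "D = max 1 (2 powr \<alpha> * 2 ^ DIM('a) / c)"
  have dbl: "emeasure ?M (ball x (2 * R)) \<le> ennreal D * emeasure ?M (ball x R)"
    if R: "0 < R" for x R
  proof -
    let ?m = "potential_bound x R" let ?B = "emeasure lborel (ball x R)"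
    have R2: "0 < 2 * R" using R by simp
    have m: "0 < ?m" "0 < potential_bound x (2 * R)" using R by (auto intro: potential_bound_pos)
    have "(2 powr (1/2) * potential_bound x (2 * R)) powr (- 2 * \<alpha>) \<le> ?m powr (- 2 * \<alpha>)"
      using potential_bound_double[OF R, of x] m \<alpha> by (intro powr_mono2') auto
    then have "2 powr \<alpha> * (2 powr (- \<alpha>) * potential_bound x (2 * R) powr (- 2 * \<alpha>)) \<le> 2 powr \<alpha> * ?m powr (- 2 * \<alpha>)"
      by (intro mult_left_mono) (auto simp: powr_mult powr_powr)
    then have mm: "potential_bound x (2 * R) powr (- 2 * \<alpha>) \<le> 2 powr \<alpha> * ?m powr (- 2 * \<alpha>)"
      by (simp add: mult.assoc[symmetric] powr_add[symmetric])
    have "emeasure ?M (ball x (2 * R))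
        \<le> ennreal (potential_bound x (2 * R) powr (- 2 * \<alpha>)) * emeasure lborel (ball x (2 * R))"
      by (rule emeasure_weight_le[OF R2 \<alpha>])
    also have "\<dots> \<le> ennreal (2 powr \<alpha> * ?m powr (- 2 * \<alpha>)) * emeasure lborel (ball x (2 * R))"
      using mm by (intro mult_right_mono ennreal_leI) auto
    also have "emeasure lborel (ball x (2 * R)) = ennreal (2 ^ DIM('a)) * ?B"
      using R by (simp add: emeasure_ball power_mult_distrib ennreal_mult[symmetric] mult_ac)
    also have "ennreal (2 powr \<alpha> * ?m powr (- 2 * \<alpha>)) * (ennreal (2 ^ DIM('a)) * ?B)
        = ennreal (2 powr \<alpha> * 2 ^ DIM('a) / c) * (ennreal (c * ?m powr (- 2 * \<alpha>)) * ?B)"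
    proof -
      have "2 powr \<alpha> * ?m powr (- 2 * \<alpha>) * 2 ^ DIM('a) = 2 powr \<alpha> * 2 ^ DIM('a) / c * (c * ?m powr (- 2 * \<alpha>))"
        using c by simp
      then have "ennreal (2 powr \<alpha> * ?m powr (- 2 * \<alpha>)) * ennreal (2 ^ DIM('a))
          = ennreal (2 powr \<alpha> * 2 ^ DIM('a) / c) * ennreal (c * ?m powr (- 2 * \<alpha>))"
        using c by (simp only: ennreal_mult[symmetric] powr_ge_zero zero_le_power zero_le_numeral
            mult_nonneg_nonneg divide_nonneg_nonneg less_imp_le)
      then show ?thesis by (simp only: mult.assoc[symmetric])
    qed
    also have "\<dots> \<le> ennreal D * emeasure ?M (ball x R)"
      by (intro mult_mono le R ennreal_leI) (auto simp: D_def)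
    finally show ?thesis .
  qed
  have pos: "0 < emeasure ?M (ball x R)" if R: "0 < R" for x R
  proof -
    have "0 < ennreal (c * potential_bound x R powr (- 2 * \<alpha>)) * emeasure lborel (ball x R)"
      using c potential_bound_pos[OF R, of x] emeasure_lborel_ball_pos(1)[OF R, of x]
      by (auto simp: ennreal_zero_less_mult_iff)
    then show ?thesis using le[OF R] by (rule less_le_trans)
  qed
  have fin: "emeasure ?M (ball x R) < \<infinity>" if R: "0 < R" for x R
  proof -
    have "emeasure ?M (ball x R)
        \<le> ennreal (potential_bound x R powr (- 2 * \<alpha>)) * emeasure lborel (ball x R)"
      by (rule emeasure_weight_le[OF R \<alpha>])
    also have "\<dots> < \<infinity>"
      using emeasure_lborel_ball_pos(2)[OF R, of x] by (simp add: ennreal_mult_less_top)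
    finally show ?thesis .
  qed
  show ?thesis
    unfolding doubling_def using dbl pos fin by (auto intro!: exI[of _ D] simp: D_def)
qed

lemma nn_mean_le:
  assumes "(\<integral>\<^sup>+y\<in>A. f y \<partial>M) \<le> C * emeasure M A" "0 < emeasure M A" "emeasure M A < top"
  shows "nn_mean M A f \<le> C"
  unfolding nn_mean_def using assms by (simp add: divide_le_posI_ennreal mult.commute)

text \<open>With m for \<open>potential_bound x R\<close>, the mean of the weight is at most
  m^(-2\<alpha>), and the mean of the dual weight at most C m^(2\<alpha>/(p-1)); in the product the
  powers of m cancel.\<close>

lemma Ap_weight_weight:
  assumes \<alpha>: "0 < \<alpha>" and p: "1 + \<alpha> < p"
  shows "Ap_weight p (weight \<alpha> :: 'a::euclidean_space \<Rightarrow> real)"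
proof -
  let ?r = "2 * \<alpha> / (p - 1)"
  have r: "0 < ?r" "?r < 2" using \<alpha> p by (auto simp: field_simps)
  then obtain C where C: "0 < C" and le: "\<And>(x :: 'a) R. 0 < R \<Longrightarrow>
    (\<integral>\<^sup>+y\<in>ball x R. ennpowr (potential y) ?r \<partial>lborel)
      \<le> ennreal (C * potential_bound x R powr ?r) * emeasure lborel (ball x R)"
    by (rule potential_average) blast
  have "nn_mean lborel (ball x R) (\<lambda>y. ennreal (weight \<alpha> y)) *
      ennpowr (nn_mean lborel (ball x R) (\<lambda>y. ennpowr (ennreal (weight \<alpha> y)) (1 / (1 - p)))) (p - 1)
        \<le> ennreal (C powr (p - 1))" if R: "0 < R" for x :: 'a and R
  proof -
    let ?m = "potential_bound x R"
    note B = emeasure_lborel_ball_pos[OF R, of x]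
    have m: "0 < ?m" using R by (rule potential_bound_pos)
    have 1: "nn_mean lborel (ball x R) (\<lambda>y. ennreal (weight \<alpha> y)) \<le> ennreal (?m powr (- 2 * \<alpha>))"
      using emeasure_weight_le[OF R \<alpha>, of x] by (intro nn_mean_le B) (simp add: emeasure_density)
    have "nn_mean lborel (ball x R) (\<lambda>y. ennpowr (ennreal (weight \<alpha> y)) (1 / (1 - p))) \<le> ennreal (C * ?m powr ?r)"
      using le[OF R, of x] \<alpha> p by (intro nn_mean_le B) (simp add: ennpowr_weight)
    then have "ennpowr (nn_mean lborel (ball x R) (\<lambda>y. ennpowr (ennreal (weight \<alpha> y)) (1 / (1 - p)))) (p - 1)
        \<le> ennpowr (ennreal (C * ?m powr ?r)) (p - 1)"
      using p \<alpha> by (intro ennpowr_mono) auto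
    also have "\<dots> = ennreal (C powr (p - 1) * ?m powr (2 * \<alpha>))"
      using C p \<alpha> by (simp add: ennpowr_ennreal powr_mult powr_powr)
    finally have "nn_mean lborel (ball x R) (\<lambda>y. ennreal (weight \<alpha> y)) *
      ennpowr (nn_mean lborel (ball x R) (\<lambda>y. ennpowr (ennreal (weight \<alpha> y)) (1 / (1 - p)))) (p - 1)
      \<le> ennreal (?m powr (- 2 * \<alpha>)) * ennreal (C powr (p - 1) * ?m powr (2 * \<alpha>))"
      using 1 by (intro mult_mono) auto
    also have "\<dots> = ennreal (C powr (p - 1))"
    proof -
      have "?m powr (- 2 * \<alpha>) * (C powr (p - 1) * ?m powr (2 * \<alpha>)) = C powr (p - 1)"
        using m by (simp add: powr_minus)
      then show ?thesis by (simp add: ennreal_mult[symmetric])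
    qed
    finally show ?thesis .
  qed
  then show ?thesis
    unfolding Ap_weight_def using C weight_nonneg by (auto intro!: exI[of _ "C powr (p - 1)"])
qed

subsection \<open>The Poincare inequality\<close>

text \<open>
  Hoelder's inequality for \<open>g = (g * w powr (1 / p)) * w powr (- 1 / p)\<close>, stated with a bound \<open>a\<close> so
  that it follows by integrating a pointwise estimate of \<open>g\<close> by a sum of two terms.
\<close>

lemma Ap_weight_Hoelder:
  fixes w :: "'a::euclidean_space \<Rightarrow> real"
  assumes Ap: "Ap_weight p w" and p: "1 < p" and dbl: "doubling (weighted w)"
  obtains C where "0 < C" "\<And>x R g a. 0 < R \<Longrightarrow> g \<in> borel_measurable borel \<Longrightarrow> 0 < a \<Longrightarrow>
    (\<integral>\<^sup>+y\<in>ball x R. ennpowr (g y) p \<partial>weighted w)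
      \<le> ennreal (a powr p) * emeasure (weighted w) (ball x R) \<Longrightarrow>
    (\<integral>\<^sup>+y\<in>ball x R. g y \<partial>lborel) \<le> ennreal (C * a) * emeasure lborel (ball x R)"
proof -
  let ?M = "weighted w"
  have [measurable]: "w \<in> borel_measurable borel" and w0: "\<And>x. 0 \<le> w x" using Ap by (auto simp: Ap_weight_def)
  obtain A where A: "0 < A" "\<And>x r. 0 < r \<Longrightarrow> nn_mean lborel (ball x r) (\<lambda>y. ennreal (w y)) *
        ennpowr (nn_mean lborel (ball x r) (\<lambda>y. ennpowr (ennreal (w y)) (1 / (1 - p)))) (p - 1)
          \<le> ennreal A"
    using Ap by (auto simp: Ap_weight_def)
  define e where "e = 1 / (p - 1)"
  have e: "0 < e" "1 / (1 - p) = - e" using p by (auto simp: e_def field_simps)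
  \<comment> \<open>\<open>A powr e\<close> will come from the dual weight term of
    \<open>pw\<close>, and 1 from its energy term.\<close>
  define C where "C = A powr e + 1"
  show ?thesis
  proof (rule that[of C])
    show "0 < C" by (simp add: C_def add_nonneg_pos)
    fix x :: 'a and R :: real and g :: "'a \<Rightarrow> ennreal" and a :: real
    assume R: "0 < R" and [measurable]: "g \<in> borel_measurable borel" and a: "0 < a"
      and gp: "(\<integral>\<^sup>+y\<in>ball x R. ennpowr (g y) p \<partial>?M) \<le> ennreal (a powr p) * emeasure ?M (ball x R)"
    let ?\<sigma> = "\<lambda>y. ennpowr (ennreal (w y)) (- e)"
    have [measurable]: "ball x R \<in> sets borel" by simp
    obtain \<beta> where \<beta>: "0 < \<beta>" "emeasure lborel (ball x R) = ennreal \<beta>"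
      using emeasure_lborel_ball_pos[OF R, of x] by (cases "emeasure lborel (ball x R)") auto
    have "0 < emeasure ?M (ball x R)" "emeasure ?M (ball x R) < \<infinity>" using dbl R by (auto simp: doubling_def)
    then obtain m where m: "0 < m" "emeasure ?M (ball x R) = ennreal m"
      by (cases "emeasure ?M (ball x R)") auto
    define W where "W = m / \<beta>"
    have W: "0 < W" using m \<beta> by (simp add: W_def)
    have "nn_mean lborel (ball x R) (\<lambda>y. ennreal (w y)) = emeasure ?M (ball x R) / emeasure lborel (ball x R)"
      unfolding nn_mean_def by (simp add: emeasure_density)
    also have "\<dots> = ennreal W" using m \<beta> by (simp add: W_def divide_ennreal)
    finally have Wm: "nn_mean lborel (ball x R) (\<lambda>y. ennreal (w y)) = ennreal W" .
    let ?N = "nn_mean lborel (ball x R) ?\<sigma>"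
    have "ennreal W * ennpowr ?N (p - 1) \<le> ennreal A" using A(2)[OF R, of x] by (simp only: Wm e)
    then have "ennreal (1 / W) * (ennreal W * ennpowr ?N (p - 1)) \<le> ennreal (1 / W) * ennreal A"
      by (rule mult_left_mono) simp
    then have "ennpowr ?N (p - 1) \<le> ennreal (A / W)"
      using W A by (simp add: mult.assoc[symmetric] ennreal_mult[symmetric])
    then have "?N \<le> ennpowr (ennreal (A / W)) (1 / (p - 1))"
      using p by (subst (asm) ennpowr_le_iff) auto
    also have "\<dots> = ennreal ((A / W) powr e)" using A W p by (simp add: ennpowr_ennreal e_def)
    finally have "?N \<le> ennreal ((A / W) powr e)" .
    moreover have "(\<integral>\<^sup>+y\<in>ball x R. ?\<sigma> y \<partial>lborel) = ?N * ennreal \<beta>"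
      using \<beta> by (simp add: nn_mean_def ennreal_divide_times ennreal_divide_self mult_divide_eq_ennreal)
    ultimately have \<sigma>: "(\<integral>\<^sup>+y\<in>ball x R. ?\<sigma> y \<partial>lborel) \<le> ennreal ((A / W) powr e) * ennreal \<beta>"
      by (simp add: mult_right_mono)
    \<comment> \<open>A crude form of Young's inequality. Up to the threshold
      \<open>a * W powr e * w y powr (- e)\<close> the first summand suffices. Above it
      \<open>g powr (p - 1)\<close> exceeds \<open>a powr (p - 1) * W / w y\<close>, because e (p -
      1) = 1, and the second summand takes over. With \<open>W\<close> the mean of w, both terms
      integrate to multiples of \<open>a * \<beta>\<close>.\<close>
    have pw: "g y \<le> ennreal (a * W powr e) * ?\<sigma> y + ennreal (a powr (1 - p) / W) * (ennpowr (g y) p * ennreal (w y))" for y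
    proof (cases "w y = 0")
      case True
      then have "?\<sigma> y = \<infinity>" using e by (simp add: ennpowr_def)
      then show ?thesis using a W by (simp add: ennreal_mult_top)
    next
      case False
      then have wy: "0 < w y" using w0[of y] by simp
      show ?thesis
      proof (cases "g y")
        case (real t)
        show ?thesis
        proof (cases "t \<le> a * W powr e * w y powr (- e)")
          case True
          then have "g y \<le> ennreal (a * W powr e) * ?\<sigma> y"
            using real a wy by (simp add: ennpowr_ennreal ennreal_mult[symmetric] ennreal_leI)
          then show ?thesis by (rule add_increasing2[rotated]) simp
        next
          case False
          then have t: "0 < t" using a by (metis less_le_trans mult_nonneg_nonneg not_le powr_ge_zero less_imp_le)
          have "(a * W powr e * w y powr (- e)) powr (p - 1) \<le> t powr (p - 1)"
            using False a p by (intro powr_mono2) auto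
          moreover have "(a * W powr e * w y powr (- e)) powr (p - 1) = a powr (p - 1) * W / w y"
          proof -
            have "e * (p - 1) = 1" "- e * (p - 1) = - 1" using p by (auto simp: e_def)
            then show ?thesis using W wy by (simp only: powr_mult powr_powr) (simp add: powr_minus_divide)
          qed
          ultimately have "a powr (p - 1) * W / w y \<le> t powr (p - 1)" by simp
          then have "a powr (p - 1) * W \<le> t powr (p - 1) * w y" using wy by (simp only: pos_divide_le_eq)
          then have "t * (a powr (p - 1) * W) \<le> t * (t powr (p - 1) * w y)" using t by (intro mult_left_mono) auto
          also have "\<dots> = t powr p * w y" using t by (simp add: powr_diff)
          finally have "t \<le> t powr p * w y / (a powr (p - 1) * W)" using a W by (simp add: pos_le_divide_eq)
          also have "\<dots> = a powr (1 - p) / W * (t powr p * w y)"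
            using a by (simp add: powr_diff)
          finally have "ennreal t \<le> ennreal (a powr (1 - p) / W * (t powr p * w y))" by (rule ennreal_leI)
          then have "g y \<le> ennreal (a powr (1 - p) / W) * (ennpowr (g y) p * ennreal (w y))"
            using real t a W wy by (simp add: ennpowr_ennreal ennreal_mult[symmetric])
          then show ?thesis by (rule add_increasing[rotated]) simp
        qed
      next
        case top
        then show ?thesis using wy p a W by (simp add: ennreal_mult_top ennreal_top_mult)
      qed
    qed
    have "(\<integral>\<^sup>+y\<in>ball x R. g y \<partial>lborel) \<le> (\<integral>\<^sup>+y. ennreal (a * W powr e) * (?\<sigma> y * indicator (ball x R) y)
        + ennreal (a powr (1 - p) / W) * (ennreal (w y) * (ennpowr (g y) p * indicator (ball x R) y)) \<partial>lborel)"
      using pw by (intro nn_integral_mono) (auto simp: mult_ac split: split_indicator)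
    also have "\<dots> = ennreal (a * W powr e) * (\<integral>\<^sup>+y\<in>ball x R. ?\<sigma> y \<partial>lborel)
        + ennreal (a powr (1 - p) / W) * (\<integral>\<^sup>+y\<in>ball x R. ennpowr (g y) p \<partial>?M)"
      by (subst nn_integral_add) (auto simp: nn_integral_cmult nn_integral_density)
    also have "\<dots> \<le> ennreal (a * W powr e) * (ennreal ((A / W) powr e) * ennreal \<beta>)
        + ennreal (a powr (1 - p) / W) * (ennreal (a powr p) * ennreal m)"
      using \<sigma> gp m by (intro add_mono mult_left_mono) auto
    also have "\<dots> = ennreal (a * W powr e * ((A / W) powr e * \<beta>) + a powr (1 - p) / W * (a powr p * m))"
      using a W m \<beta> by (simp add: ennreal_mult[symmetric] ennreal_plus[symmetric] del: ennreal_plus)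
    also have "a * W powr e * ((A / W) powr e * \<beta>) + a powr (1 - p) / W * (a powr p * m) = C * a * \<beta>"
    proof -
      have "W powr e * (A / W) powr e = A powr e" using W by (simp add: powr_mult[symmetric])
      moreover have "a powr (1 - p) * a powr p = a" using a by (simp add: powr_add[symmetric])
      moreover have "m / W = \<beta>" using m \<beta> by (simp add: W_def)
      moreover have "a * W powr e * ((A / W) powr e * \<beta>) + a powr (1 - p) / W * (a powr p * m)
          = a * (W powr e * (A / W) powr e) * \<beta> + (a powr (1 - p) * a powr p) * (m / W)"
        by simp
      ultimately show ?thesis by (simp add: C_def algebra_simps)
    qed
    also have "ennreal (C * a * \<beta>) = ennreal (C * a) * emeasure lborel (ball x R)"
      using a \<beta> \<open>0 < C\<close> by (simp add: ennreal_mult)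
    finally show "(\<integral>\<^sup>+y\<in>ball x R. g y \<partial>lborel) \<le> ennreal (C * a) * emeasure lborel (ball x R)" .
  qed
qed

section \<open>Segments and the unweighted Poincare inequality\<close>

lemma nn_integral_affine_le:
  fixes F :: "'a::euclidean_space \<Rightarrow> ennreal"
  assumes [measurable]: "F \<in> borel_measurable borel" and c: "1 / 2 \<le> c"
  shows "(\<integral>\<^sup>+y. F (v + c *\<^sub>R y) \<partial>lborel) \<le> ennreal (2 ^ DIM('a)) * (\<integral>\<^sup>+y. F y \<partial>lborel)"
proof -
  have c0: "c \<noteq> 0" "0 < c" using c by auto
  have eq: "(\<integral>\<^sup>+y. F y \<partial>lborel) = ennreal (c ^ DIM('a)) * (\<integral>\<^sup>+y. F (v + c *\<^sub>R y) \<partial>lborel)"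
    using c0 by (subst lborel_affine[OF c0(1), of v])
      (simp add: nn_integral_density nn_integral_distr nn_integral_cmult)
  have "(1 / 2) ^ DIM('a) \<le> c ^ DIM('a)" using c by (intro power_mono) auto
  then have "1 \<le> 2 ^ DIM('a) * c ^ DIM('a)" by (simp add: power_divide field_simps)
  then have "ennreal 1 \<le> ennreal (2 ^ DIM('a) * c ^ DIM('a))" by (rule ennreal_leI)
  then have "1 * (\<integral>\<^sup>+y. F (v + c *\<^sub>R y) \<partial>lborel)
      \<le> ennreal (2 ^ DIM('a) * c ^ DIM('a)) * (\<integral>\<^sup>+y. F (v + c *\<^sub>R y) \<partial>lborel)"
    by (intro mult_right_mono) auto
  then show ?thesis using c0 by (simp add: eq ennreal_mult mult.assoc)
qed

lemma segment_ac_curve: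
  fixes y h :: "'a::real_normed_vector"
  shows "speed_bound (0, 1, \<lambda>t. y + t *\<^sub>R h) (\<lambda>_. norm h)"
    and "(0, 1, \<lambda>t. y + t *\<^sub>R h) \<in> ac_curves"
proof -
  show sb: "speed_bound (0, 1, \<lambda>t. y + t *\<^sub>R h) (\<lambda>_. norm h)"
    unfolding speed_bound_def prod.case
  proof (intro conjI allI impI)
    have "emeasure lebesgue {0..1::real} < \<infinity>" by simp
    then have "integrable lebesgue (indicat_real {0..1::real})" by (intro integrable_real_indicator) auto
    then show "set_integrable lebesgue {0..1::real} (\<lambda>_. norm h)" by (simp add: set_integrable_def)
    fix s t :: real assume st: "0 \<le> s \<and> s < t \<and> t \<le> 1"
    have "(y + s *\<^sub>R h) - (y + t *\<^sub>R h) = (s - t) *\<^sub>R h" by (simp add: algebra_simps)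
    then have "dist (y + s *\<^sub>R h) (y + t *\<^sub>R h) = (t - s) * norm h"
      using st by (simp add: dist_norm)
    then show "dist (y + s *\<^sub>R h) (y + t *\<^sub>R h) \<le> set_lebesgue_integral lebesgue {s..t} (\<lambda>_. norm h)"
      using st by (simp add: set_lebesgue_integral_def)
  qed
  have "continuous_on {0..1} (\<lambda>t. y + t *\<^sub>R h)" by (intro continuous_intros)
  then show "(0, 1, \<lambda>t. y + t *\<^sub>R h) \<in> ac_curves" using sb by (auto simp: ac_curves_def)
qed

text \<open>The constant \<open>norm h\<close> is a speed bound, and the metric speed is minimal.
  This direction suffices, since curve integrals over segments are only estimated from
  above.\<close>

lemma curve_integral_segment_le:
  fixes y h :: "'a::real_normed_vector"
  shows "curve_integral (0, 1, \<lambda>t. y + t *\<^sub>R h) u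
    \<le> (\<integral>\<^sup>+t\<in>{0..1}. u (y + t *\<^sub>R h) * ennreal (norm h) \<partial>lborel)"
proof -
  let ?c = "(0, 1, \<lambda>t. y + t *\<^sub>R h)"
  have "AE t in lebesgue. t \<in> {0..1} \<longrightarrow> metric_speed ?c t \<le> norm h"
    by (rule metric_speed(2)[OF segment_ac_curve(2) segment_ac_curve(1)])
  then have "curve_integral ?c u \<le> (\<integral>\<^sup>+t\<in>{0..1}. u (y + t *\<^sub>R h) * ennreal (norm h) \<partial>lebesgue)"
    unfolding curve_integral_def prod.case
    by (intro nn_integral_mono_AE, eventually_elim) (auto intro!: mult_left_mono ennreal_leI split: split_indicator)
  then show ?thesis by (simp add: nn_integral_completion)
qed

lemma segment_upper_gradient:
  fixes f :: "'a::real_normed_vector \<Rightarrow> real"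
  assumes f: "L-lipschitz_on UNIV f"
  shows "ennreal \<bar>f z - f y\<bar> \<le> (\<integral>\<^sup>+t\<in>{0..1}. slope f (y + t *\<^sub>R (z - y)) * ennreal (dist y z) \<partial>lborel)"
  using order_trans[OF curve_integral_slope[OF segment_ac_curve(2) f] curve_integral_segment_le, of y "z - y"]
  by (simp add: dist_norm norm_minus_commute)

text \<open>
  For \<open>t \<ge> 1 / 2\<close> the substitution of \<open>y + t * (z - y)\<close> is made in \<open>z\<close>, otherwise in \<open>y\<close>; this keeps
  its Jacobian above \<open>2 powr (- n)\<close>.
\<close>

lemma double_average_le:
  fixes f :: "'a::euclidean_space \<Rightarrow> real"
  assumes f: "L-lipschitz_on UNIV f" and R: "0 < R"
  shows "(\<integral>\<^sup>+y\<in>ball x R. (\<integral>\<^sup>+z\<in>ball x R. ennreal \<bar>f y - f z\<bar> \<partial>lborel) \<partial>lborel)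
    \<le> ennreal (2 * R * 2 ^ DIM('a)) * emeasure lborel (ball x R) * (\<integral>\<^sup>+y\<in>ball x R. slope f y \<partial>lborel)"
proof -
  let ?B = "ball x R"
  define F where "F y = slope f y * indicator ?B y" for y
  have [measurable]: "slope f \<in> borel_measurable borel"
    unfolding slope_eq_pointwise_lip using f by (intro pointwise_lip_measurable lipschitz_on_continuous_on)
  have [measurable]: "?B \<in> sets borel" by simp
  have [measurable]: "F \<in> borel_measurable borel" unfolding F_def by measurable
  let ?I = "\<integral>\<^sup>+y. F y \<partial>lborel"
  let ?h = "\<lambda>y z t. F (y + t *\<^sub>R (z - y)) * indicator {0..1::real} t * indicator ?B z * indicator ?B y"
  have pw: "ennreal \<bar>f y - f z\<bar> * indicator ?B z * indicator ?B y
      \<le> ennreal (2 * R) * (\<integral>\<^sup>+t. ?h y z t \<partial>lborel)" for y z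
  proof (cases "y \<in> ?B \<and> z \<in> ?B")
    case True
    have d: "dist y z \<le> 2 * R" using True dist_triangle2[of y z x] by (simp add: dist_commute)
    have "ennreal \<bar>f y - f z\<bar> = ennreal \<bar>f z - f y\<bar>" by (simp add: abs_minus_commute)
    also have "\<dots> \<le> (\<integral>\<^sup>+t\<in>{0..1}. slope f (y + t *\<^sub>R (z - y)) * ennreal (dist y z) \<partial>lborel)"
      by (rule segment_upper_gradient[OF f])
    also have "\<dots> \<le> (\<integral>\<^sup>+t. ennreal (2 * R) * ?h y z t \<partial>lborel)"
    proof (rule nn_integral_mono)
      fix t :: real
      show "slope f (y + t *\<^sub>R (z - y)) * ennreal (dist y z) * indicator {0..1} t \<le> ennreal (2 * R) * ?h y z t"
      proof (cases "t \<in> {0..1}")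
        case t: True
        have "(1 - t) *\<^sub>R y + t *\<^sub>R z \<in> ?B"
          using True t by (intro convexD convex_ball) auto
        then have "y + t *\<^sub>R (z - y) \<in> ?B" by (simp add: algebra_simps)
        then have "F (y + t *\<^sub>R (z - y)) = slope f (y + t *\<^sub>R (z - y))" by (simp add: F_def)
        then show ?thesis
          using True t mult_right_mono[OF ennreal_leI[OF d], of "slope f (y + t *\<^sub>R (z - y))"]
          by (simp add: mult.commute)
      qed simp
    qed
    also have "\<dots> = ennreal (2 * R) * (\<integral>\<^sup>+t. ?h y z t \<partial>lborel)"
      by (rule nn_integral_cmult) measurable
    finally show ?thesis using True by simp
  qed auto
  have inner: "(\<integral>\<^sup>+y. (\<integral>\<^sup>+z. ?h y z t \<partial>lborel) \<partial>lborel)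
      \<le> ennreal (2 ^ DIM('a)) * ?I * emeasure lborel ?B * indicator {0..1} t" for t
  proof (cases "t \<in> {0..1}")
    case t: True
    show ?thesis
    proof (cases "1 / 2 \<le> t")
      case True
      have "(\<integral>\<^sup>+y. (\<integral>\<^sup>+z. ?h y z t \<partial>lborel) \<partial>lborel)
          \<le> (\<integral>\<^sup>+y. ennreal (2 ^ DIM('a)) * ?I * indicator ?B y \<partial>lborel)"
      proof (rule nn_integral_mono)
        fix y
        have "(\<integral>\<^sup>+z. ?h y z t \<partial>lborel) \<le> (\<integral>\<^sup>+z. F ((1 - t) *\<^sub>R y + t *\<^sub>R z) \<partial>lborel)"
          by (intro nn_integral_mono) (auto simp: algebra_simps split: split_indicator)
        also have "\<dots> \<le> ennreal (2 ^ DIM('a)) * ?I"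
          using True by (intro nn_integral_affine_le) auto
        finally show "(\<integral>\<^sup>+z. ?h y z t \<partial>lborel) \<le> ennreal (2 ^ DIM('a)) * ?I * indicator ?B y"
          by (auto split: split_indicator)
      qed
      also have "\<dots> = ennreal (2 ^ DIM('a)) * ?I * emeasure lborel ?B"
        by (rule nn_integral_cmult_indicator) simp
      finally show ?thesis using t by simp
    next
      case False
      have "(\<integral>\<^sup>+y. (\<integral>\<^sup>+z. ?h y z t \<partial>lborel) \<partial>lborel) = (\<integral>\<^sup>+z. (\<integral>\<^sup>+y. ?h y z t \<partial>lborel) \<partial>lborel)"
        by (rule lborel_pair.Fubini'[symmetric]) measurable
      also have "\<dots> \<le> (\<integral>\<^sup>+z. ennreal (2 ^ DIM('a)) * ?I * indicator ?B z \<partial>lborel)"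
      proof (rule nn_integral_mono)
        fix z
        have "(\<integral>\<^sup>+y. ?h y z t \<partial>lborel) \<le> (\<integral>\<^sup>+y. F (t *\<^sub>R z + (1 - t) *\<^sub>R y) \<partial>lborel)"
          by (intro nn_integral_mono) (auto simp: algebra_simps split: split_indicator)
        also have "\<dots> \<le> ennreal (2 ^ DIM('a)) * ?I"
          using False by (intro nn_integral_affine_le) auto
        finally show "(\<integral>\<^sup>+y. ?h y z t \<partial>lborel) \<le> ennreal (2 ^ DIM('a)) * ?I * indicator ?B z"
          by (auto split: split_indicator)
      qed
      also have "\<dots> = ennreal (2 ^ DIM('a)) * ?I * emeasure lborel ?B"
        by (rule nn_integral_cmult_indicator) simp
      finally show ?thesis using t by simp
    qed
  qed simp
  have "(\<integral>\<^sup>+y\<in>?B. (\<integral>\<^sup>+z\<in>?B. ennreal \<bar>f y - f z\<bar> \<partial>lborel) \<partial>lborel)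
      \<le> (\<integral>\<^sup>+y. (\<integral>\<^sup>+z. ennreal (2 * R) * (\<integral>\<^sup>+t. ?h y z t \<partial>lborel) \<partial>lborel) \<partial>lborel)"
  proof (rule nn_integral_mono)
    fix y
    have "(\<integral>\<^sup>+z\<in>?B. ennreal \<bar>f y - f z\<bar> \<partial>lborel) * indicator ?B y
        \<le> (\<integral>\<^sup>+z. ennreal \<bar>f y - f z\<bar> * indicator ?B z * indicator ?B y \<partial>lborel)"
      by (auto split: split_indicator)
    also have "\<dots> \<le> (\<integral>\<^sup>+z. ennreal (2 * R) * (\<integral>\<^sup>+t. ?h y z t \<partial>lborel) \<partial>lborel)"
      by (rule nn_integral_mono[OF pw])
    finally show "(\<integral>\<^sup>+z\<in>?B. ennreal \<bar>f y - f z\<bar> \<partial>lborel) * indicator ?B y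
        \<le> (\<integral>\<^sup>+z. ennreal (2 * R) * (\<integral>\<^sup>+t. ?h y z t \<partial>lborel) \<partial>lborel)" .
  qed
  also have "\<dots> = ennreal (2 * R) * (\<integral>\<^sup>+y. (\<integral>\<^sup>+z. (\<integral>\<^sup>+t. ?h y z t \<partial>lborel) \<partial>lborel) \<partial>lborel)"
    by (simp add: nn_integral_cmult)
  also have "(\<integral>\<^sup>+y. (\<integral>\<^sup>+z. (\<integral>\<^sup>+t. ?h y z t \<partial>lborel) \<partial>lborel) \<partial>lborel)
      = (\<integral>\<^sup>+y. (\<integral>\<^sup>+t. (\<integral>\<^sup>+z. ?h y z t \<partial>lborel) \<partial>lborel) \<partial>lborel)"
    by (intro nn_integral_cong lborel_pair.Fubini'[symmetric]) measurable
  also have "\<dots> = (\<integral>\<^sup>+t. (\<integral>\<^sup>+y. (\<integral>\<^sup>+z. ?h y z t \<partial>lborel) \<partial>lborel) \<partial>lborel)"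
    by (rule lborel_pair.Fubini'[symmetric]) measurable
  also have "\<dots> \<le> (\<integral>\<^sup>+t. ennreal (2 ^ DIM('a)) * ?I * emeasure lborel ?B * indicator {0..1::real} t \<partial>lborel)"
    by (rule nn_integral_mono[OF inner])
  also have "\<dots> = ennreal (2 ^ DIM('a)) * ?I * emeasure lborel ?B"
    by (subst nn_integral_cmult_indicator) auto
  finally have "(\<integral>\<^sup>+y\<in>?B. (\<integral>\<^sup>+z\<in>?B. ennreal \<bar>f y - f z\<bar> \<partial>lborel) \<partial>lborel)
      \<le> ennreal (2 * R) * (ennreal (2 ^ DIM('a)) * ?I * emeasure lborel ?B)"
    by (simp add: mult_left_mono)
  also have "\<dots> = ennreal (2 * R * 2 ^ DIM('a)) * emeasure lborel ?B * ?I"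
    using R by (simp add: ennreal_mult mult_ac)
  finally show ?thesis by (simp add: F_def)
qed

text \<open>Compactness of the smaller closed ball. The notion \<open>local_lipschitz\<close>
  carries a time parameter, for which the one-point set \<open>{0}\<close> is taken.\<close>

lemma locally_lipschitz_cball:
  fixes f :: "'a::euclidean_space \<Rightarrow> real"
  assumes f: "locally_lipschitz_on (ball x R) f" and r: "r < R"
  obtains L where "L-lipschitz_on (cball x r) f"
proof -
  have sub: "cball x r \<subseteq> ball x R" using r by auto
  have "local_lipschitz {0::real} (cball x r) (\<lambda>_. f)"
    unfolding local_lipschitz_def
  proof (intro ballI)
    fix y t assume "y \<in> cball x r"
    then have "y \<in> ball x R" using sub by blast
    then obtain \<rho> L where \<rho>: "0 < \<rho>" "L-lipschitz_on (ball x R \<inter> ball y \<rho>) f"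
      using f unfolding locally_lipschitz_on_def by blast
    have "L-lipschitz_on (cball y (\<rho> / 2) \<inter> cball x r) f"
      using \<rho> sub by (intro lipschitz_on_subset[OF \<rho>(2)]) auto
    then show "\<exists>u>0. \<exists>L. \<forall>s\<in>cball t u \<inter> {0}. L-lipschitz_on (cball y u \<inter> cball x r) f"
      using \<rho> by (intro exI[of _ "\<rho> / 2"]) auto
  qed
  then obtain L where "\<And>t. t \<in> {0::real} \<Longrightarrow> L-lipschitz_on (cball x r) f"
    by (rule local_lipschitz_compact_implies_lipschitz) auto
  then show ?thesis using that by blast
qed

lemma ennreal_le_of_le_mult_add:
  assumes "\<And>e. 0 < e \<Longrightarrow> X \<le> ennreal (Q * (a + e))" and "0 \<le> Q" "0 \<le> a"
  shows "X \<le> ennreal (Q * a)"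
proof (cases "Q = 0")
  case False
  then have Q: "0 < Q" using assms by simp
  show ?thesis
  proof (rule ennreal_le_epsilon)
    fix e :: real assume "0 < e"
    then have "X \<le> ennreal (Q * (a + e / Q))" using assms(1)[of "e / Q"] Q by simp
    also have "Q * (a + e / Q) = Q * a + e" using Q by (simp add: field_simps)
    also have "ennreal \<dots> = ennreal (Q * a) + ennreal e" using assms \<open>0 < e\<close> by (intro ennreal_plus) auto
    finally show "X \<le> ennreal (Q * a) + ennreal e" .
  qed
qed (use assms(1)[of 1] in simp)

lemma abs_diff_mean_le:
  fixes f :: "'a \<Rightarrow> real"
  assumes f[measurable]: "f \<in> borel_measurable M" and A[measurable]: "A \<in> sets M"
    and fin: "emeasure M A < \<infinity>" and pos: "0 < emeasure M A"
    and bnd: "\<And>z. z \<in> A \<Longrightarrow> \<bar>f z\<bar> \<le> b"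
  shows "ennreal \<bar>c - mean M A f\<bar> * emeasure M A \<le> (\<integral>\<^sup>+z\<in>A. ennreal \<bar>c - f z\<bar> \<partial>M)"
proof -
  have m: "0 < measure M A" "emeasure M A = ennreal (measure M A)"
  proof -
    show m: "emeasure M A = ennreal (measure M A)" using fin by (simp add: emeasure_eq_ennreal_measure)
    show "0 < measure M A" using pos unfolding m by simp
  qed
  have ci: "integrable M (\<lambda>z. c * indicator A z)" for c :: real
    using fin by (intro integrable_mult_right integrable_real_indicator) auto
  have fi: "integrable M (\<lambda>z. indicator A z *\<^sub>R f z)"
    by (rule Bochner_Integration.integrable_bound[OF ci[of b]])
      (use bnd in \<open>auto intro!: AE_I2 order_trans[OF bnd] split: split_indicator\<close>)
  let ?g = "\<lambda>z. c * indicator A z - indicator A z *\<^sub>R f z"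
  have gi: "integrable M ?g" using ci fi by (rule Bochner_Integration.integrable_diff)
  have "integral\<^sup>L M ?g = c * measure M A - set_lebesgue_integral M A f"
    unfolding set_lebesgue_integral_def using ci fi by (subst Bochner_Integration.integral_diff) auto
  also have "\<dots> = (c - mean M A f) * measure M A"
    using m by (simp add: mean_def field_simps)
  finally have "\<bar>c - mean M A f\<bar> * measure M A = \<bar>integral\<^sup>L M ?g\<bar>" using m by (simp add: abs_mult)
  also have "\<dots> \<le> integral\<^sup>L M (\<lambda>z. \<bar>?g z\<bar>)" by (rule integral_abs_bound)
  finally have "ennreal (\<bar>c - mean M A f\<bar> * measure M A) \<le> ennreal (integral\<^sup>L M (\<lambda>z. \<bar>?g z\<bar>))"
    by (rule ennreal_leI)
  also have "\<dots> = (\<integral>\<^sup>+z. ennreal \<bar>?g z\<bar> \<partial>M)"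
    using gi by (intro nn_integral_eq_integral[symmetric]) auto
  also have "\<dots> = (\<integral>\<^sup>+z\<in>A. ennreal \<bar>c - f z\<bar> \<partial>M)"
    by (rule nn_integral_cong) (auto split: split_indicator)
  finally show ?thesis using m by (simp add: ennreal_mult)
qed

text \<open>In terms of means: passing from the weighted measure to Lebesgue measure costs at most
  the factor \<open>K\<close>. Products instead of quotients keep the inequality meaningful for
  infinite integrals.\<close>

lemma reverse_Hoelder_nn_integral:
  fixes w :: "'a::euclidean_space \<Rightarrow> real"
  assumes [measurable]: "w \<in> borel_measurable borel" "h \<in> borel_measurable borel"
    and K: "\<And>y. y \<in> ball x R \<Longrightarrow> ennreal (w y) * emeasure lborel (ball x R)
      \<le> ennreal K * emeasure (weighted w) (ball x R)"
  shows "(\<integral>\<^sup>+y\<in>ball x R. h y \<partial>weighted w) * emeasure lborel (ball x R)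
    \<le> ennreal K * emeasure (weighted w) (ball x R) * (\<integral>\<^sup>+y\<in>ball x R. h y \<partial>lborel)"
proof -
  let ?M = "weighted w"
  have [measurable]: "ball x R \<in> sets borel" by simp
  have "(\<integral>\<^sup>+y\<in>ball x R. h y \<partial>?M) * emeasure lborel (ball x R)
      = (\<integral>\<^sup>+y. ennreal (w y) * (h y * indicator (ball x R) y) * emeasure lborel (ball x R) \<partial>lborel)"
    by (simp add: nn_integral_density nn_integral_multc)
  also have "\<dots> \<le> (\<integral>\<^sup>+y. (ennreal K * emeasure ?M (ball x R)) * (h y * indicator (ball x R) y) \<partial>lborel)"
  proof (rule nn_integral_mono)
    fix y
    show "ennreal (w y) * (h y * indicator (ball x R) y) * emeasure lborel (ball x R)
      \<le> (ennreal K * emeasure ?M (ball x R)) * (h y * indicator (ball x R) y)"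
    proof (cases "y \<in> ball x R")
      case True
      have "ennreal (w y) * (h y * indicator (ball x R) y) * emeasure lborel (ball x R)
          = (ennreal (w y) * emeasure lborel (ball x R)) * (h y * indicator (ball x R) y)"
        by (simp only: mult_ac)
      also have "\<dots> \<le> (ennreal K * emeasure ?M (ball x R)) * (h y * indicator (ball x R) y)"
        using K[OF True] by (rule mult_right_mono) simp
      finally show ?thesis .
    qed simp
  qed
  also have "\<dots> = ennreal K * emeasure ?M (ball x R) * (\<integral>\<^sup>+y\<in>ball x R. h y \<partial>lborel)"
    by (rule nn_integral_cmult) measurable
  finally show ?thesis .
qed

text \<open>The mean oscillation is bounded by the double average of |h y - h z|, the weight is
  dropped in both variables by the reverse Hoelder bound, \<open>double_average_le\<close> brings in
  the slope, and the A_p Hoelder estimate returns to the weighted p-mean. The dilation 2 provides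
  room: f is only locally Lipschitz on an open ball, hence Lipschitz on a smaller closed
  one.\<close>

lemma weak_poincare_Ap:
  fixes w :: "'a::euclidean_space \<Rightarrow> real"
  assumes Ap: "Ap_weight p w" and p: "1 < p" and dbl: "doubling (weighted w)"
    and K0: "0 < K" and K: "\<And>x R y. 0 < R \<Longrightarrow> y \<in> ball x R \<Longrightarrow> ennreal (w y) * emeasure lborel (ball x R)
      \<le> ennreal K * emeasure (weighted w) (ball x R)"
  shows "weak_poincare p (weighted w)"
proof -
  let ?M = "weighted w"
  have [measurable]: "w \<in> borel_measurable borel" using Ap by (auto simp: Ap_weight_def)
  obtain C where C: "0 < C" and H: "\<And>x R g a. 0 < R \<Longrightarrow> g \<in> borel_measurable borel \<Longrightarrow> 0 < a \<Longrightarrow>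
    (\<integral>\<^sup>+y\<in>ball x R. ennpowr (g y) p \<partial>?M) \<le> ennreal (a powr p) * emeasure ?M (ball x R) \<Longrightarrow>
    (\<integral>\<^sup>+y\<in>ball x R. g y \<partial>lborel) \<le> ennreal (C * a) * emeasure lborel (ball x R)"
    using Ap_weight_Hoelder[OF Ap p dbl] by blast
  obtain D where D: "1 \<le> D" "\<And>x r. 0 < r \<Longrightarrow> emeasure ?M (ball x (2 * r)) \<le> ennreal D * emeasure ?M (ball x r)"
    and Mpos: "\<And>x r. 0 < r \<Longrightarrow> 0 < emeasure ?M (ball x r)" "\<And>x r. 0 < r \<Longrightarrow> emeasure ?M (ball x r) < \<infinity>"
    using dbl by (auto simp: doubling_def)
  \<comment> \<open>One factor \<open>K\<close> for each variable in which the weight is dropped,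
    \<open>2 * 2 ^ DIM('a)\<close> from \<open>double_average_le\<close>, and \<open>C\<close> from
    the Hoelder estimate. The factor \<open>D powr (1 / p)\<close> in \<open>CP\<close> pays for
    comparing the ball with its double.\<close>
  define Q where "Q = K * K * (2 * 2 ^ DIM('a)) * C"
  have Q: "0 < Q" using K0 C by (simp add: Q_def)
  define CP where "CP = Q * D powr (1 / p)"
  have CP: "0 < CP" using Q D by (simp add: CP_def)
  have main: "nn_mean ?M (ball x r) (\<lambda>y. ennreal \<bar>f y - mean ?M (ball x r) f\<bar>)
      \<le> ennreal (CP * r) * ennpowr (nn_mean ?M (ball x (2 * r)) (\<lambda>y. ennpowr (slope f y) p)) (1 / p)"
    if r: "0 < r" and f: "locally_lipschitz_on (ball x (2 * r)) f" for x r f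
  proof (cases "nn_mean ?M (ball x (2 * r)) (\<lambda>y. ennpowr (slope f y) p)")
    case top
    then show ?thesis using p CP r by (simp add: ennreal_mult_top)
  next
    case (real \<xi>)
    let ?B = "ball x r"
    have [measurable]: "?B \<in> sets borel" by simp
    obtain L where L: "L-lipschitz_on (cball x r) f"
      by (rule locally_lipschitz_cball[OF f, of r]) (use r in auto)
    \<comment> \<open>The projection onto the closed ball extends \<open>f\<close> to a Lipschitz function on the whole space.\<close>
    define h where "h = f \<circ> closest_point (cball x r)"
    have hf: "h y = f y" if "y \<in> cball x r" for y
      using that by (simp add: h_def closest_point_self)
    have hL: "L-lipschitz_on UNIV h"
    proof (rule lipschitz_onI)
      fix y z :: 'a
      have "dist (h y) (h z) \<le> L * dist (closest_point (cball x r) y) (closest_point (cball x r) z)"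
        unfolding h_def comp_def using r
        by (intro lipschitz_onD[OF L] closest_point_in_set) auto
      also have "\<dots> \<le> L * dist y z"
        using r lipschitz_on_nonneg[OF L] by (intro mult_left_mono closest_point_lipschitz) auto
      finally show "dist (h y) (h z) \<le> L * dist y z" .
    qed (rule lipschitz_on_nonneg[OF L])
    have hc: "continuous_on UNIV h" using hL by (rule lipschitz_on_continuous_on)
    have [measurable]: "h \<in> borel_measurable borel" using hc by (rule borel_measurable_continuous_onI)
    have [measurable]: "slope h \<in> borel_measurable borel"
      unfolding slope_eq_pointwise_lip using hc by (rule pointwise_lip_measurable)
    have slope: "slope h y = slope f y" if "y \<in> ?B" for y
      unfolding slope_eq_pointwise_lip using that
      by (intro pointwise_lip_cong[of ?B]) (auto simp: hf)
    have "bounded (h ` cball x r)"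
      by (intro compact_imp_bounded compact_continuous_image continuous_on_subset[OF hc]) auto
    then obtain bd where "\<forall>y\<in>h ` cball x r. norm y \<le> bd" unfolding bounded_iff by blast
    then have bd: "\<bar>h z\<bar> \<le> bd" if "z \<in> cball x r" for z using that by auto
    have mean: "mean ?M ?B f = mean ?M ?B h"
      unfolding mean_def by (intro arg_cong2[where f = "(/)"] set_lebesgue_integral_cong) (auto simp: hf)
    obtain m where m: "0 < m" "emeasure ?M ?B = ennreal m"
      using Mpos[OF r, of x] by (cases "emeasure ?M ?B") auto
    obtain \<beta> where \<beta>: "0 < \<beta>" "emeasure lborel ?B = ennreal \<beta>"
      using emeasure_lborel_ball_pos[OF r, of x] by (cases "emeasure lborel ?B") auto
    let ?I = "\<integral>\<^sup>+y\<in>?B. ennreal \<bar>h y - mean ?M ?B h\<bar> \<partial>?M"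
    let ?J = "\<lambda>N N'. \<integral>\<^sup>+y\<in>?B. (\<integral>\<^sup>+z\<in>?B. ennreal \<bar>h y - h z\<bar> \<partial>N) \<partial>N'"
    have rh: "(\<integral>\<^sup>+y\<in>?B. u y \<partial>?M) * ennreal \<beta> \<le> ennreal (K * m) * (\<integral>\<^sup>+y\<in>?B. u y \<partial>lborel)"
      if "u \<in> borel_measurable borel" for u
      using reverse_Hoelder_nn_integral[of w u x r K] that K[OF r, of _ x] m \<beta> K0
      by (simp add: ennreal_mult)
    have "?I * ennreal m = (\<integral>\<^sup>+y\<in>?B. ennreal \<bar>h y - mean ?M ?B h\<bar> * ennreal m \<partial>?M)"
      by (subst nn_integral_multc[symmetric]) (auto simp: mult_ac)
    also have "\<dots> \<le> ?J ?M ?M"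
    proof (intro nn_integral_mono mult_right_mono)
      fix y
      show "ennreal \<bar>h y - mean ?M ?B h\<bar> * ennreal m \<le> (\<integral>\<^sup>+z\<in>?B. ennreal \<bar>h y - h z\<bar> \<partial>?M)"
        using abs_diff_mean_le[of h ?M ?B bd "h y"] bd m by simp
    qed simp
    finally have 1: "?I * ennreal m \<le> ?J ?M ?M" .
    \<comment> \<open>The weight is removed from the outer integral first and then from the inner
      one, each time at the price of \<open>K * m\<close> against \<beta>.\<close>
    have "?J ?M ?M * ennreal \<beta> * ennreal \<beta> \<le> ennreal (K * m) * ?J ?M lborel * ennreal \<beta>"
      by (intro mult_right_mono rh) (auto simp: nn_integral_density)
    also have "\<dots> = ennreal (K * m) * (\<integral>\<^sup>+y\<in>?B. (\<integral>\<^sup>+z\<in>?B. ennreal \<bar>h y - h z\<bar> \<partial>?M) * ennreal \<beta> \<partial>lborel)"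
    proof -
      have "?J ?M lborel * ennreal \<beta>
          = (\<integral>\<^sup>+y\<in>?B. (\<integral>\<^sup>+z\<in>?B. ennreal \<bar>h y - h z\<bar> \<partial>?M) * ennreal \<beta> \<partial>lborel)"
        by (subst nn_integral_multc[symmetric]) (auto simp: nn_integral_density mult_ac)
      then show ?thesis by (simp add: mult.assoc)
    qed
    also have "\<dots> \<le> ennreal (K * m) * (\<integral>\<^sup>+y\<in>?B. ennreal (K * m) * (\<integral>\<^sup>+z\<in>?B. ennreal \<bar>h y - h z\<bar> \<partial>lborel) \<partial>lborel)"
      by (intro mult_left_mono nn_integral_mono mult_right_mono rh) auto
    also have "\<dots> = ennreal (K * m) * (ennreal (K * m) * ?J lborel lborel)"
      by (simp add: mult.assoc nn_integral_cmult)
    finally have 2: "?J ?M ?M * ennreal \<beta> * ennreal \<beta> \<le> ennreal (K * m) * (ennreal (K * m) * ?J lborel lborel)" .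
    have 3: "?J lborel lborel \<le> ennreal (2 * r * 2 ^ DIM('a)) * ennreal \<beta> * (\<integral>\<^sup>+y\<in>?B. slope h y \<partial>lborel)"
      using double_average_le[OF hL r, of x] \<beta> by simp
    have "nn_mean ?M ?B (\<lambda>y. ennreal \<bar>h y - mean ?M ?B h\<bar>) \<le> ennreal (Q * r * ((D * \<xi>) powr (1 / p)))"
    proof (rule ennreal_le_of_le_mult_add)
      fix e :: real assume e: "0 < e"
      \<comment> \<open>The Hoelder estimate needs a positive bound, but \<xi> may be 0; the summand
        e is removed by \<open>ennreal_le_of_le_mult_add\<close>.\<close>
      define a where "a = (D * \<xi>) powr (1 / p) + e"
      have a: "0 < a" using e by (simp add: a_def add_nonneg_pos)
      have "D * \<xi> \<le> a powr p"
      proof -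
        have "((D * \<xi>) powr (1 / p)) powr p \<le> a powr p"
          using e p by (intro powr_mono2) (auto simp: a_def)
        then show ?thesis using p D real by (simp add: powr_powr)
      qed
      have "(\<integral>\<^sup>+y\<in>?B. ennpowr (slope h y) p \<partial>?M) \<le> (\<integral>\<^sup>+y\<in>ball x (2 * r). ennpowr (slope f y) p \<partial>?M)"
        using slope r by (intro nn_integral_mono) (auto split: split_indicator)
      also have "\<dots> = ennreal \<xi> * emeasure ?M (ball x (2 * r))"
      proof -
        have "0 < emeasure ?M (ball x (2 * r))" "emeasure ?M (ball x (2 * r)) < \<infinity>"
          using Mpos[of "2 * r" x] r by auto
        then show ?thesis unfolding real(2)[symmetric]
          by (simp add: nn_mean_def ennreal_divide_times ennreal_divide_self)
      qed
      also have "\<dots> \<le> ennreal \<xi> * (ennreal D * emeasure ?M ?B)"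
        using D(2)[OF r] by (intro mult_left_mono) auto
      also have "\<dots> = ennreal (D * \<xi>) * emeasure ?M ?B"
        using D real by (simp add: ennreal_mult mult_ac)
      also have "\<dots> \<le> ennreal (a powr p) * emeasure ?M ?B"
        using \<open>D * \<xi> \<le> a powr p\<close> by (intro mult_right_mono ennreal_leI) auto
      finally have "(\<integral>\<^sup>+y\<in>?B. slope h y \<partial>lborel) \<le> ennreal (C * a) * ennreal \<beta>"
        using H[OF r _ a, of "slope h" x] \<beta> by simp
      then have 4: "?J lborel lborel \<le> ennreal (2 * r * 2 ^ DIM('a)) * ennreal \<beta> * (ennreal (C * a) * ennreal \<beta>)"
        by (intro order_trans[OF 3] mult_left_mono) auto
      have "?I * (ennreal m * ennreal \<beta> * ennreal \<beta>) \<le> ?J ?M ?M * ennreal \<beta> * ennreal \<beta>"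
        using mult_right_mono[OF 1, of "ennreal \<beta> * ennreal \<beta>"] by (simp add: mult_ac)
      also have "\<dots> \<le> ennreal (K * m) * (ennreal (K * m) * (ennreal (2 * r * 2 ^ DIM('a)) * ennreal \<beta> * (ennreal (C * a) * ennreal \<beta>)))"
        by (intro order_trans[OF 2] mult_left_mono 4) auto
      also have "\<dots> = ennreal (Q * r * a * m) * (ennreal m * ennreal \<beta> * ennreal \<beta>)"
      proof -
        have "K * m * (K * m * (2 * r * 2 ^ DIM('a) * \<beta> * (C * a * \<beta>))) = Q * r * a * m * (m * \<beta> * \<beta>)"
          by (simp add: Q_def)
        then show ?thesis
          using K0 m \<beta> r C a Q by (simp add: ennreal_mult[symmetric])
      qed
      finally have "?I \<le> ennreal (Q * r * a * m)"
        using m \<beta> by (subst (asm) (1 2) mult.commute, subst (asm) ennreal_mult_le_mult_iff)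
          (auto simp: ennreal_mult[symmetric])
      also have "\<dots> = ennreal (Q * r * a) * emeasure ?M ?B" using m Q r a by (simp add: ennreal_mult)
      finally show "nn_mean ?M ?B (\<lambda>y. ennreal \<bar>h y - mean ?M ?B h\<bar>) \<le> ennreal (Q * r * ((D * \<xi>) powr (1 / p) + e))"
        unfolding a_def using Mpos[OF r, of x] by (intro nn_mean_le) (auto simp: less_top)
    qed (use Q r in auto)
    also have "Q * r * ((D * \<xi>) powr (1 / p)) = CP * r * \<xi> powr (1 / p)"
      by (simp add: CP_def powr_mult)
    also have "ennreal \<dots> = ennreal (CP * r) * ennpowr (ennreal \<xi>) (1 / p)"
      using CP r p real by (simp add: ennpowr_ennreal ennreal_mult)
    finally have "nn_mean ?M ?B (\<lambda>y. ennreal \<bar>h y - mean ?M ?B h\<bar>) \<le> ennreal (CP * r) * ennpowr (ennreal \<xi>) (1 / p)" .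
    moreover have "nn_mean ?M ?B (\<lambda>y. ennreal \<bar>f y - mean ?M ?B f\<bar>) = nn_mean ?M ?B (\<lambda>y. ennreal \<bar>h y - mean ?M ?B h\<bar>)"
      unfolding mean nn_mean_def
      by (intro arg_cong2[where f = "(/)"] nn_integral_cong) (auto simp: hf split: split_indicator)
    ultimately show ?thesis by (simp add: real)
  qed
  show ?thesis
    unfolding weak_poincare_def
    by (intro exI[of _ CP] exI[of _ 2] conjI allI impI CP main) auto
qed

subsection \<open>Minimality of the slope\<close>

lemma nn_integral_segment_measurable [measurable]:
  fixes h :: "'a::euclidean_space"
  assumes [measurable]: "u \<in> borel_measurable borel"
  shows "(\<lambda>y. \<integral>\<^sup>+t\<in>{0..1}. u (y + t *\<^sub>R h) * ennreal c \<partial>lborel) \<in> borel_measurable borel"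
proof -
  have "(\<lambda>y. \<integral>\<^sup>+t\<in>{0..1}. u (y + t *\<^sub>R h) * ennreal c \<partial>lborel) \<in> borel_measurable lborel"
    by measurable
  then show ?thesis by simp
qed

text \<open>Fubini and translation of y by \<open>t *\<^sub>R h\<close>. The factor
  \<open>2 ^ DIM('a)\<close> only stems from using \<open>nn_integral_affine_le\<close> with c =
  1.\<close>

lemma nn_integral_segment_le:
  fixes h :: "'a::euclidean_space"
  assumes [measurable]: "u \<in> borel_measurable borel" "A \<in> sets borel" "B \<in> sets borel"
    and sub: "\<And>y t. y \<in> A \<Longrightarrow> 0 \<le> t \<Longrightarrow> t \<le> 1 \<Longrightarrow> y + t *\<^sub>R h \<in> B"
  shows "(\<integral>\<^sup>+y\<in>A. (\<integral>\<^sup>+t\<in>{0..1}. u (y + t *\<^sub>R h) * ennreal c \<partial>lborel) \<partial>lborel)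
    \<le> ennreal c * (ennreal (2 ^ DIM('a)) * (\<integral>\<^sup>+y\<in>B. u y \<partial>lborel))"
proof -
  define F where "F y = u y * indicator B y" for y
  have [measurable]: "F \<in> borel_measurable borel" unfolding F_def by measurable
  have "(\<integral>\<^sup>+y\<in>A. (\<integral>\<^sup>+t\<in>{0..1}. u (y + t *\<^sub>R h) * ennreal c \<partial>lborel) \<partial>lborel)
      \<le> (\<integral>\<^sup>+y. (\<integral>\<^sup>+t. ennreal c * (F (y + t *\<^sub>R h) * indicator {0..1} t) \<partial>lborel) \<partial>lborel)"
  proof (rule nn_integral_mono)
    fix y
    show "(\<integral>\<^sup>+t\<in>{0..1}. u (y + t *\<^sub>R h) * ennreal c \<partial>lborel) * indicator A y
        \<le> (\<integral>\<^sup>+t. ennreal c * (F (y + t *\<^sub>R h) * indicator {0..1} t) \<partial>lborel)"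
    proof (cases "y \<in> A")
      case True
      then have "(\<integral>\<^sup>+t\<in>{0..1}. u (y + t *\<^sub>R h) * ennreal c \<partial>lborel)
          \<le> (\<integral>\<^sup>+t. ennreal c * (F (y + t *\<^sub>R h) * indicator {0..1} t) \<partial>lborel)"
        using sub[OF True] by (intro nn_integral_mono) (auto simp: F_def mult_ac split: split_indicator)
      then show ?thesis using True by simp
    qed simp
  qed
  also have "\<dots> = (\<integral>\<^sup>+t. (\<integral>\<^sup>+y. ennreal c * (F (y + t *\<^sub>R h) * indicator {0..1} t) \<partial>lborel) \<partial>lborel)"
    by (rule lborel_pair.Fubini'[symmetric]) measurable
  also have "\<dots> \<le> (\<integral>\<^sup>+t. (ennreal c * (ennreal (2 ^ DIM('a)) * (\<integral>\<^sup>+y. F y \<partial>lborel))) * indicator {0..1::real} t \<partial>lborel)"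
  proof (rule nn_integral_mono)
    fix t :: real
    have "(\<integral>\<^sup>+y. F (y + t *\<^sub>R h) \<partial>lborel) \<le> ennreal (2 ^ DIM('a)) * (\<integral>\<^sup>+y. F y \<partial>lborel)"
      using nn_integral_affine_le[of F 1 "t *\<^sub>R h"] by (simp add: add.commute)
    then have "ennreal c * (\<integral>\<^sup>+y. F (y + t *\<^sub>R h) \<partial>lborel) \<le> ennreal c * (ennreal (2 ^ DIM('a)) * (\<integral>\<^sup>+y. F y \<partial>lborel))"
      by (rule mult_left_mono) simp
    then show "(\<integral>\<^sup>+y. ennreal c * (F (y + t *\<^sub>R h) * indicator {0..1} t) \<partial>lborel)
        \<le> (ennreal c * (ennreal (2 ^ DIM('a)) * (\<integral>\<^sup>+y. F y \<partial>lborel))) * indicator {0..1} t"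
      by (cases "t \<in> {0..1}") (auto simp: nn_integral_cmult)
  qed
  also have "\<dots> = ennreal c * (ennreal (2 ^ DIM('a)) * (\<integral>\<^sup>+y. F y \<partial>lborel))"
    by (subst nn_integral_cmult_indicator) auto
  finally show ?thesis by (simp add: F_def)
qed

text \<open>
  An admissible function of small energy for the exceptional curves has, by the Hoelder estimate, small
  Lebesgue integral, so by Markov's inequality few segments in direction \<open>h\<close> are exceptional.
\<close>

lemma AE_segment_upper_gradient:
  fixes w :: "'a::euclidean_space \<Rightarrow> real"
  assumes Ap: "Ap_weight p w" and p: "1 < p" and dbl: "doubling (weighted w)"
    and g: "upper_gradient p (weighted w) f g"
  shows "AE y in lborel. ennreal \<bar>f (y + h) - f y\<bar>
    \<le> (\<integral>\<^sup>+t\<in>{0..1}. g (y + t *\<^sub>R h) * ennreal (norm h) \<partial>lborel)"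
proof -
  let ?M = "weighted w"
  obtain C where C: "0 < C" and H: "\<And>x R g a. 0 < R \<Longrightarrow> g \<in> borel_measurable borel \<Longrightarrow> 0 < a \<Longrightarrow>
    (\<integral>\<^sup>+y\<in>ball x R. ennpowr (g y) p \<partial>?M) \<le> ennreal (a powr p) * emeasure ?M (ball x R) \<Longrightarrow>
    (\<integral>\<^sup>+y\<in>ball x R. g y \<partial>lborel) \<le> ennreal (C * a) * emeasure lborel (ball x R)"
    using Ap_weight_Hoelder[OF Ap p dbl] by blast
  let ?seg = "\<lambda>y. (0, 1, \<lambda>t. y + t *\<^sub>R h)"
  define Bad where "Bad = {y. \<not> ennreal \<bar>f (y + h) - f y\<bar> \<le> curve_integral (?seg y) g}"
  define E where "E = {c \<in> ac_curves. \<not> (case c of (a, b, \<gamma>) \<Rightarrow>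
      ennreal \<bar>f (\<gamma> b) - f (\<gamma> a)\<bar> \<le> curve_integral (a, b, \<gamma>) g)}"
  have E0: "modulus p ?M E = 0" using g by (simp add: upper_gradient_def ae_curve_def E_def)
  have BadE: "?seg y \<in> E" if "y \<in> Bad" for y
    using that segment_ac_curve(2)[of y h] by (simp add: Bad_def E_def)
  have "AE y in lborel. y \<notin> Bad \<inter> ball 0 (real (Suc N))" for N :: nat
  proof (rule AE_notin_if_outer_null)
    fix e :: real assume e: "0 < e"
    \<comment> \<open>This ball contains every segment in direction h that starts in the ball of
      radius N + 1.\<close>
    define R where "R = real (Suc N) + norm h"
    have R: "0 < R" by (simp add: R_def add_pos_nonneg)
    obtain \<beta> where \<beta>: "0 < \<beta>" "emeasure lborel (ball (0::'a) R) = ennreal \<beta>"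
      using emeasure_lborel_ball_pos[OF R, of "0::'a"] by (cases "emeasure lborel (ball (0::'a) R)") auto
    \<comment> \<open>Chosen so that an energy bound with a = e / Q yields a set of volume at most
      e. The summand 1 keeps Q positive for h = 0.\<close>
    define Q where "Q = (norm h + 1) * 2 ^ DIM('a) * C * \<beta>"
    have Q: "0 < Q" using C \<beta> by (simp add: Q_def add_nonneg_pos)
    define a where "a = e / Q"
    have a: "0 < a" using e Q by (simp add: a_def)
    have "0 < emeasure ?M (ball 0 R)" using dbl R by (auto simp: doubling_def)
    then have "0 < ennreal (a powr p) * emeasure ?M (ball 0 R)" using a by (simp add: ennreal_zero_less_mult_iff)
    from modulus_zeroD[OF E0 this] obtain \<rho> where [measurable]: "\<rho> \<in> borel_measurable borel"
      and \<rho>: "\<And>c. c \<in> E \<Longrightarrow> 1 \<le> curve_integral c \<rho>"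
      and \<rho>p: "(\<integral>\<^sup>+x. ennpowr (\<rho> x) p \<partial>?M) < ennreal (a powr p) * emeasure ?M (ball 0 R)" by metis
    define \<Phi> where "\<Phi> y = (\<integral>\<^sup>+t\<in>{0..1}. \<rho> (y + t *\<^sub>R h) * ennreal (norm h) \<partial>lborel)" for y
    have [measurable]: "\<Phi> \<in> borel_measurable borel" unfolding \<Phi>_def by measurable
    have [measurable]: "ball (0::'a) (real (Suc N)) \<in> sets borel" "ball (0::'a) R \<in> sets borel" by auto
    define T where "T = {y \<in> space borel. 1 \<le> \<Phi> y} \<inter> ball 0 (real (Suc N))"
    have T[measurable]: "T \<in> sets borel" unfolding T_def by measurable
    have sub: "Bad \<inter> ball 0 (real (Suc N)) \<subseteq> T"
    proof
      fix y assume y: "y \<in> Bad \<inter> ball 0 (real (Suc N))"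
      then have "1 \<le> curve_integral (?seg y) \<rho>" using \<rho> BadE by blast
      also have "\<dots> \<le> \<Phi> y" unfolding \<Phi>_def by (rule curve_integral_segment_le)
      finally show "y \<in> T" using y by (simp add: T_def)
    qed
    have "emeasure lborel T = (\<integral>\<^sup>+y. indicator T y \<partial>lborel)" by simp
    also have "\<dots> \<le> (\<integral>\<^sup>+y\<in>ball 0 (real (Suc N)). \<Phi> y \<partial>lborel)"
      by (intro nn_integral_mono) (auto simp: T_def split: split_indicator)
    also have "\<dots> \<le> ennreal (norm h) * (ennreal (2 ^ DIM('a)) * (\<integral>\<^sup>+y\<in>ball 0 R. \<rho> y \<partial>lborel))"
      unfolding \<Phi>_def
    proof (rule nn_integral_segment_le)
      fix y :: 'a and t :: real assume "y \<in> ball 0 (real (Suc N))" "0 \<le> t" "t \<le> 1"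
      then have "norm y < real (Suc N)" "norm (t *\<^sub>R h) \<le> norm h"
        by (auto simp: mult_left_le_one_le)
      then show "y + t *\<^sub>R h \<in> ball 0 R"
        using norm_triangle_ineq[of y "t *\<^sub>R h"] by (simp add: R_def)
    qed auto
    also have "\<dots> \<le> ennreal (norm h) * (ennreal (2 ^ DIM('a)) * (ennreal (C * a) * ennreal \<beta>))"
    proof (intro mult_left_mono)
      have "(\<integral>\<^sup>+y\<in>ball 0 R. ennpowr (\<rho> y) p \<partial>?M) \<le> (\<integral>\<^sup>+x. ennpowr (\<rho> x) p \<partial>?M)"
        by (intro nn_integral_mono) (auto split: split_indicator)
      also have "\<dots> \<le> ennreal (a powr p) * emeasure ?M (ball 0 R)" using \<rho>p by simp
      finally show "(\<integral>\<^sup>+y\<in>ball 0 R. \<rho> y \<partial>lborel) \<le> ennreal (C * a) * ennreal \<beta>"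
        using H[OF R _ a, of \<rho> 0] \<beta> by simp
    qed auto
    also have "\<dots> = ennreal (norm h * (2 ^ DIM('a) * (C * a * \<beta>)))"
      using C a \<beta> by (simp add: ennreal_mult[symmetric])
    also have "\<dots> \<le> ennreal e"
    proof (rule ennreal_leI)
      have "norm h * (2 ^ DIM('a) * (C * a * \<beta>)) \<le> (norm h + 1) * (2 ^ DIM('a) * (C * a * \<beta>))"
        using C a \<beta> by (intro mult_right_mono) auto
      also have "\<dots> = Q * a" by (simp add: Q_def)
      also have "\<dots> = e" using Q by (simp add: a_def)
      finally show "norm h * (2 ^ DIM('a) * (C * a * \<beta>)) \<le> e" .
    qed
    finally show "\<exists>T\<in>sets lebesgue. Bad \<inter> ball 0 (real (Suc N)) \<subseteq> T \<and> emeasure lebesgue T \<le> ennreal e"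
      using sub by (intro bexI[of _ T]) auto
  qed
  then have "AE y in lborel. \<forall>N::nat. y \<notin> Bad \<inter> ball 0 (real (Suc N))"
    unfolding AE_all_countable by blast
  then show ?thesis
  proof eventually_elim
    fix y :: 'a assume y: "\<forall>N::nat. y \<notin> Bad \<inter> ball 0 (real (Suc N))"
    obtain N :: nat where "norm y < N" using reals_Archimedean2 by blast
    then have "y \<in> ball 0 (real (Suc N))" by simp
    then have "y \<notin> Bad" using y by blast
    then have "ennreal \<bar>f (y + h) - f y\<bar> \<le> curve_integral (?seg y) g" by (simp add: Bad_def)
    also have "\<dots> \<le> (\<integral>\<^sup>+t\<in>{0..1}. g (y + t *\<^sub>R h) * ennreal (norm h) \<partial>lborel)"
      by (rule curve_integral_segment_le)
    finally show "ennreal \<bar>f (y + h) - f y\<bar> \<le> (\<integral>\<^sup>+t\<in>{0..1}. g (y + t *\<^sub>R h) * ennreal (norm h) \<partial>lborel)" .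
  qed
qed

text \<open>The null set of bad segments may depend on h: for each y near x the direction h = y - x
  is fixed, and only the starting point z is averaged. The point x itself enters through
  \<open>avg\<close> alone, which does not involve h, so one null set of points x serves all
  directions.\<close>

lemma slope_le_of_segments:
  fixes g :: "'a::euclidean_space \<Rightarrow> ennreal" and f :: "'a \<Rightarrow> real"
  assumes [measurable]: "g \<in> borel_measurable borel" and f: "L-lipschitz_on UNIV f"
    and seg: "\<And>h. AE y in lborel. ennreal \<bar>f (y + h) - f y\<bar>
      \<le> (\<integral>\<^sup>+t\<in>{0..1}. g (y + t *\<^sub>R h) * ennreal (norm h) \<partial>lborel)"
    and avg: "\<And>q. q \<in> \<rat> \<Longrightarrow> 0 \<le> q \<Longrightarrow> g x < ennreal q \<Longrightarrow> vanishing_averages (\<lambda>y. g y - ennreal q) x"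
  shows "slope f x \<le> g x"
proof (rule ennreal_le_rat_bounds)
  fix q e :: real assume q: "q \<in> \<rat>" "0 \<le> q" "g x < ennreal q" and e: "0 < e"
  let ?n = "DIM('a)"
  have L: "0 \<le> L" using f by (rule lipschitz_on_nonneg)
  \<comment> \<open>Replacing the segment from x to y by one from z to z + h moves both end points
    by at most \<delta> s, which costs 2 L \<delta> s \<le> (e / 2) s.\<close>
  define \<delta> where "\<delta> = min 1 (e / (4 * (L + 1)))"
  have \<delta>: "0 < \<delta>" "\<delta> \<le> 1" using e L by (auto simp: \<delta>_def)
  have L\<delta>: "2 * L * \<delta> \<le> e / 2"
  proof -
    have "2 * L * \<delta> \<le> 2 * (L + 1) * (e / (4 * (L + 1)))"
      using L \<delta> by (intro mult_mono) (auto simp: \<delta>_def)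
    also have "\<dots> = e / 2" using L by (simp add: field_simps)
    finally show ?thesis .
  qed
  \<comment> \<open>The power cancels two losses: the factor 2^n of
    \<open>nn_integral_segment_le\<close>, and the volume ratio (2 / \<delta>)^n of
    \<open>cball x (2 * s)\<close>, which contains all the segments, to the small ball of starting
    points.\<close>
  define \<eta> where "\<eta> = e / 2 * (\<delta> / 4) ^ ?n"
  have \<eta>: "0 < \<eta>" using e \<delta> by (simp add: \<eta>_def)
  obtain r0 where r0: "r0 > 0" "\<And>r. 0 < r \<Longrightarrow> r < r0 \<Longrightarrow>
        (\<integral>\<^sup>+y\<in>cball x r. g y - ennreal q \<partial>lborel) \<le> ennreal \<eta> * emeasure lborel (cball x r)"
    using avg[OF q, unfolded vanishing_averages_def, rule_format, OF \<eta>] by blast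
  show "slope f x \<le> ennreal (q + e)"
    unfolding slope_eq_pointwise_lip
  proof (rule pointwise_lip_leI)
    show "0 < r0 / 2" using r0 by simp
    fix y assume y: "dist y x < r0 / 2" "y \<noteq> x"
    define s where "s = dist y x"
    define h where "h = y - x"
    have s: "0 < s" "2 * s < r0" "norm h = s" using y by (auto simp: s_def h_def dist_norm)
    let ?B = "ball x (\<delta> * s)"
    have B0: "0 < \<delta> * s" using \<delta> s by simp
    obtain \<beta> where \<beta>: "0 < \<beta>" "emeasure lborel ?B = ennreal \<beta>"
      using emeasure_lborel_ball_pos[OF B0, of x] by (cases "emeasure lborel ?B") auto
    have [measurable]: "?B \<in> sets borel" "cball x (2 * s) \<in> sets borel" by auto
    define u where "u y = g y - ennreal q" for y
    have [measurable]: "u \<in> borel_measurable borel" unfolding u_def by measurable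
    have gu: "g z \<le> ennreal q + u z" for z
      unfolding u_def by (cases "ennreal q \<le> g z") (auto simp: add_diff_inverse_ennreal intro: add_increasing2)
    let ?U = "\<lambda>z. \<integral>\<^sup>+t\<in>{0..1}. u (z + t *\<^sub>R h) * ennreal s \<partial>lborel"
    have pw: "AE z in lborel. ennreal \<bar>f y - f x\<bar> * indicator ?B z
        \<le> ennreal (2 * L * (\<delta> * s) + q * s) * indicator ?B z + ?U z * indicator ?B z"
      using seg[of h]
    proof eventually_elim
      fix z assume z: "ennreal \<bar>f (z + h) - f z\<bar>
        \<le> (\<integral>\<^sup>+t\<in>{0..1}. g (z + t *\<^sub>R h) * ennreal (norm h) \<partial>lborel)"
      show "ennreal \<bar>f y - f x\<bar> * indicator ?B z
        \<le> ennreal (2 * L * (\<delta> * s) + q * s) * indicator ?B z + ?U z * indicator ?B z"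
      proof (cases "z \<in> ?B")
        case True
        then have d: "dist x z \<le> \<delta> * s" by simp
        have 1: "\<bar>f z - f x\<bar> \<le> L * (\<delta> * s)"
          using lipschitz_onD[OF f, of z x] d L by (simp add: dist_real_def dist_commute mult_left_mono order_trans)
        have "dist y (z + h) = dist x z" by (simp add: h_def dist_norm)
        then have 2: "\<bar>f y - f (z + h)\<bar> \<le> L * (\<delta> * s)"
          using lipschitz_onD[OF f, of y "z + h"] d L by (simp add: dist_real_def mult_left_mono order_trans)
        have "\<bar>f y - f x\<bar> \<le> 2 * L * (\<delta> * s) + \<bar>f (z + h) - f z\<bar>" using 1 2 by linarith
        then have "ennreal \<bar>f y - f x\<bar> \<le> ennreal (2 * L * (\<delta> * s) + \<bar>f (z + h) - f z\<bar>)" by (rule ennreal_leI)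
        also have "\<dots> = ennreal (2 * L * (\<delta> * s)) + ennreal \<bar>f (z + h) - f z\<bar>"
          using L \<delta> s by (intro ennreal_plus) auto
        also have "\<dots> \<le> ennreal (2 * L * (\<delta> * s)) + (\<integral>\<^sup>+t. ennreal (q * s) * indicator {0..1} t
            + u (z + t *\<^sub>R h) * ennreal s * indicator {0..1::real} t \<partial>lborel)"
        proof (rule add_left_mono, rule order_trans[OF z], rule nn_integral_mono)
          fix t :: real
          have "g (z + t *\<^sub>R h) * ennreal s \<le> (ennreal q + u (z + t *\<^sub>R h)) * ennreal s"
            by (rule mult_right_mono[OF gu]) simp
          also have "\<dots> = ennreal (q * s) + u (z + t *\<^sub>R h) * ennreal s"
            using q s by (simp add: distrib_right ennreal_mult)
          finally show "g (z + t *\<^sub>R h) * ennreal (norm h) * indicator {0..1} t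
            \<le> ennreal (q * s) * indicator {0..1} t + u (z + t *\<^sub>R h) * ennreal s * indicator {0..1} t"
            by (auto simp: s split: split_indicator)
        qed
        also have "(\<integral>\<^sup>+t. ennreal (q * s) * indicator {0..1} t
            + u (z + t *\<^sub>R h) * ennreal s * indicator {0..1::real} t \<partial>lborel) = ennreal (q * s) + ?U z"
          by (subst nn_integral_add) (auto simp: nn_integral_cmult_indicator)
        also have "ennreal (2 * L * (\<delta> * s)) + (ennreal (q * s) + ?U z) = ennreal (2 * L * (\<delta> * s) + q * s) + ?U z"
          using L \<delta> s q by (simp add: add.assoc)
        finally show ?thesis using True by simp
      qed simp
    qed
    have "ennreal \<bar>f y - f x\<bar> * ennreal \<beta> = (\<integral>\<^sup>+z. ennreal \<bar>f y - f x\<bar> * indicator ?B z \<partial>lborel)"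
      using \<beta> by (simp add: nn_integral_cmult_indicator)
    also have "\<dots> \<le> (\<integral>\<^sup>+z. ennreal (2 * L * (\<delta> * s) + q * s) * indicator ?B z + ?U z * indicator ?B z \<partial>lborel)"
      by (rule nn_integral_mono_AE[OF pw])
    also have "\<dots> = ennreal (2 * L * (\<delta> * s) + q * s) * ennreal \<beta> + (\<integral>\<^sup>+z\<in>?B. ?U z \<partial>lborel)"
      using \<beta> by (subst nn_integral_add) (auto simp: nn_integral_cmult_indicator)
    also have "(\<integral>\<^sup>+z\<in>?B. ?U z \<partial>lborel) \<le> ennreal s * (ennreal (2 ^ ?n) * (\<integral>\<^sup>+y\<in>cball x (2 * s). u y \<partial>lborel))"
    proof (rule nn_integral_segment_le)
      fix z and t :: real assume z: "z \<in> ?B" and t: "0 \<le> t" "t \<le> 1"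
      have "dist x (z + t *\<^sub>R h) \<le> dist x z + norm (t *\<^sub>R h)"
        using dist_triangle[of x "z + t *\<^sub>R h" z] by (simp add: dist_norm)
      moreover have "norm (t *\<^sub>R h) \<le> 1 * s" using t s by (simp add: mult_left_le_one_le)
      moreover have "\<delta> * s \<le> 1 * s" using \<delta> s by (intro mult_right_mono) auto
      ultimately show "z + t *\<^sub>R h \<in> cball x (2 * s)" using z by simp
    qed auto
    also have "\<dots> \<le> ennreal s * (ennreal (2 ^ ?n) * (ennreal \<eta> * emeasure lborel (cball x (2 * s))))"
      using r0(2)[of "2 * s"] s unfolding u_def by (intro mult_left_mono) auto
    also have "emeasure lborel (cball x (2 * s)) = ennreal ((2 / \<delta>) ^ ?n * \<beta>)"
    proof -
      have "ennreal \<beta> = ennreal (unit_ball_vol (real ?n) * (\<delta> * s) ^ ?n)"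
        using emeasure_ball[of "\<delta> * s" x] B0 \<beta> by simp
      then have "\<beta> = unit_ball_vol (real ?n) * (\<delta> * s) ^ ?n"
        using \<beta> B0 by (subst (asm) ennreal_inj) auto
      then have "(2 / \<delta>) ^ ?n * \<beta> = unit_ball_vol (real ?n) * (2 * s) ^ ?n"
        using \<delta> by (simp add: power_mult_distrib power_divide)
      then show ?thesis using s by (simp add: emeasure_cball)
    qed
    also have "ennreal s * (ennreal (2 ^ ?n) * (ennreal \<eta> * ennreal ((2 / \<delta>) ^ ?n * \<beta>))) = ennreal (e / 2 * s * \<beta>)"
    proof -
      have "(2::real) ^ ?n * (\<delta> / 4) ^ ?n * (2 / \<delta>) ^ ?n = 1"
        using \<delta> by (simp add: power_mult_distrib[symmetric])
      then have "s * (2 ^ ?n * (\<eta> * ((2 / \<delta>) ^ ?n * \<beta>))) = e / 2 * s * \<beta>"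
        by (simp add: \<eta>_def mult_ac)
      moreover have "ennreal s * (ennreal (2 ^ ?n) * (ennreal \<eta> * ennreal ((2 / \<delta>) ^ ?n * \<beta>)))
          = ennreal (s * (2 ^ ?n * (\<eta> * ((2 / \<delta>) ^ ?n * \<beta>))))"
        using s \<eta> \<delta> \<beta> by (simp add: ennreal_mult[symmetric])
      ultimately show ?thesis by (simp only:)
    qed
    finally have "ennreal \<bar>f y - f x\<bar> * ennreal \<beta>
        \<le> ennreal (2 * L * (\<delta> * s) + q * s) * ennreal \<beta> + ennreal (e / 2 * s * \<beta>)"
      by (simp add: add_left_mono)
    also have "\<dots> = ennreal ((2 * L * (\<delta> * s) + q * s) * \<beta> + e / 2 * s * \<beta>)"
      using L \<delta> s q \<beta> e by (simp add: ennreal_mult[symmetric] ennreal_plus[symmetric] del: ennreal_plus)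
    also have "ennreal \<bar>f y - f x\<bar> * ennreal \<beta> = ennreal (\<bar>f y - f x\<bar> * \<beta>)"
      using \<beta> by (simp add: ennreal_mult)
    finally have "\<bar>f y - f x\<bar> * \<beta> \<le> (2 * L * (\<delta> * s) + q * s) * \<beta> + e / 2 * s * \<beta>"
      by (rule ennreal_le_iff[THEN iffD1, rotated]) (use L \<delta> s q \<beta> e in simp)
    also have "\<dots> = (2 * L * \<delta> + q + e / 2) * s * \<beta>" by (simp add: algebra_simps)
    also have "\<dots> \<le> (q + e) * s * \<beta>" using L\<delta> s \<beta> by (intro mult_right_mono) auto
    finally have "\<bar>f y - f x\<bar> \<le> (q + e) * s" using \<beta> by simp
    then show "ennreal (dist (f y) (f x)) \<le> ennreal ((q + e) * dist y x)"
      by (intro ennreal_leI) (simp add: s_def dist_real_def)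
  qed
qed

text \<open>The A_p Hoelder estimate turns local p-integrability for the weighted measure into local
  Lebesgue integrability of g, which \<open>AE_excess_averages\<close> requires. The resulting local
  statements are joined by a countable subcover.\<close>

lemma AE_slope_le_upper_gradient:
  fixes w :: "'a::euclidean_space \<Rightarrow> real"
  assumes Ap: "Ap_weight p w" and p: "1 < p" and dbl: "doubling (weighted w)"
    and g: "upper_gradient p (weighted w) f g"
    and gp: "locally_Lp p (weighted w) g"
    and f: "L-lipschitz_on UNIV f"
  shows "AE x in lborel. slope f x \<le> g x"
proof -
  let ?M = "weighted w"
  have [measurable]: "g \<in> borel_measurable borel" using g by (simp add: upper_gradient_def)
  obtain C where C: "0 < C" and H: "\<And>x R g a. 0 < R \<Longrightarrow> g \<in> borel_measurable borel \<Longrightarrow> 0 < a \<Longrightarrow>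
    (\<integral>\<^sup>+y\<in>ball x R. ennpowr (g y) p \<partial>?M) \<le> ennreal (a powr p) * emeasure ?M (ball x R) \<Longrightarrow>
    (\<integral>\<^sup>+y\<in>ball x R. g y \<partial>lborel) \<le> ennreal (C * a) * emeasure lborel (ball x R)"
    using Ap_weight_Hoelder[OF Ap p dbl] by blast
  obtain R where R: "\<And>x. 0 < R x" "\<And>x. (\<integral>\<^sup>+y\<in>ball x (R x). ennpowr (g y) p \<partial>?M) < \<infinity>"
    using gp unfolding locally_Lp_def by metis
  have loc: "AE x in lborel. x \<in> ball x0 (R x0) \<longrightarrow> slope f x \<le> g x" for x0
  proof -
    let ?U = "ball x0 (R x0)"
    have "0 < emeasure ?M ?U" "emeasure ?M ?U < \<infinity>" using dbl R(1)[of x0] by (auto simp: doubling_def)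
    then obtain m where m: "0 < m" "emeasure ?M ?U = ennreal m" by (cases "emeasure ?M ?U") auto
    obtain I where I: "0 \<le> I" "(\<integral>\<^sup>+y\<in>?U. ennpowr (g y) p \<partial>?M) = ennreal I"
      using R(2)[of x0] by (cases "\<integral>\<^sup>+y\<in>?U. ennpowr (g y) p \<partial>?M") auto
    define a where "a = (I / m) powr (1 / p) + 1"
    have a: "0 < a" by (simp add: a_def add_nonneg_pos)
    have "((I / m) powr (1 / p)) powr p \<le> a powr p" using p by (intro powr_mono2) (auto simp: a_def)
    then have "I / m \<le> a powr p" using p I m by (simp add: powr_powr)
    then have "I \<le> a powr p * m" using m by (simp add: pos_divide_le_eq)
    then have "(\<integral>\<^sup>+y\<in>?U. ennpowr (g y) p \<partial>?M) \<le> ennreal (a powr p) * emeasure ?M ?U"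
      using I m by (simp add: ennreal_mult[symmetric] ennreal_leI)
    then have "(\<integral>\<^sup>+y\<in>?U. g y \<partial>lborel) \<le> ennreal (C * a) * emeasure lborel ?U"
      using H[OF R(1) _ a] by simp
    also have "\<dots> < \<infinity>" using emeasure_lborel_ball_pos(2)[OF R(1), of x0 x0] by (simp add: ennreal_mult_less_top)
    finally have fin: "(\<integral>\<^sup>+y\<in>?U. g y \<partial>lborel) < \<infinity>" .
    have "g \<in> borel_measurable borel" by measurable
    from AE_excess_averages[OF this open_ball fin] show ?thesis
    proof (eventually_elim, intro impI)
      fix x assume "x \<in> ?U \<longrightarrow> (\<forall>q\<in>\<rat>. 0 \<le> q \<longrightarrow> g x < ennreal q \<longrightarrow> vanishing_averages (\<lambda>y. g y - ennreal q) x)"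
        and "x \<in> ?U"
      then show "slope f x \<le> g x"
        by (intro slope_le_of_segments[OF _ f AE_segment_upper_gradient[OF Ap p dbl g]]) auto
    qed
  qed
  obtain F' where F': "F' \<subseteq> (\<lambda>x. ball x (R x)) ` UNIV" "countable F'" "\<Union>F' = \<Union>((\<lambda>x. ball x (R x)) ` UNIV)"
    by (rule Lindelof[of "(\<lambda>x. ball x (R x)) ` UNIV"]) auto
  have "\<Union>((\<lambda>x. ball x (R x)) ` UNIV) = UNIV" using R(1) by (auto intro: centre_in_ball[THEN iffD2])
  then have cov: "\<Union>F' = UNIV" using F' by simp
  have "AE x in lborel. \<forall>V\<in>F'. x \<in> V \<longrightarrow> slope f x \<le> g x"
    using F' loc by (subst AE_ball_countable) auto
  then show ?thesis
    by (rule AE_mp) (use cov in \<open>auto intro!: AE_I2\<close>)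
qed

section \<open>The weak gradients in the two ranges of p\<close>

lemma modulus_empty: "0 < p \<Longrightarrow> modulus p M {} = 0"
  by (intro modulus_zeroI bexI[of _ "\<lambda>_. 0"]) auto

text \<open>For the zero function the upper gradient inequality can fail only on curves with
  different end points, which are nonconstant.\<close>

lemma is_weak_gradient_zero:
  assumes p: "0 < p" and m: "modulus p M nonconstant_ac_curves = 0"
  shows "is_weak_gradient p M f (\<lambda>_. 0)"
proof -
  have "modulus p M {c \<in> ac_curves. \<not> (case c of (a, b, \<gamma>) \<Rightarrow>
      ennreal \<bar>f (\<gamma> b) - f (\<gamma> a)\<bar> \<le> curve_integral (a, b, \<gamma>) (\<lambda>_. 0))} = 0"
  proof (rule modulus_zero_subset[OF m], intro subsetI)
    fix c assume c: "c \<in> {c \<in> ac_curves. \<not> (case c of (a, b, \<gamma>) \<Rightarrow>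
      ennreal \<bar>f (\<gamma> b) - f (\<gamma> a)\<bar> \<le> curve_integral (a, b, \<gamma>) (\<lambda>_. 0))}"
    obtain a b \<gamma> where cc: "c = (a, b, \<gamma>)" by (cases c)
    have "\<not> \<gamma> constant_on {a..b}"
    proof
      assume "\<gamma> constant_on {a..b}"
      moreover have "a \<in> {a..b}" "b \<in> {a..b}" using c by (auto simp: cc ac_curves_def)
      ultimately have "\<gamma> a = \<gamma> b" unfolding constant_on_def by metis
      then show False using c by (simp add: cc)
    qed
    then show "c \<in> nonconstant_ac_curves" using c by (simp add: cc nonconstant_ac_curves_def)
  qed
  then have "upper_gradient p M f (\<lambda>_. 0)" by (simp add: upper_gradient_def ae_curve_def)
  moreover have "locally_Lp p M (\<lambda>_. 0)" using p by (auto simp: locally_Lp_def intro: exI[of _ 1])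
  ultimately show ?thesis by (simp add: is_weak_gradient_def)
qed

lemma is_weak_gradient_slope:
  fixes w :: "'a::euclidean_space \<Rightarrow> real"
  assumes Ap: "Ap_weight p w" and p: "1 < p" and dbl: "doubling (weighted w)"
    and f: "L-lipschitz_on UNIV f"
  shows "is_weak_gradient p (weighted w) f (slope f)"
proof -
  let ?M = "weighted w"
  have [measurable]: "w \<in> borel_measurable borel" using Ap by (auto simp: Ap_weight_def)
  have L: "0 \<le> L" using f by (rule lipschitz_on_nonneg)
  have sm[measurable]: "slope f \<in> borel_measurable borel"
    unfolding slope_eq_pointwise_lip using f by (intro pointwise_lip_measurable lipschitz_on_continuous_on)
  let ?E = "{c \<in> ac_curves. \<not> (case c of (a, b, \<gamma>) \<Rightarrow>
      ennreal \<bar>f (\<gamma> b) - f (\<gamma> a)\<bar> \<le> curve_integral (a, b, \<gamma>) (slope f))}"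
  have E: "?E = {}"
    using curve_integral_slope[OF _ f] by auto
  have "modulus p ?M ?E = 0" unfolding E using p by (intro modulus_empty) simp
  then have "upper_gradient p ?M f (slope f)"
    using sm by (simp add: upper_gradient_def ae_curve_def)
  moreover have "locally_Lp p ?M (slope f)"
    unfolding locally_Lp_def
  proof (intro allI exI[of _ 1] conjI)
    fix x :: 'a
    have "(\<integral>\<^sup>+y\<in>ball x 1. ennpowr (slope f y) p \<partial>?M) \<le> (\<integral>\<^sup>+y. ennreal (L powr p) * indicator (ball x 1) y \<partial>?M)"
    proof (intro nn_integral_mono mult_right_mono)
      fix y
      have "ennpowr (slope f y) p \<le> ennpowr (ennreal L) p"
        unfolding slope_eq_pointwise_lip using p by (intro ennpowr_mono pointwise_lip_lipschitz[OF f]) auto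
      then show "ennpowr (slope f y) p \<le> ennreal (L powr p)" using L p by (simp add: ennpowr_ennreal)
    qed simp
    also have "\<dots> = ennreal (L powr p) * emeasure ?M (ball x 1)"
      by (rule nn_integral_cmult_indicator) auto
    also have "\<dots> < \<infinity>" using dbl by (simp add: ennreal_mult_less_top doubling_def)
    finally show "(\<integral>\<^sup>+y\<in>ball x 1. ennpowr (slope f y) p \<partial>?M) < \<infinity>" .
  qed simp
  moreover have "AE x in ?M. slope f x \<le> g x" if "upper_gradient p ?M f g" "locally_Lp p ?M g" for g
    using AE_slope_le_upper_gradient[OF Ap p dbl that f] by (subst AE_density) auto
  ultimately show ?thesis by (simp add: is_weak_gradient_def)
qed

theorem theorem1:
  fixes \<alpha> :: real
  assumes "\<alpha> > 0"
  shows "\<exists>w :: real ^ 'n \<Rightarrow> real.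
    w \<in> borel_measurable borel \<and> (\<forall>x. 0 \<le> w x) \<and>
    (let \<mu> = density lborel (\<lambda>x. ennreal (w x)) in
      doubling \<mu> \<and>
      (\<forall>p. 1 \<le> p \<and> p \<le> 1 + \<alpha> \<longrightarrow> modulus p \<mu> nonconstant_ac_curves = 0) \<and>
      (\<forall>p. 1 < p \<and> p \<le> 1 + \<alpha> \<longrightarrow>
        (\<forall>f :: real ^ 'n \<Rightarrow> real.
           \<exists>G. is_weak_gradient p \<mu> f G \<and> (AE x in \<mu>. G x = 0))) \<and>
      (\<forall>p. 1 + \<alpha> < p \<longrightarrow>
        Ap_weight p w \<and>
        weak_poincare p \<mu> \<and>
        (\<forall>f :: real ^ 'n \<Rightarrow> real. (\<exists>L. L-lipschitz_on UNIV f) \<longrightarrow>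
           (\<exists>G. is_weak_gradient p \<mu> f G \<and> (AE x in \<mu>. G x = slope f x)))))"
proof -
  let ?w = "weight \<alpha> :: real ^ 'n \<Rightarrow> real"
  let ?\<mu> = "density lborel (\<lambda>x. ennreal (?w x))"
  have dbl: "doubling ?\<mu>" using assms by (rule doubling_weight)
  have mod: "modulus p ?\<mu> nonconstant_ac_curves = 0" if "1 \<le> p" "p \<le> 1 + \<alpha>" for p
    by (rule modulus_nonconstant_zero[OF _ weight_le_hyperplane assms]) (use assms that in auto)
  obtain K where K: "0 < K" "\<And>(x :: real ^ 'n) R y. 0 < R \<Longrightarrow> y \<in> ball x R \<Longrightarrow>
      ennreal (?w y) * emeasure lborel (ball x R) \<le> ennreal K * emeasure ?\<mu> (ball x R)"
    using reverse_Hoelder_weight[OF assms] by blast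
  show ?thesis
    unfolding Let_def
  proof (intro exI[of _ ?w] conjI allI impI)
    fix p and f :: "real ^ 'n \<Rightarrow> real" assume "1 < p \<and> p \<le> 1 + \<alpha>"
    then show "\<exists>G. is_weak_gradient p ?\<mu> f G \<and> (AE x in ?\<mu>. G x = 0)"
      using is_weak_gradient_zero[of p ?\<mu> f] mod[of p] by (intro exI[of _ "\<lambda>_. 0"]) auto
  next
    fix p assume p: "1 + \<alpha> < p"
    then have p1: "1 < p" using assms by simp
    show Ap: "Ap_weight p ?w" using assms p by (rule Ap_weight_weight)
    show "weak_poincare p ?\<mu>" by (rule weak_poincare_Ap[OF Ap p1 dbl K])
    fix f :: "real ^ 'n \<Rightarrow> real" assume "\<exists>L. L-lipschitz_on UNIV f"
    then show "\<exists>G. is_weak_gradient p ?\<mu> f G \<and> (AE x in ?\<mu>. G x = slope f x)"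
      using is_weak_gradient_slope[OF Ap p1 dbl] by (intro exI[of _ "slope f"]) auto
  qed (use dbl mod weight_nonneg in auto)
qed

end
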